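(* Let $(R,\mathfrak m)$ be a regular local ring, or a polynomial ring $R=K[x_1,\dots,x_n]$ over a field $K$ with graded maximal ideal $\mathfrak m$, and let $I\subset\mathfrak m$ be an ideal, which is assumed to be graded if $R$ is the polynomial ring. Then the ring $R/I^k$ is Golod for all $k\gg 0$.
   Context: Let $(A,\mathfrak m_A)$ be a Noetherian local ring, or a standard graded $K$-algebra (graded, generated over $A_0=K$ by finitely many elements of degree 1) with graded maximal ideal $\mathfrak m_A$. Let $\mathbf x=x_1,\dots,x_n$ be a minimal (homogeneous, in the graded case) system of generators of $\mathfrak m_A$, let $(K(A),\partial)$ be the Koszul complex of $A$ with respect to $\mathbf x$ (a differential graded algebra, with $K_i(A)$ its component of homological degree $i$), and let $Z(A)$, $B(A)$, $H(A)$ be its cycles, boundaries and homology; $[z]$ denotes the homology class of a cycle $z$. For $a\in K_i(A)$ put $\bar a=(-1)^{i+1}a$ (extended additively). The ring $A$ is called Golod if for each subset $\mathcal S$ of (homologically) homogeneous elements of $\bigoplus_{i=1}^nH_i(A)$ there exists a function $\gamma$, defined on the set of finite sequences of elements of $\mathcal S$ and with values in $\mathfrak m_A\oplus\bigoplus_{i=1}^nK_i(A)$, such that: (G1) if $h\in\mathcal S$, then $\gamma(h)\in Z(A)$ and $h=[\gamma(h)]$; (G2) if $h_1,\dots,h_m$ is a sequence in $\mathcal S$ with $m>1$, then $$\partial\gamma(h_1,\dots,h_m)=\sum_{\ell=1}^{m-1}\overline{\gamma(h_1,\dots,h_\ell)}\,\gamma(h_{\ell+1},\dots,h_m).$$ 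*)

theory Defs
  imports "HOL-Algebra.Algebra" "HOL-Library.Poly_Mapping" "HOL-Library.Extended_Nat"
begin

section \<open>Regular local rings\<close>

definition local_ring :: "('a, 'b) ring_scheme \<Rightarrow> bool" where
  "local_ring R \<longleftrightarrow> cring R \<and> (\<exists>!M. maximalideal M R)"

definition max_ideal :: "('a, 'b) ring_scheme \<Rightarrow> 'a set" where
  "max_ideal R = (THE M. maximalideal M R)"

text \<open>Supremum of the lengths \<open>d\<close> of chains \<open>p 0 \<subset> \<dots> \<subset> p d\<close> of prime ideals.\<close>
definition krull_dim :: "('a, 'b) ring_scheme \<Rightarrow> enat" where
  "krull_dim R = Sup {enat d | d. \<exists>p :: nat \<Rightarrow> 'a set.
     (\<forall>i\<le>d. primeideal (p i) R) \<and> (\<forall>i<d. p i \<subset> p (Suc i))}"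

definition min_number_of_generators :: "('a, 'b) ring_scheme \<Rightarrow> 'a set \<Rightarrow> nat" where
  "min_number_of_generators R M =
     (LEAST d. \<exists>S \<subseteq> carrier R. finite S \<and> card S = d \<and> Idl\<^bsub>R\<^esub> S = M)"

definition regular_local_ring :: "('a, 'b) ring_scheme \<Rightarrow> bool" where
  "regular_local_ring R \<longleftrightarrow> noetherian_ring R \<and> local_ring R \<and>
     krull_dim R = enat (min_number_of_generators R (max_ideal R))"

section \<open>Gradings and polynomial rings\<close>

text \<open>A grading is given by the family \<open>G\<close> of its homogeneous components.\<close>

definition homogeneous_elements :: "(nat \<Rightarrow> 'a set) \<Rightarrow> 'a set" where
  "homogeneous_elements G = (\<Union>i. G i)"

definition graded_ideal :: "('a, 'b) ring_scheme \<Rightarrow> (nat \<Rightarrow> 'a set) \<Rightarrow> 'a set \<Rightarrow> bool" where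
  "graded_ideal R G I \<longleftrightarrow> ideal I R \<and> Idl\<^bsub>R\<^esub> (I \<inter> homogeneous_elements G) = I"

definition graded_max_ideal :: "('a, 'b) ring_scheme \<Rightarrow> (nat \<Rightarrow> 'a set) \<Rightarrow> 'a set" where
  "graded_max_ideal R G = Idl\<^bsub>R\<^esub> (\<Union>i\<in>{1..}. G i)"

definition quotient_grading ::
    "('a, 'b) ring_scheme \<Rightarrow> (nat \<Rightarrow> 'a set) \<Rightarrow> 'a set \<Rightarrow> nat \<Rightarrow> 'a set set" where
  "quotient_grading R G I i = (\<lambda>a. I +>\<^bsub>R\<^esub> a) ` G i"

text \<open>
  The polynomial ring in the variables with indices \<open>0, \<dots>, n - 1\<close> over the field given by the
  type \<open>'k\<close>. A monomial is its exponent vector, of type \<open>nat \<Rightarrow>\<^sub>0 nat\<close>; the ring operations are the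
  convolution operations of \<open>Poly_Mapping\<close>.
\<close>
definition polynomial_ring :: "nat \<Rightarrow> ((nat \<Rightarrow>\<^sub>0 nat) \<Rightarrow>\<^sub>0 'k::field) ring" where
  "polynomial_ring n =
     \<lparr>carrier = {p. \<forall>m\<in>Poly_Mapping.keys p. Poly_Mapping.keys m \<subseteq> {..<n}},
      monoid.mult = (*), one = 1, ring.zero = 0, add = (+)\<rparr>"

definition polynomial_grading :: "nat \<Rightarrow> nat \<Rightarrow> ((nat \<Rightarrow>\<^sub>0 nat) \<Rightarrow>\<^sub>0 'k::field) set" where
  "polynomial_grading n d = {p \<in> carrier (polynomial_ring n).
     \<forall>m\<in>Poly_Mapping.keys p. (\<Sum>i\<in>Poly_Mapping.keys m. Poly_Mapping.lookup m i) = d}"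

section \<open>The Koszul complex\<close>

text \<open>
  The Koszul algebra on \<open>xs = [x\<^sub>0, \<dots>, x\<^sub>n\<^sub>-\<^sub>1]\<close> is the exterior algebra of the free module with
  basis \<open>e\<^sub>0, \<dots>, e\<^sub>n\<^sub>-\<^sub>1\<close>. An element \<open>a\<close> stands for the sum of the \<open>a U e\<^sub>U\<close> over all
  \<open>U \<subseteq> {..<n}\<close>, where \<open>e\<^sub>U\<close> is the product of the \<open>e\<^sub>u\<close>, \<open>u \<in> U\<close>, in increasing order.
\<close>

definition signed :: "('a, 'b) ring_scheme \<Rightarrow> nat \<Rightarrow> 'a \<Rightarrow> 'a" where
  "signed A k a = (if even k then a else \<ominus>\<^bsub>A\<^esub> a)"

text \<open>For disjoint \<open>S\<close> and \<open>T\<close> one has \<open>e\<^sub>S e\<^sub>T = (-1)^(inversions S T) e\<^sub>S\<^sub>\<union>\<^sub>T\<close>.\<close>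
definition inversions :: "nat set \<Rightarrow> nat set \<Rightarrow> nat" where
  "inversions S T = card {(s, t). s \<in> S \<and> t \<in> T \<and> t < s}"

definition koszul_algebra :: "('a, 'b) ring_scheme \<Rightarrow> 'a list \<Rightarrow> (nat set \<Rightarrow> 'a) ring" where
  "koszul_algebra A xs =
     \<lparr>carrier = Pow {..<length xs} \<rightarrow>\<^sub>E carrier A,
      monoid.mult = (\<lambda>a b. \<lambda>U\<in>Pow {..<length xs}.
        \<Oplus>\<^bsub>A\<^esub>S\<in>Pow U. signed A (inversions S (U - S)) (a S \<otimes>\<^bsub>A\<^esub> b (U - S))),
      one = (\<lambda>U\<in>Pow {..<length xs}. if U = {} then \<one>\<^bsub>A\<^esub> else \<zero>\<^bsub>A\<^esub>),
      ring.zero = (\<lambda>U\<in>Pow {..<length xs}. \<zero>\<^bsub>A\<^esub>),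
      add = (\<lambda>a b. \<lambda>U\<in>Pow {..<length xs}. a U \<oplus>\<^bsub>A\<^esub> b U)\<rparr>"

definition koszul_component ::
    "('a, 'b) ring_scheme \<Rightarrow> 'a list \<Rightarrow> nat \<Rightarrow> (nat set \<Rightarrow> 'a) set" where
  "koszul_component A xs i = {a \<in> carrier (koszul_algebra A xs).
     \<forall>U\<in>Pow {..<length xs}. card U \<noteq> i \<longrightarrow> a U = \<zero>\<^bsub>A\<^esub>}"

text \<open>
  \<open>\<partial> e\<^sub>V\<close> is the sum over \<open>j \<in> V\<close> of \<open>(-1)^card {v \<in> V. v < j} x\<^sub>j e\<^sub>V\<^sub>-\<^sub>{\<^sub>j\<^sub>}\<close>; the definition below
  collects the coefficient of \<open>e\<^sub>U\<close>, to which \<open>V = insert j U\<close> with \<open>j \<notin> U\<close> contributes.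
\<close>
definition koszul_diff ::
    "('a, 'b) ring_scheme \<Rightarrow> 'a list \<Rightarrow> (nat set \<Rightarrow> 'a) \<Rightarrow> (nat set \<Rightarrow> 'a)" where
  "koszul_diff A xs a = (\<lambda>U\<in>Pow {..<length xs}.
     \<Oplus>\<^bsub>A\<^esub>j\<in>{..<length xs} - U. signed A (card {u\<in>U. u < j}) (xs ! j \<otimes>\<^bsub>A\<^esub> a (insert j U)))"

text \<open>The additive extension of \<open>a \<mapsto> (-1)^(i+1) a\<close> for \<open>a\<close> of homological degree \<open>i\<close>.\<close>
definition koszul_bar ::
    "('a, 'b) ring_scheme \<Rightarrow> 'a list \<Rightarrow> (nat set \<Rightarrow> 'a) \<Rightarrow> (nat set \<Rightarrow> 'a)" where
  "koszul_bar A xs a = (\<lambda>U\<in>Pow {..<length xs}. signed A (card U + 1) (a U))"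

definition koszul_cycles :: "('a, 'b) ring_scheme \<Rightarrow> 'a list \<Rightarrow> (nat set \<Rightarrow> 'a) set" where
  "koszul_cycles A xs =
     {a \<in> carrier (koszul_algebra A xs). koszul_diff A xs a = \<zero>\<^bsub>koszul_algebra A xs\<^esub>}"

definition koszul_boundaries :: "('a, 'b) ring_scheme \<Rightarrow> 'a list \<Rightarrow> (nat set \<Rightarrow> 'a) set" where
  "koszul_boundaries A xs = koszul_diff A xs ` carrier (koszul_algebra A xs)"

definition homology_class ::
    "('a, 'b) ring_scheme \<Rightarrow> 'a list \<Rightarrow> (nat set \<Rightarrow> 'a) \<Rightarrow> (nat set \<Rightarrow> 'a) set" where
  "homology_class A xs z = koszul_boundaries A xs +>\<^bsub>koszul_algebra A xs\<^esub> z"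

text \<open>
  \<open>H\<^sub>i\<close> as a subset of the total homology: classes are cosets of all boundaries, so that
  the zero elements of the different \<open>H\<^sub>i\<close> coincide.
\<close>
definition koszul_homology ::
    "('a, 'b) ring_scheme \<Rightarrow> 'a list \<Rightarrow> nat \<Rightarrow> (nat set \<Rightarrow> 'a) set set" where
  "koszul_homology A xs i =
     homology_class A xs ` (koszul_cycles A xs \<inter> koszul_component A xs i)"

section \<open>Golod rings\<close>

definition minimal_generators :: "('a, 'b) ring_scheme \<Rightarrow> 'a set \<Rightarrow> 'a list \<Rightarrow> bool" where
  "minimal_generators A M xs \<longleftrightarrow> set xs \<subseteq> carrier A \<and> Idl\<^bsub>A\<^esub> (set xs) = M \<and>
     (\<forall>i<length xs. Idl\<^bsub>A\<^esub> {xs ! j | j. j < length xs \<and> j \<noteq> i} \<noteq> M)"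

text \<open>
  An element of \<open>M \<oplus> K\<^sub>1 \<oplus> \<dots> \<oplus> K\<^sub>n\<close> is an element of the Koszul algebra whose coefficient at
  \<open>e\<^sub>{\<^sub>} = 1\<close> lies in \<open>M\<close>.
\<close>
definition golod_wrt :: "('a, 'b) ring_scheme \<Rightarrow> 'a set \<Rightarrow> 'a list \<Rightarrow> bool" where
  "golod_wrt A M xs \<longleftrightarrow>
     (\<forall>S \<subseteq> (\<Union>i\<in>{1..length xs}. koszul_homology A xs i).
       \<exists>\<gamma> :: (nat set \<Rightarrow> 'a) set list \<Rightarrow> (nat set \<Rightarrow> 'a).
         (\<forall>hs\<in>lists S. \<gamma> hs \<in> carrier (koszul_algebra A xs) \<and> \<gamma> hs {} \<in> M) \<and>
         (\<forall>h\<in>S. \<gamma> [h] \<in> koszul_cycles A xs \<and> h = homology_class A xs (\<gamma> [h])) \<and>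
         (\<forall>hs\<in>lists S. length hs > 1 \<longrightarrow>
           koszul_diff A xs (\<gamma> hs) =
             (\<Oplus>\<^bsub>koszul_algebra A xs\<^esub>l\<in>{1..length hs - 1}.
               koszul_bar A xs (\<gamma> (take l hs)) \<otimes>\<^bsub>koszul_algebra A xs\<^esub> \<gamma> (drop l hs))))"

text \<open>The Koszul complex depends on a choice of generators; the condition is imposed for each choice.\<close>

definition golod_local :: "('a, 'b) ring_scheme \<Rightarrow> bool" where
  "golod_local A \<longleftrightarrow>
     (\<forall>xs. minimal_generators A (max_ideal A) xs \<longrightarrow> golod_wrt A (max_ideal A) xs)"

definition golod_graded :: "('a, 'b) ring_scheme \<Rightarrow> (nat \<Rightarrow> 'a set) \<Rightarrow> bool" where
  "golod_graded A G \<longleftrightarrow>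
     (\<forall>xs. minimal_generators A (graded_max_ideal A G) xs \<and> set xs \<subseteq> homogeneous_elements G
       \<longrightarrow> golod_wrt A (graded_max_ideal A G) xs)"

section \<open>Powers of ideals\<close>

abbreviation ideal_power :: "('a, 'b) ring_scheme \<Rightarrow> 'a set \<Rightarrow> nat \<Rightarrow> 'a set" where
  "ideal_power R I k \<equiv> I [^]\<^bsub>ideals_set R\<^esub> k"

end

theory Submission
  imports Defs
begin

text \<open>
  Let \<open>x\<close> generate the maximal ideal \<open>m\<close> of \<open>R\<close> minimally. Since \<open>x\<close> is a regular sequence, the Koszul
  complex of \<open>R\<close> is exact in positive degrees. A cycle of \<open>K(R/I\<^sup>k)\<close> lifts to an element \<open>z\<close> of \<open>K(R)\<close>
  whose boundary has coefficients in \<open>I\<^sup>k\<close>; by the Artin-Rees lemma it is the boundary of some \<open>w\<close> with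
  coefficients in \<open>I\<^sup>k\<^sup>-\<^sup>r\<close>, and \<open>z - w\<close> is a cycle, hence a boundary. So every homology class
  of positive degree has a representative with coefficients in \<open>I\<^sup>k\<^sup>-\<^sup>r\<close>. For \<open>k \<ge> 2r\<close> any
  product of two such representatives vanishes, and one may take \<open>\<gamma>\<close> to be zero on all sequences of
  length at least two.
\<close>

section \<open>Localization at a prime and the principal ideal theorem\<close>

locale noetherian_cring = noetherian_ring R + cring R for R (structure)

lemma (in cring) idealI':
  assumes "I \<subseteq> carrier R" "\<zero> \<in> I" "\<And>x y. x \<in> I \<Longrightarrow> y \<in> I \<Longrightarrow> x \<oplus> y \<in> I"
    "\<And>r x. r \<in> carrier R \<Longrightarrow> x \<in> I \<Longrightarrow> r \<otimes> x \<in> I"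
  shows "ideal I R"
proof (rule idealI)
  show "ring R" by (rule ring_axioms)
  show "subgroup I (add_monoid R)"
  proof
    fix x assume x: "x \<in> I"
    then have "(\<ominus> \<one>) \<otimes> x \<in> I" using assms(4) by auto
    then have "\<ominus> x \<in> I" using x assms(1) by (auto simp: l_minus subset_iff)
    then show "inv\<^bsub>add_monoid R\<^esub> x \<in> I" by (simp add: a_inv_def)
  qed (use assms in auto)
  fix a x assume "a \<in> I" "x \<in> carrier R"
  then show "x \<otimes> a \<in> I" "a \<otimes> x \<in> I" using assms(1,4) m_comm[of a x] by (auto simp: subset_iff)
qed

lemma (in ring) ideal_simps:
  assumes "ideal I R"
  shows "\<zero> \<in> I" "\<And>x y. x \<in> I \<Longrightarrow> y \<in> I \<Longrightarrow> x \<oplus> y \<in> I"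
    "\<And>x y. x \<in> I \<Longrightarrow> y \<in> I \<Longrightarrow> x \<ominus> y \<in> I" "\<And>x. x \<in> I \<Longrightarrow> \<ominus> x \<in> I"
    "\<And>r x. r \<in> carrier R \<Longrightarrow> x \<in> I \<Longrightarrow> r \<otimes> x \<in> I"
    "\<And>r x. r \<in> carrier R \<Longrightarrow> x \<in> I \<Longrightarrow> x \<otimes> r \<in> I" "I \<subseteq> carrier R" "\<And>x. x \<in> I \<Longrightarrow> x \<in> carrier R"
proof -
  interpret ideal I R by fact
  show "\<zero> \<in> I" "I \<subseteq> carrier R" "\<And>x y. x \<in> I \<Longrightarrow> y \<in> I \<Longrightarrow> x \<oplus> y \<in> I"
    "\<And>x. x \<in> I \<Longrightarrow> \<ominus> x \<in> I" "\<And>x. x \<in> I \<Longrightarrow> x \<in> carrier R" 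
    "\<And>x y. x \<in> I \<Longrightarrow> y \<in> I \<Longrightarrow> x \<ominus> y \<in> I"
    by (auto simp: a_subset minus_eq)
  show "\<And>r x. r \<in> carrier R \<Longrightarrow> x \<in> I \<Longrightarrow> r \<otimes> x \<in> I"
    "\<And>r x. r \<in> carrier R \<Longrightarrow> x \<in> I \<Longrightarrow> x \<otimes> r \<in> I" by (auto simp: I_l_closed I_r_closed)
qed

lemma (in cring) Idl_mono:
  "U \<subseteq> V \<Longrightarrow> V \<subseteq> carrier R \<Longrightarrow> Idl U \<subseteq> Idl V"
  by (intro genideal_minimal genideal_ideal) (use genideal_self[of V] in auto)

lemma (in cring) Idl_eq: "ideal I R \<Longrightarrow> Idl I = I"
  by (intro subset_antisym genideal_minimal genideal_self) (auto dest: ideal_simps(8))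

lemma (in cring) Idl_Un_Idl:
  assumes "U \<subseteq> carrier R" "Y \<subseteq> carrier R"
  shows "Idl (Idl U \<union> Y) = Idl (U \<union> Y)"
proof
  show "Idl (Idl U \<union> Y) \<subseteq> Idl (U \<union> Y)"
    using assms by (intro genideal_minimal genideal_ideal Un_least Idl_mono)
      (auto intro: genideal_self[THEN subsetD])
  show "Idl (U \<union> Y) \<subseteq> Idl (Idl U \<union> Y)"
    using assms genideal_self[of U] genideal_ideal[of U] by (intro Idl_mono) (auto dest: ideal_simps(8))
qed

lemma (in cring) Idl_Un:
  assumes "ideal I R" "ideal J R"
  shows "Idl (I \<union> J) = {a \<oplus> b | a b. a \<in> I \<and> b \<in> J}"
  using union_genideal[OF assms] unfolding set_add_def' by auto

lemma (in cring) ideal_mult_elem: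
  assumes "ideal I R" "x \<in> carrier R"
  shows "ideal {i \<otimes> x | i. i \<in> I} R"
proof (rule idealI')
  note I = ideal_simps[OF assms(1)]
  show "{i \<otimes> x |i. i \<in> I} \<subseteq> carrier R" using I(8) assms(2) by auto
  show "\<zero> \<in> {i \<otimes> x |i. i \<in> I}" using I(1) assms(2) by (auto intro!: exI[of _ \<zero>])
  fix u v assume "u \<in> {i \<otimes> x |i. i \<in> I}" "v \<in> {i \<otimes> x |i. i \<in> I}"
  then obtain i j where "i \<in> I" "j \<in> I" "u = i \<otimes> x" "v = j \<otimes> x" by auto
  then show "u \<oplus> v \<in> {i \<otimes> x |i. i \<in> I}"
    using I assms(2) by (auto intro!: exI[of _ "i \<oplus> j"] simp: l_distr)
next
  note I = ideal_simps[OF assms(1)]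
  fix r u assume r: "r \<in> carrier R" and "u \<in> {i \<otimes> x |i. i \<in> I}"
  then obtain i where "i \<in> I" "u = i \<otimes> x" by auto
  then show "r \<otimes> u \<in> {i \<otimes> x |i. i \<in> I}"
    using r I assms(2) by (auto simp: m_assoc intro!: exI[of _ "r \<otimes> i"])
qed

lemma (in cring) Idl_insert:
  assumes "U \<subseteq> carrier R" "x \<in> carrier R"
  shows "Idl (insert x U) = {r \<otimes> x \<oplus> y | r y. r \<in> carrier R \<and> y \<in> Idl U}"
proof -
  have "insert x U = {x} \<union> U" by auto
  then have "Idl (insert x U) = Idl (U \<union> {x})" by simp
  also have "\<dots> = Idl (Idl {x} \<union> Idl U)"
    using assms Idl_Un_Idl[of U "Idl {x}"] Idl_Un_Idl[of "{x}" "U"]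
    by (simp add: Un_commute genideal_ideal ideal_simps(7))
  also have "\<dots> = {a \<oplus> b | a b. a \<in> Idl {x} \<and> b \<in> Idl U}"
    using assms by (intro Idl_Un genideal_ideal) auto
  also have "Idl {x} = {r \<otimes> x | r. r \<in> carrier R}"
    using cgenideal_eq_genideal[OF assms(2)] unfolding cgenideal_def by auto
  finally show ?thesis by blast
qed

lemma (in cring) ideal_colon:
  assumes "ideal I R" "x \<in> carrier R"
  shows "ideal {y \<in> carrier R. x \<otimes> y \<in> I} R"
  by (rule idealI') (use ideal_simps[OF assms(1)] assms(2) in \<open>auto simp: r_distr m_lcomm\<close>)

text \<open>The contraction to \<open>R\<close> of the extension of \<open>N\<close> to the localization at the prime \<open>P\<close>.\<close>

definition saturation :: "('a, 'b) ring_scheme \<Rightarrow> 'a set \<Rightarrow> 'a set \<Rightarrow> 'a set" where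
  "saturation R P N = {x \<in> carrier R. \<exists>s\<in>carrier R - P. s \<otimes>\<^bsub>R\<^esub> x \<in> N}"

lemma (in cring) primeideal_compl:
  assumes "primeideal P R"
  shows "\<one> \<in> carrier R - P"
    "\<And>s t. s \<in> carrier R - P \<Longrightarrow> t \<in> carrier R - P \<Longrightarrow> s \<otimes> t \<in> carrier R - P"
proof -
  interpret P: primeideal P R by fact
  show "\<one> \<in> carrier R - P" using P.I_notcarr P.one_imp_carrier by auto
  show "\<And>s t. s \<in> carrier R - P \<Longrightarrow> t \<in> carrier R - P \<Longrightarrow> s \<otimes> t \<in> carrier R - P"
    using P.I_prime by auto
qed

lemma (in cring) saturation_ideal:
  assumes "primeideal P R" "ideal N R"
  shows "ideal (saturation R P N) R"
proof (rule idealI')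
  note N = ideal_simps[OF assms(2)] and P = primeideal_compl[OF assms(1)]
  show "saturation R P N \<subseteq> carrier R" by (auto simp: saturation_def)
  show "\<zero> \<in> saturation R P N" using N(1) P(1) by (auto simp: saturation_def)
  fix x y assume "x \<in> saturation R P N" "y \<in> saturation R P N"
  then obtain s t where x: "x \<in> carrier R" "y \<in> carrier R" and s: "s \<in> carrier R - P" "t \<in> carrier R - P"
    and "s \<otimes> x \<in> N" "t \<otimes> y \<in> N" by (auto simp: saturation_def)
  then have "t \<otimes> (s \<otimes> x) \<oplus> s \<otimes> (t \<otimes> y) \<in> N" using N by auto
  also have "t \<otimes> (s \<otimes> x) \<oplus> s \<otimes> (t \<otimes> y) = (s \<otimes> t) \<otimes> (x \<oplus> y)"
    using s x by (simp add: r_distr m_ac)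
  finally show "x \<oplus> y \<in> saturation R P N"
    using P(2)[OF s] x by (auto simp: saturation_def)
next
  note N = ideal_simps[OF assms(2)]
  fix r x assume "r \<in> carrier R" "x \<in> saturation R P N"
  then obtain s where "s \<in> carrier R - P" "s \<otimes> x \<in> N" "x \<in> carrier R"
    by (auto simp: saturation_def)
  then show "r \<otimes> x \<in> saturation R P N" using \<open>r \<in> carrier R\<close> N
    by (auto simp: saturation_def m_lcomm intro!: bexI[of _ s])
qed

lemma (in cring) saturation_superset:
  assumes "primeideal P R" "ideal N R" shows "N \<subseteq> saturation R P N"
  using primeideal_compl[OF assms(1)] ideal_simps[OF assms(2)]
  by (auto simp: saturation_def intro!: bexI[of _ \<one>])

lemma (in cring) saturation_mono: "N \<subseteq> N' \<Longrightarrow> saturation R P N \<subseteq> saturation R P N'"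
  by (auto simp: saturation_def)

lemma (in cring) saturation_cancel:
  assumes "primeideal P R" "x \<in> carrier R" "s \<in> carrier R - P" "s \<otimes> x \<in> saturation R P N"
  shows "x \<in> saturation R P N"
proof -
  obtain t where t: "t \<in> carrier R - P" "t \<otimes> (s \<otimes> x) \<in> N"
    using assms(4) by (auto simp: saturation_def)
  then have "(t \<otimes> s) \<otimes> x \<in> N" using assms by (simp add: m_assoc)
  then show ?thesis using primeideal_compl(2)[OF assms(1) t(1) assms(3)] assms(2)
    by (auto simp: saturation_def)
qed

lemma (in cring) saturation_idem:
  "primeideal P R \<Longrightarrow> saturation R P (saturation R P N) \<subseteq> saturation R P N"
  using saturation_cancel by (auto simp: saturation_def[of R P "saturation R P N"])

lemma (in cring) nakayama:
  assumes P: "primeideal P R" and N: "ideal N R" and G: "finite G" "G \<subseteq> carrier R"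
    and *: "G \<subseteq> saturation R P (Idl (N \<union> {i \<otimes> g | i g. i \<in> P \<and> g \<in> G}))"
  shows "\<exists>u\<in>carrier R - P. \<forall>g\<in>G. u \<otimes> g \<in> N"
  using G *
proof (induction G rule: finite_induct)
  case empty
  then show ?case using primeideal_compl[OF P] by auto
next
  case (insert g0 G)
  interpret P: primeideal P R by fact
  note Ns = ideal_simps[OF N] and Ps = ideal_simps[OF P.is_ideal]
  define W where "W = Idl (N \<union> {i \<otimes> g | i g. i \<in> P \<and> g \<in> G})"
  have sub: "N \<union> {i \<otimes> g | i g. i \<in> P \<and> g \<in> G} \<subseteq> carrier R"
    using Ns Ps insert.prems(1) by auto
  have W: "ideal W R" unfolding W_def by (rule genideal_ideal[OF sub])
  note Ws = ideal_simps[OF W]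
  have g0: "g0 \<in> carrier R" and Gc: "G \<subseteq> carrier R" using insert.prems by auto
  have eq: "Idl (N \<union> {i \<otimes> g | i g. i \<in> P \<and> g \<in> insert g0 G}) = {a \<oplus> b | a b. a \<in> {i \<otimes> g0 | i. i \<in> P} \<and> b \<in> W}" (is "?L = ?S")
  proof -
    have "N \<union> {i \<otimes> g | i g. i \<in> P \<and> g \<in> insert g0 G}
        = (N \<union> {i \<otimes> g | i g. i \<in> P \<and> g \<in> G}) \<union> {i \<otimes> g0 | i. i \<in> P}" by auto
    then have "?L = Idl (W \<union> {i \<otimes> g0 | i. i \<in> P})"
      unfolding W_def by (subst Idl_Un_Idl[OF sub]) (use g0 Ps in auto)
    also have "\<dots> = ?S"
      by (subst Un_commute, rule Idl_Un[OF ideal_mult_elem[OF P.is_ideal g0] W])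
    finally show ?thesis .
  qed
  have rep: "\<exists>t\<in>carrier R - P. \<exists>i\<in>P. \<exists>w\<in>W. t \<otimes> g = i \<otimes> g0 \<oplus> w" if "g \<in> insert g0 G" for g
    using subsetD[OF insert.prems(2) that] unfolding saturation_def eq by blast
  obtain t0 i0 w0 where t0: "t0 \<in> carrier R - P" "i0 \<in> P" "w0 \<in> W" "t0 \<otimes> g0 = i0 \<otimes> g0 \<oplus> w0"
    using rep[of g0] by auto
  define s where "s = t0 \<ominus> i0"
  have s: "s \<in> carrier R - P"
  proof -
    have "t0 = s \<oplus> i0" using t0 Ps by (simp add: s_def minus_eq a_assoc l_neg)
    then have "s \<in> P \<Longrightarrow> t0 \<in> P" using Ps t0 by auto
    then show ?thesis using t0 Ps by (auto simp: s_def)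
  qed
  have sg0: "s \<otimes> g0 = w0"
  proof -
    have "s \<otimes> g0 = t0 \<otimes> g0 \<ominus> i0 \<otimes> g0" 
      using t0 g0 Ps by (simp add: s_def minus_eq l_distr l_minus)
    also have "\<dots> = w0" unfolding t0(4) using t0 Ws Ps g0 
      by (simp add: minus_eq a_comm a_assoc r_neg1 a_lcomm r_neg)
    finally show ?thesis .
  qed
  have "G \<subseteq> saturation R P W"
  proof
    fix g assume g: "g \<in> G"
    then obtain t i w where t: "t \<in> carrier R - P" "i \<in> P" "w \<in> W" "t \<otimes> g = i \<otimes> g0 \<oplus> w"
      using rep[of g] by auto
    have gc: "g \<in> carrier R" using g Gc by auto
    have "(s \<otimes> t) \<otimes> g = s \<otimes> (i \<otimes> g0 \<oplus> w)" using t gc s by (simp add: m_assoc flip: t(4))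
    also have "\<dots> = i \<otimes> (s \<otimes> g0) \<oplus> s \<otimes> w" using t s g0 Ps Ws by (simp add: r_distr m_lcomm)
    also have "\<dots> \<in> W" unfolding sg0 using t s t0 Ws Ps by auto
    finally show "g \<in> saturation R P W"
      using gc primeideal_compl(2)[OF P s t(1)] by (auto simp: saturation_def)
  qed
  then obtain u where u: "u \<in> carrier R - P" "\<forall>g\<in>G. u \<otimes> g \<in> N"
    using insert.IH[OF Gc] by (auto simp: W_def)
  have uW: "u \<otimes> w \<in> N" if "w \<in> W" for w
  proof -
    have "W \<subseteq> {w \<in> carrier R. u \<otimes> w \<in> N}"
      unfolding W_def
    proof (rule genideal_minimal[OF ideal_colon[OF N]])
      show "N \<union> {i \<otimes> g |i g. i \<in> P \<and> g \<in> G} \<subseteq> {w \<in> carrier R. u \<otimes> w \<in> N}"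
        using u Ns Ps Gc by (auto simp: m_lcomm subset_iff)
    qed (use u in auto)
    then show ?thesis using that by auto
  qed
  have "(u \<otimes> s) \<otimes> g \<in> N" if "g \<in> insert g0 G" for g
  proof (cases "g = g0")
    case True
    then show ?thesis using uW[OF t0(3)] u s g0 by (simp add: m_assoc sg0)
  next
    case False
    then have "g \<in> G" using that by auto
    moreover have "(u \<otimes> s) \<otimes> g = s \<otimes> (u \<otimes> g)" using u s Gc \<open>g \<in> G\<close> by (auto simp: m_ac)
    ultimately show ?thesis using u s Ns by auto
  qed
  then show ?case using primeideal_compl(2)[OF P u(1) s] by blast
qed

lemma (in noetherian_ring) wf_ideals: "wf {(I, J). ideal I R \<and> ideal J R \<and> J \<subset> I}"
  unfolding wf_iff_no_infinite_down_chain
proof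
  assume "\<exists>f. \<forall>i. (f (Suc i), f i) \<in> {(I, J). ideal I R \<and> ideal J R \<and> J \<subset> I}"
  then obtain f where f: "\<And>i. ideal (f i) R" "\<And>i. f i \<subset> f (Suc i)" by blast
  have m: "f i \<subseteq> f j" if "i \<le> j" for i j
    using lift_Suc_mono_le[of f, OF _ that] f(2) by auto
  have "subset.chain {I. ideal I R} (range f)"
    using f(1) by (auto simp: subset_chain_def) (meson linear m subsetD)
  from ideal_chain_is_trivial[OF _ this] obtain i where "\<Union>(range f) = f i" by auto
  then show False using f(2)[of i] by auto
qed

text \<open>
  In the localization at \<open>P\<close> the quotient by \<open>N\<close> has a finite composition series: each step adjoins
  an element \<open>v\<close> killed by \<open>P\<close> modulo the previous ideal.
\<close>

inductive finite_colength :: "('a, 'b) ring_scheme \<Rightarrow> 'a set \<Rightarrow> 'a set \<Rightarrow> bool" for R P where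
  base: "\<not> N \<subseteq> P \<Longrightarrow> finite_colength R P N"
| step: "v \<in> carrier R \<Longrightarrow> (\<And>z. z \<in> P \<Longrightarrow> z \<otimes>\<^bsub>R\<^esub> v \<in> saturation R P N) \<Longrightarrow>
    finite_colength R P (Idl\<^bsub>R\<^esub> (insert v N)) \<Longrightarrow> finite_colength R P N"

lemma (in noetherian_cring) exists_socle_element:
  assumes P: "primeideal P R" and N: "ideal N R" "N \<subseteq> P"
    and min: "\<And>Q. primeideal Q R \<Longrightarrow> N \<subseteq> Q \<Longrightarrow> Q \<subseteq> P \<Longrightarrow> Q = P"
  shows "\<exists>v\<in>carrier R. v \<notin> saturation R P N \<and> (\<forall>z\<in>P. z \<otimes> v \<in> saturation R P N)"
proof -
  define T where "T = saturation R P N"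
  have T: "ideal T R" unfolding T_def by (rule saturation_ideal[OF P N(1)])
  note Ts = ideal_simps[OF T] and Pc = primeideal_compl[OF P]
  interpret P: primeideal P R by fact
  define c where "c v = {y \<in> carrier R. v \<otimes> y \<in> T}" for v
  have one: "\<one> \<notin> T"
  proof
    assume "\<one> \<in> T"
    then obtain s where "s \<in> carrier R - P" "s \<otimes> \<one> \<in> N" by (auto simp: T_def saturation_def)
    then show False using N(2) by auto
  qed
  have "\<exists>v\<in>carrier R - T. \<forall>w\<in>carrier R - T. \<not> c v \<subset> c w"
  proof (rule ccontr)
    assume *: "\<not> ?thesis"
    have "c ` (carrier R - T) \<noteq> {}" using one by auto
    define D where "D = {(I, J). ideal I R \<and> ideal J R \<and> J \<subset> I}"
    have "wf D" unfolding D_def by (rule wf_ideals)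
    from wfE_min'[OF this \<open>c ` (carrier R - T) \<noteq> {}\<close>]
    obtain z where z: "z \<in> c ` (carrier R - T)" "\<And>y. (y, z) \<in> D \<Longrightarrow> y \<notin> c ` (carrier R - T)"
      by metis
    then obtain v where v: "v \<in> carrier R - T" "z = c v" by blast
    then obtain w where w: "w \<in> carrier R - T" "c v \<subset> c w" using * by blast
    have "ideal (c v) R" "ideal (c w) R" unfolding c_def using v w by (auto intro!: ideal_colon[OF T])
    then have "c w \<notin> c ` (carrier R - T)" using z(2)[of "c w"] w v by (simp add: D_def)
    then show False using w by blast
  qed
  then obtain v where v: "v \<in> carrier R" "v \<notin> T" 
    and max: "\<And>w. w \<in> carrier R \<Longrightarrow> w \<notin> T \<Longrightarrow> \<not> c v \<subset> c w" by auto
  have cv: "ideal (c v) R" unfolding c_def using ideal_colon[OF T v(1)] .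
  have "primeideal (c v) R"
  proof (rule primeidealI[OF cv cring_axioms])
    have "\<one> \<notin> c v" using v by (simp add: c_def)
    then show "carrier R \<noteq> c v" by auto
    fix a b assume a: "a \<in> carrier R" and b: "b \<in> carrier R" and ab: "a \<otimes> b \<in> c v"
    show "a \<in> c v \<or> b \<in> c v"
    proof (rule disjCI)
      assume nb: "b \<notin> c v"
      then have bv: "v \<otimes> b \<in> carrier R" "v \<otimes> b \<notin> T" using b v by (auto simp: c_def)
      have "c v \<subseteq> c (v \<otimes> b)"
      proof
        fix y assume "y \<in> c v"
        then have "y \<in> carrier R" "v \<otimes> y \<in> T" by (auto simp: c_def)
        moreover then have "(v \<otimes> b) \<otimes> y = b \<otimes> (v \<otimes> y)" using v b by (simp add: m_ac)
        ultimately show "y \<in> c (v \<otimes> b)" using b Ts by (auto simp: c_def)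
      qed
      then have "c v = c (v \<otimes> b)" using max[OF bv] by auto
      moreover have "(v \<otimes> b) \<otimes> a = v \<otimes> (a \<otimes> b)" using v a b by (simp add: m_ac)
      ultimately show "a \<in> c v" using ab a by (auto simp: c_def)
    qed
  qed
  moreover have "N \<subseteq> c v"
    using ideal_simps[OF N(1)] v saturation_superset[OF P N(1)] Ts by (auto simp: c_def T_def)
  moreover have "c v \<subseteq> P"
  proof (rule ccontr)
    assume "\<not> c v \<subseteq> P"
    then obtain s where s: "s \<in> carrier R - P" "v \<otimes> s \<in> T" by (auto simp: c_def)
    then have "s \<otimes> v \<in> T" using v by (simp add: m_comm)
    then show False using saturation_cancel[OF P v(1) s(1)] v(2) by (auto simp: T_def)
  qed
  ultimately have "c v = P" using min by blast
  then show ?thesis using v P.Icarr by (auto simp: c_def T_def m_comm intro!: bexI[of _ v])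
qed

lemma (in noetherian_cring) finite_colengthI:
  assumes P: "primeideal P R" and N: "ideal N R"
    and min: "\<And>Q. primeideal Q R \<Longrightarrow> N \<subseteq> Q \<Longrightarrow> Q \<subseteq> P \<Longrightarrow> Q = P"
  shows "finite_colength R P N"
  using N min
proof (induction N rule: wf_induct_rule[OF wf_ideals])
  case (1 N)
  show ?case
  proof (cases "N \<subseteq> P")
    case False then show ?thesis by (rule finite_colength.base)
  next
    case True
    from exists_socle_element[OF P 1(2) True 1(3)] obtain v where v: "v \<in> carrier R"
      "v \<notin> saturation R P N" "\<forall>z\<in>P. z \<otimes> v \<in> saturation R P N" by auto
    note Ns = ideal_simps[OF 1(2)]
    have sub: "insert v N \<subseteq> Idl (insert v N)" using v Ns by (intro genideal_self) auto
    have "v \<notin> N" using v(2) saturation_superset[OF P 1(2)] by auto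
    then have lt: "N \<subset> Idl (insert v N)" using sub by auto
    have i: "ideal (Idl (insert v N)) R" using v Ns by (intro genideal_ideal) auto
    have "finite_colength R P (Idl (insert v N))"
      using lt i 1(2) 1(3) by (intro 1(1)) auto
    then show ?thesis using v finite_colength.step by metis
  qed
qed

lemma (in cring) finite_colength_dcc:
  assumes P: "primeideal P R" and len: "finite_colength R P N" and N: "ideal N R"
    and b: "\<And>n. ideal (b n) R" "\<And>n. N \<subseteq> b n" "\<And>n. b (Suc n) \<subseteq> b n" "\<And>n. saturation R P (b n) \<subseteq> b n"
  shows "\<exists>n0. \<forall>n\<ge>n0. b (Suc n) = b n"
  using len N b
proof (induction N arbitrary: b rule: finite_colength.induct)
  case (base N)
  have "b n = carrier R" for n
  proof -
    obtain s where s: "s \<in> N" "s \<notin> P" using base by auto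
    then have "s \<in> carrier R" using ideal_simps(8)[OF base(2)] by blast
    then have "\<one> \<in> saturation R P (b n)" using s base(4)[of n]
      by (auto simp: saturation_def intro!: bexI[of _ s])
    then have "\<one> \<in> b n" using base(6) by auto
    then show ?thesis using ideal.one_imp_carrier base(3) by blast
  qed
  then show ?case by auto
next
  case (step v N)
  note Ns = ideal_simps[OF step.prems(1)]
  have bs: "ideal (b n) R" for n by (rule step.prems)
  define b' where "b' n = saturation R P (Idl (insert v (b n)))" for n
  have subc: "insert v (b n) \<subseteq> carrier R" for n using step.hyps(1) ideal_simps[OF bs] by auto
  have I: "ideal (Idl (insert v (b n))) R" for n by (rule genideal_ideal[OF subc])
  have b'_ideal: "ideal (b' n) R" for n unfolding b'_def by (rule saturation_ideal[OF P I])
  have "\<exists>n0. \<forall>n\<ge>n0. b' (Suc n) = b' n"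
  proof (rule step.IH)
    show "ideal (Idl (insert v N)) R" using Ns step.hyps by (intro genideal_ideal) auto
    show "Idl (insert v N) \<subseteq> b' n" for n
      unfolding b'_def using step.prems(3) 
      by (intro order_trans[OF _ saturation_superset[OF P I]] Idl_mono subc) auto
    show "b' (Suc n) \<subseteq> b' n" for n
      unfolding b'_def using step.prems(4) by (intro saturation_mono Idl_mono subc) auto
    show "saturation R P (b' n) \<subseteq> b' n" for n
      unfolding b'_def by (rule saturation_idem[OF P])
  qed (rule b'_ideal)
  then obtain n0 where n0: "\<And>n. n \<ge> n0 \<Longrightarrow> b' (Suc n) = b' n" by auto
  have anti: "b n \<subseteq> b m" if "m \<le> n" for m n
    using lift_Suc_antimono_le[of b, OF _ that] step.prems(4) by auto
  show ?case
  proof (cases "\<forall>n. v \<in> b n")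
    case True
    have "b' n = b n" for n
    proof -
      have "Idl (insert v (b n)) = b n" using True Idl_eq[OF bs] by (simp add: insert_absorb)
      then show ?thesis unfolding b'_def using step.prems(5)[of n] saturation_superset[OF P bs] by auto
    qed
    then show ?thesis using n0 by auto
  next
    case False
    then obtain n1 where n1: "v \<notin> b n1" by auto
    have "b n \<subseteq> b (Suc n)" if n: "n \<ge> max n0 n1" for n
    proof
      fix e assume e: "e \<in> b n"
      note bn = ideal_simps[OF bs[of n]] and bSn = ideal_simps[OF bs[of "Suc n"]]
      have vn: "v \<notin> b n" using anti[of n1 n] n n1 by auto
      have "b n \<subseteq> b' n" unfolding b'_def
        using genideal_self[OF subc[of n]] saturation_superset[OF P I[of n]] by auto
      then have "e \<in> b' (Suc n)" using n0[of n] n e by auto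
      then obtain s where s: "s \<in> carrier R - P" "s \<otimes> e \<in> Idl (insert v (b (Suc n)))"
        by (auto simp: b'_def saturation_def)
      then obtain c f where c: "c \<in> carrier R" "f \<in> b (Suc n)" "s \<otimes> e = c \<otimes> v \<oplus> f"
        using Idl_insert[OF bSn(7) step.hyps(1)] Idl_eq[OF bs[of "Suc n"]] by auto
      have fn: "f \<in> b n" using c(2) step.prems(4) by auto
      have cv: "c \<otimes> v = s \<otimes> e \<ominus> f" unfolding c(3)
        using c fn bn step.hyps(1) by (simp add: minus_eq a_assoc r_neg)
      then have "c \<otimes> v \<in> b n" using e s fn bn by auto
      have "c \<in> P"
      proof (rule ccontr)
        assume "c \<notin> P"
        then have "v \<in> saturation R P (b n)" using \<open>c \<otimes> v \<in> b n\<close> c step.hyps(1)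
          by (auto simp: saturation_def)
        then show False using vn step.prems(5) by auto
      qed
      then have "c \<otimes> v \<in> saturation R P N" by (rule step.hyps(2))
      also have "\<dots> \<subseteq> b (Suc n)"
        using saturation_mono[OF step.prems(3)[of "Suc n"]] step.prems(5)[of "Suc n"] by blast
      finally have "s \<otimes> e \<in> b (Suc n)" unfolding c(3) using c bSn by auto
      then have "e \<in> saturation R P (b (Suc n))" using s e bn by (auto simp: saturation_def)
      then show "e \<in> b (Suc n)" using step.prems(5) by auto
    qed
    then show ?thesis using step.prems(4) by (metis subset_antisym)
  qed
qed

lemma ideals_set_simps [simp]:
  "\<one>\<^bsub>ideals_set R\<^esub> = carrier R" "monoid.mult (ideals_set R) = ideal_prod R"
  by (simp_all add: ideals_set_def)

lemma (in cring) ideal_power_ideal: "ideal I R \<Longrightarrow> ideal (ideal_power R I n) R"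
  by (induction n) (auto simp: oneideal ideal_prod_is_ideal)

lemma (in cring) ideal_prod_minimal:
  assumes "ideal K R" "\<And>i j. i \<in> I \<Longrightarrow> j \<in> J \<Longrightarrow> i \<otimes> j \<in> K"
  shows "ideal_prod R I J \<subseteq> K"
proof
  fix s assume "s \<in> ideal_prod R I J"
  then show "s \<in> K" by induction (use assms ideal_simps[OF assms(1)] in auto)
qed

lemma (in cring) primeideal_contains_power:
  assumes "primeideal p R" "ideal q R" "ideal_power R q n \<subseteq> p"
  shows "q \<subseteq> p"
  using assms(3)
proof (induction n)
  case 0
  then show ?case using ideal_simps(7)[OF assms(2)] by auto
next
  case (Suc n)
  interpret p: primeideal p R by fact
  show ?case
  proof (rule ccontr)
    assume "\<not> q \<subseteq> p"
    then obtain x where x: "x \<in> q" "x \<notin> p" by auto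
    have xc: "x \<in> carrier R" using ideal_simps[OF assms(2)] x by auto
    have "ideal_power R q n \<subseteq> p"
    proof
      fix y assume y: "y \<in> ideal_power R q n"
      then have yc: "y \<in> carrier R" using ideal_simps[OF ideal_power_ideal[OF assms(2)]] by auto
      have "y \<otimes> x \<in> p" using Suc.prems y x by (auto intro: ideal_prod.prod)
      then show "y \<in> p" using p.I_prime[OF yc xc] x(2) by auto
    qed
    then show False using Suc.IH x by auto
  qed
qed

text \<open>
  If \<open>r\<close> were minimal over \<open>p + (x)\<close>, the symbolic powers of \<open>q\<close> together with \<open>x\<close> would become
  stationary in the Artinian localization, and \<open>q\<close> locally nilpotent modulo \<open>p\<close> by Nakayama's lemma.
\<close>

lemma (in noetherian_cring) principal_ideal_theorem:
  assumes p: "primeideal p R" and q: "primeideal q R" and r: "primeideal r R"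
    and pq: "p \<subset> q" and qr: "q \<subset> r" and x: "x \<in> r" "x \<notin> q"
  shows "\<exists>Q. primeideal Q R \<and> p \<subseteq> Q \<and> x \<in> Q \<and> Q \<subset> r"
proof (rule ccontr)
  assume neg: "\<not> ?thesis"
  interpret p: primeideal p R by fact
  interpret q: primeideal q R by fact
  interpret r: primeideal r R by fact
  have xc: "x \<in> carrier R" using x by auto
  define N where "N = Idl (insert x p)"
  have subN: "insert x p \<subseteq> carrier R" using xc p.a_subset by auto
  have N: "ideal N R" unfolding N_def by (rule genideal_ideal[OF subN])
  have len: "finite_colength R r N"
  proof (rule finite_colengthI[OF r N])
    fix Q assume "primeideal Q R" "N \<subseteq> Q" "Q \<subseteq> r"
    moreover from this(2) have "x \<in> Q" "p \<subseteq> Q" using genideal_self[OF subN] unfolding N_def by blast+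
    ultimately show "Q = r" using neg by blast
  qed
  define pw where "pw n = ideal_power R q n" for n
  have pw: "ideal (pw n) R" for n unfolding pw_def by (rule ideal_power_ideal[OF q.is_ideal])
  have pwSuc: "pw (Suc n) \<subseteq> pw n" for n
    using ideal_prod_inter[OF pw[of n] q.is_ideal] by (auto simp: pw_def)
  define sy where "sy n = saturation R q (Idl (p \<union> pw n))" for n
  have psub: "p \<union> pw n \<subseteq> carrier R" for n using p.a_subset ideal_simps[OF pw] by auto
  have sy: "ideal (sy n) R" for n unfolding sy_def
    by (intro saturation_ideal[OF q] genideal_ideal psub)
  have sup: "p \<union> pw n \<subseteq> sy n" for n unfolding sy_def
    using saturation_superset[OF q genideal_ideal[OF psub]] genideal_self[OF psub] by blast
  have sySuc: "sy (Suc n) \<subseteq> sy n" for n unfolding sy_def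
    using pwSuc by (intro saturation_mono Idl_mono psub) auto
  define b where "b n = saturation R r (Idl (insert x (sy n)))" for n
  have bsub: "insert x (sy n) \<subseteq> carrier R" for n using xc ideal_simps[OF sy] by auto
  note bI = genideal_ideal[OF bsub]
  have "\<exists>n0. \<forall>n\<ge>n0. b (Suc n) = b n"
  proof (rule finite_colength_dcc[OF r len N])
    show "ideal (b n) R" for n unfolding b_def by (rule saturation_ideal[OF r bI])
    show "N \<subseteq> b n" for n unfolding b_def N_def using sup
      by (intro order_trans[OF _ saturation_superset[OF r bI]] Idl_mono bsub) auto
    show "b (Suc n) \<subseteq> b n" for n unfolding b_def
      using sySuc by (intro saturation_mono Idl_mono bsub) auto
    show "saturation R r (b n) \<subseteq> b n" for n unfolding b_def by (rule saturation_idem[OF r])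
  qed
  then obtain n where bn: "b (Suc n) = b n" by blast
  obtain G where G: "G \<subseteq> carrier R" "finite G" "sy n = Idl G" using finetely_gen[OF sy] by blast
  note syn = ideal_simps[OF sy[of n]] and sySn = ideal_simps[OF sy[of "Suc n"]]
  define W where "W = Idl (sy (Suc n) \<union> {i \<otimes> g | i g. i \<in> r \<and> g \<in> G})"
  have Wsub: "sy (Suc n) \<union> {i \<otimes> g | i g. i \<in> r \<and> g \<in> G} \<subseteq> carrier R"
    using G sySn(7) r.a_subset by auto
  have W: "ideal W R" unfolding W_def by (rule genideal_ideal[OF Wsub])
  note Ws = ideal_simps[OF W] 
  have Wsup: "sy (Suc n) \<union> {i \<otimes> g | i g. i \<in> r \<and> g \<in> G} \<subseteq> W"
    unfolding W_def by (rule genideal_self[OF Wsub])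
  have WrG: "i \<otimes> g \<in> W" if "i \<in> r" "g \<in> G" for i g using Wsup that by blast
  have "\<exists>u\<in>carrier R - r. \<forall>g\<in>G. u \<otimes> g \<in> sy (Suc n)"
  proof (rule nakayama[OF r sy G(2,1)])
    show "G \<subseteq> saturation R r (Idl (sy (Suc n) \<union> {i \<otimes> g | i g. i \<in> r \<and> g \<in> G}))"
      unfolding W_def[symmetric]
    proof
      fix a assume "a \<in> G"
      then have a: "a \<in> sy n" "a \<in> carrier R" using genideal_self[OF G(1)] G by auto
      have "a \<in> b n" unfolding b_def
        using a saturation_superset[OF r bI[of n]] genideal_self[OF bsub[of n]] by auto
      then obtain s where s: "s \<in> carrier R - r" "s \<otimes> a \<in> Idl (insert x (sy (Suc n)))"
        unfolding bn[symmetric] by (auto simp: b_def saturation_def)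
      then obtain c y where c: "c \<in> carrier R" "y \<in> sy (Suc n)" "s \<otimes> a = c \<otimes> x \<oplus> y"
        using Idl_insert[OF sySn(7) xc] Idl_eq[OF sy[of "Suc n"]] by auto
      have yn: "y \<in> sy n" using c sySuc by auto
      have "c \<otimes> x = s \<otimes> a \<ominus> y" unfolding c(3)
        using c yn syn xc by (simp add: minus_eq a_assoc r_neg)
      also have "\<dots> \<in> sy n" using a s yn syn by auto
      finally have "x \<otimes> c \<in> sy n" using xc c by (simp add: m_comm)
      then have cn: "c \<in> sy n"
        unfolding sy_def using saturation_cancel[OF q c(1), of x] x xc by blast
      have "sy n \<subseteq> {y \<in> carrier R. x \<otimes> y \<in> W}"
        unfolding G(3) using WrG x(1) G(1) by (intro genideal_minimal ideal_colon[OF W xc]) auto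
      then have "x \<otimes> c \<in> W" using cn by auto
      then have "s \<otimes> a \<in> W" unfolding c(3) using c xc Ws Wsup by (auto simp: m_comm)
      then show "a \<in> saturation R r W" using a s by (auto simp: saturation_def)
    qed
  qed
  then obtain u where u: "u \<in> carrier R - r" "\<forall>g\<in>G. u \<otimes> g \<in> sy (Suc n)" by auto
  have "sy n \<subseteq> sy (Suc n)"
    unfolding G(3)
  proof (rule genideal_minimal[OF sy])
    show "G \<subseteq> sy (Suc n)"
    proof
      fix g assume g: "g \<in> G"
      show "g \<in> sy (Suc n)" unfolding sy_def
        using u g G(1) qr by (intro saturation_cancel[OF q, of g u]) (auto simp: sy_def)
    qed
  qed
  then have le: "pw n \<subseteq> sy (Suc n)" using sup by blast
  obtain H where H: "H \<subseteq> carrier R" "finite H" "pw n = Idl H" using finetely_gen[OF pw] by blast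
  define V where "V = Idl (p \<union> {i \<otimes> g | i g. i \<in> q \<and> g \<in> H})"
  have Vsub: "p \<union> {i \<otimes> g | i g. i \<in> q \<and> g \<in> H} \<subseteq> carrier R"
    using H q.a_subset p.a_subset by auto
  have V: "ideal V R" unfolding V_def by (rule genideal_ideal[OF Vsub])
  have Vsup: "p \<union> {i \<otimes> g | i g. i \<in> q \<and> g \<in> H} \<subseteq> V"
    unfolding V_def by (rule genideal_self[OF Vsub])
  have VqH: "i \<otimes> g \<in> V" if "i \<in> q" "g \<in> H" for i g using Vsup that by blast
  have pw_eq: "pw (Suc n) = ideal_prod R (pw n) q" by (simp add: pw_def)
  have "pw (Suc n) \<subseteq> V"
    unfolding pw_eq
  proof (rule ideal_prod_minimal[OF V])
    fix i j assume i: "i \<in> pw n" and j: "j \<in> q"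
    have "Idl H \<subseteq> {y \<in> carrier R. j \<otimes> y \<in> V}"
      using VqH j H(1) by (intro genideal_minimal ideal_colon[OF V]) auto
    then have "i \<in> carrier R" "j \<otimes> i \<in> V" using i H(3) by auto
    then show "i \<otimes> j \<in> V" using j by (simp add: m_comm)
  qed
  then have "Idl (p \<union> pw (Suc n)) \<subseteq> V" using Vsup by (intro genideal_minimal[OF V]) auto
  then have "H \<subseteq> saturation R q V"
    using le genideal_self[OF H(1)] H(3) saturation_mono[of _ V q] unfolding sy_def by blast
  then obtain w where w: "w \<in> carrier R - q" "\<forall>g\<in>H. w \<otimes> g \<in> p"
    using nakayama[OF q p.is_ideal H(2,1)] unfolding V_def by blast
  have "H \<subseteq> p"
    using w H(1) pq by (metis Diff_iff p.I_prime psubsetD subset_iff)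
  then have "pw n \<subseteq> p" unfolding H(3) by (intro genideal_minimal p.is_ideal)
  then have "q \<subseteq> p" using primeideal_contains_power[OF p q.is_ideal] by (simp add: pw_def)
  then show False using pq by auto
qed

section \<open>Regular local rings\<close>

definition prime_chain :: "('a, 'b) ring_scheme \<Rightarrow> 'a set \<Rightarrow> 'a set \<Rightarrow> nat \<Rightarrow> (nat \<Rightarrow> 'a set) \<Rightarrow> bool" where
  "prime_chain R a m d p \<longleftrightarrow> (\<forall>i\<le>d. primeideal (p i) R) \<and> (\<forall>i<d. p i \<subset> p (Suc i)) \<and> a \<subseteq> p 0 \<and> p d = m"

lemma prime_chain_Suc:
  assumes "prime_chain R a m (Suc d) p"
  shows "prime_chain R (p 1) m d (\<lambda>i. p (Suc i))"
  using assms by (auto simp: prime_chain_def)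

lemma prime_chain_Cons:
  assumes "prime_chain R a m d p" "primeideal q R" "a' \<subseteq> q" "q \<subset> p 0"
  shows "prime_chain R a' m (Suc d) (\<lambda>i. case i of 0 \<Rightarrow> q | Suc j \<Rightarrow> p j)"
  unfolding prime_chain_def
proof (intro conjI allI impI)
  fix i assume "i < Suc d"
  then show "(case i of 0 \<Rightarrow> q | Suc j \<Rightarrow> p j) \<subset> (case Suc i of 0 \<Rightarrow> q | Suc j \<Rightarrow> p j)"
    using assms by (cases i) (auto simp: prime_chain_def)
qed (use assms in \<open>auto simp: prime_chain_def split: nat.splits\<close>)

lemma prime_chain_le:
  assumes "prime_chain R a m d p" "i \<le> d"
  shows "p i \<subseteq> m"
proof -
  have "p j \<subseteq> p d" if "j \<le> d" for j
    using that by (induction j rule: inc_induct) (use assms in \<open>auto simp: prime_chain_def\<close>)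
  then show ?thesis using assms by (auto simp: prime_chain_def)
qed

lemma (in noetherian_cring) prime_chain_drop:
  assumes "prime_chain R a m (Suc d) p" "x \<in> m"
  shows "\<exists>q. prime_chain R (insert x (p 0)) m d q"
  using assms
proof (induction d arbitrary: a p)
  case 0
  then have "prime_chain R (insert x (p 0)) m 0 (\<lambda>_. m)" by (auto simp: prime_chain_def)
  then show ?case by blast
next
  case (Suc d)
  obtain q where q: "prime_chain R (insert x (p 1)) m d q"
    using Suc.IH[OF prime_chain_Suc[OF Suc.prems(1)] Suc.prems(2)] by auto
  have p: "primeideal (p 0) R" "primeideal (p 1) R" "p 0 \<subset> p 1"
    using Suc.prems by (auto simp: prime_chain_def)
  have q0: "primeideal (q 0) R" "x \<in> q 0" "p 1 \<subseteq> q 0" using q by (auto simp: prime_chain_def)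
  show ?case
  proof (cases "x \<in> p 1")
    case True
    then have "prime_chain R (insert x (p 0)) m (Suc d) (\<lambda>i. p (Suc i))"
      using prime_chain_Suc[OF Suc.prems(1)] p(3) by (auto simp: prime_chain_def)
    then show ?thesis by blast
  next
    case False
    then have "p 1 \<subset> q 0" using q0 by auto
    then obtain Q where "primeideal Q R" "p 0 \<subseteq> Q" "x \<in> Q" "Q \<subset> q 0"
      using principal_ideal_theorem[OF p(1,2) q0(1) p(3) _ q0(2) False] by auto
    then show ?thesis using prime_chain_Cons[OF q, of Q "insert x (p 0)"] by auto
  qed
qed

lemma (in noetherian_cring) prime_chain_length:
  assumes "ideal a R" "prime_chain R a m d p" "set ys \<subseteq> carrier R" "Idl (a \<union> set ys) = m"
  shows "d \<le> length ys"
  using assms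
proof (induction ys arbitrary: a d p)
  case Nil
  then have m: "m = a" using Idl_eq by auto
  show ?case
  proof (cases d)
    case (Suc k)
    then have "p 0 \<subset> p 1" "a \<subseteq> p 0" using Nil by (auto simp: prime_chain_def)
    moreover have "p 1 \<subseteq> m" using prime_chain_le[OF Nil.prems(2), of 1] Suc by auto
    ultimately show ?thesis using m by auto
  qed auto
next
  case (Cons y ys)
  show ?case
  proof (cases d)
    case (Suc k)
    have p0: "ideal (p 0) R" "a \<subseteq> p 0" 
      using Cons.prems by (auto simp: prime_chain_def primeideal_def)
    note p0s = ideal_simps[OF p0(1)]
    have sub: "insert y (p 0) \<subseteq> carrier R" using Cons.prems p0s by auto
    have sub': "a \<union> set (y # ys) \<subseteq> carrier R" using Cons.prems ideal_simps(7)[OF Cons.prems(1)] by auto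
    have ym: "a \<union> set (y # ys) \<subseteq> m" using genideal_self[OF sub'] Cons.prems(4) by auto
    have mi: "ideal m R" using genideal_ideal[OF sub'] Cons.prems(4) by auto
    have "y \<in> m" using ym by auto
    then obtain q where q: "prime_chain R (insert y (p 0)) m k q"
      using prime_chain_drop[of a m k p y] Cons.prems(2) Suc by auto
    have q0: "ideal (q 0) R" using q by (auto simp: prime_chain_def primeideal_def)
    have "prime_chain R (Idl (insert y (p 0))) m k q"
      using q genideal_minimal[OF q0, of "insert y (p 0)"] by (auto simp: prime_chain_def)
    moreover have "Idl (Idl (insert y (p 0)) \<union> set ys) = m"
    proof (rule subset_antisym)
      have "Idl (Idl (insert y (p 0)) \<union> set ys) = Idl (insert y (p 0) \<union> set ys)"
        using Cons.prems by (intro Idl_Un_Idl sub) auto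
      also have "\<dots> \<subseteq> m"
        using prime_chain_le[OF Cons.prems(2), of 0] ym by (intro genideal_minimal mi) auto
      finally show "Idl (Idl (insert y (p 0)) \<union> set ys) \<subseteq> m" .
      show "m \<subseteq> Idl (Idl (insert y (p 0)) \<union> set ys)"
        unfolding Cons.prems(4)[symmetric] using p0(2) genideal_self[OF sub] 
          ideal_simps(7)[OF genideal_ideal[OF sub]] Cons.prems(3)
        by (intro Idl_mono) auto
    qed
    ultimately have "k \<le> length ys"
      using Cons.IH[OF genideal_ideal[OF sub], of k q] Cons.prems(3) by auto
    then show ?thesis using Suc by auto
  qed auto
qed

lemma (in cring) prime_eq_of_regular_generator:
  assumes m: "primeideal m R" and units: "carrier R - m \<subseteq> Units R"
    and a: "ideal a R" and p: "primeideal p R" "finite G" "G \<subseteq> carrier R" "p = Idl G"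
    and y: "y \<in> m" "y \<notin> p" and ap: "a \<subseteq> p" "p \<subseteq> Idl (insert y a)"
  shows "p = a"
proof
  interpret p: primeideal p R by fact
  interpret m: primeideal m R by fact
  note as = ideal_simps[OF a]
  have yc: "y \<in> carrier R" using y by auto
  define W where "W = Idl (a \<union> {i \<otimes> g | i g. i \<in> m \<and> g \<in> G})"
  have Wsub: "a \<union> {i \<otimes> g | i g. i \<in> m \<and> g \<in> G} \<subseteq> carrier R"
    using as p(3) m.a_subset by auto
  have W: "ideal W R" unfolding W_def by (rule genideal_ideal[OF Wsub])
  have Wsup: "a \<union> {i \<otimes> g | i g. i \<in> m \<and> g \<in> G} \<subseteq> W"
    unfolding W_def by (rule genideal_self[OF Wsub])
  have WG: "y \<otimes> g \<in> W" if "g \<in> G" for g using Wsup that y(1) by blast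
  have "G \<subseteq> W"
  proof
    fix g assume "g \<in> G"
    then have gp: "g \<in> p" using genideal_self[OF p(3)] p(4) by auto
    then have "g \<in> Idl (insert y a)" using ap by auto
    then obtain r z where r: "r \<in> carrier R" "z \<in> a" "g = r \<otimes> y \<oplus> z"
      using Idl_insert[OF as(7) yc] Idl_eq[OF a] by auto
    have zp: "z \<in> p" using r ap by auto
    have "r \<otimes> y = g \<ominus> z" unfolding r(3) using r yc as by (simp add: minus_eq a_assoc r_neg)
    also have "\<dots> \<in> p" using gp zp ideal_simps[OF p.is_ideal] by auto
    finally have "r \<in> p" using p.I_prime[of r y] r yc y(2) by auto
    have "p \<subseteq> {w \<in> carrier R. y \<otimes> w \<in> W}"
      unfolding p(4) using WG p(3) by (intro genideal_minimal ideal_colon[OF W yc]) auto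
    then have "y \<otimes> r \<in> W" using \<open>r \<in> p\<close> by auto
    then show "g \<in> W" unfolding r(3) using r yc ideal_simps[OF W] Wsup by (auto simp: m_comm)
  qed
  then have "G \<subseteq> saturation R m W" using saturation_superset[OF m W] by auto
  then obtain u where u: "u \<in> carrier R - m" "\<forall>g\<in>G. u \<otimes> g \<in> a"
    using nakayama[OF m a p(2,3)] unfolding W_def by blast
  then have uu: "u \<in> Units R" using units by auto
  have "G \<subseteq> a"
  proof
    fix g assume "g \<in> G"
    then have g: "inv u \<otimes> (u \<otimes> g) \<in> a" "g \<in> carrier R" using u uu as p(3) by auto
    have "inv u \<otimes> (u \<otimes> g) = (inv u \<otimes> u) \<otimes> g"
      using uu g(2) by (intro m_assoc[symmetric]) auto
    then show "g \<in> a" using g uu by simp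
  qed
  then show "p \<subseteq> a" unfolding p(4) by (intro genideal_minimal a)
qed (use ap in auto)

text \<open>
  For a generator \<open>y\<close> both \<open>a + (y)\<close> and \<open>p 0 + (y)\<close> are prime by induction, and equal because a strict
  inclusion would give a chain that is too long. Hence \<open>p 0 = a + y (p 0)\<close>, and \<open>p 0 = a\<close> by Nakayama.
\<close>

lemma (in noetherian_cring) prime_of_maximal_chain:
  assumes m: "primeideal m R" and units: "carrier R - m \<subseteq> Units R"
    and "ideal a R" "prime_chain R a m (length ys) p" "set ys \<subseteq> carrier R" "Idl (a \<union> set ys) = m"
  shows "primeideal a R"
  using assms(3-)
proof (induction ys arbitrary: a p)
  case Nil
  then have "m = a" using Idl_eq by auto
  then show ?case using m by simp
next
  case (Cons y ys)
  define d where "d = length ys"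
  have ch: "prime_chain R a m (Suc d) p" using Cons.prems by (simp add: d_def)
  note as = ideal_simps[OF Cons.prems(1)]
  have p0: "primeideal (p 0) R" "a \<subseteq> p 0" using ch by (auto simp: prime_chain_def)
  then have p0i: "ideal (p 0) R" by (auto simp: primeideal_def)
  note p0s = ideal_simps[OF p0i]
  have yc: "y \<in> carrier R" "set ys \<subseteq> carrier R" using Cons.prems by auto
  have sub: "a \<union> set (y # ys) \<subseteq> carrier R" using Cons.prems as by auto
  have ym: "a \<union> set (y # ys) \<subseteq> m" using genideal_self[OF sub] Cons.prems(4) by auto
  have mi: "ideal m R" using genideal_ideal[OF sub] Cons.prems(4) by auto
  have p0m: "p 0 \<subseteq> m" using prime_chain_le[OF ch, of 0] by auto
  have gen: "Idl (b \<union> set (y # ys)) = m" if "a \<subseteq> b" "b \<subseteq> m" for b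
  proof
    have bc: "b \<subseteq> carrier R" using that ideal_simps(7)[OF mi] by auto
    show "Idl (b \<union> set (y # ys)) \<subseteq> m" using that ym by (intro genideal_minimal mi) auto
    show "m \<subseteq> Idl (b \<union> set (y # ys))"
      unfolding Cons.prems(4)[symmetric] using that sub bc by (intro Idl_mono) auto
  qed
  obtain q where q: "prime_chain R (insert y (p 0)) m d q"
    using prime_chain_drop[OF ch, of y] ym by auto
  have q0: "primeideal (q 0) R" "ideal (q 0) R" using q by (auto simp: prime_chain_def primeideal_def)
  have qI: "prime_chain R (Idl (insert y b)) m d q" if "b \<subseteq> p 0" for b
  proof -
    have "insert y b \<subseteq> q 0" using q that by (auto simp: prime_chain_def)
    from genideal_minimal[OF q0(2) this] show ?thesis using q by (simp add: prime_chain_def)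
  qed
  have ideal': "ideal (Idl (insert y b)) R" if "b \<subseteq> p 0" for b
    using that yc p0s by (intro genideal_ideal) auto
  have gen': "Idl (Idl (insert y b) \<union> set ys) = m" if "a \<subseteq> b" "b \<subseteq> p 0" for b
    using gen[of b] Idl_Un_Idl[of "insert y b" "set ys"] that p0m yc p0s by auto
  have prime': "primeideal (Idl (insert y b)) R" if "a \<subseteq> b" "b \<subseteq> p 0" for b
    using Cons.IH[of "Idl (insert y b)" q] that qI ideal' gen' yc by (auto simp: d_def)
  have eq: "Idl (insert y a) = Idl (insert y (p 0))"
  proof (rule ccontr)
    assume ne: "Idl (insert y a) \<noteq> Idl (insert y (p 0))"
    have le: "Idl (insert y a) \<subseteq> Idl (insert y (p 0))" using p0(2) yc p0s by (intro Idl_mono) auto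
    have "Idl (insert y a) \<subset> q 0" using le ne qI[of "p 0"] by (auto simp: prime_chain_def)
    then have "prime_chain R (Idl (insert y a)) m (Suc d)
        (\<lambda>i. case i of 0 \<Rightarrow> Idl (insert y a) | Suc j \<Rightarrow> q j)"
      using prime_chain_Cons[OF q prime'[of a]] p0(2) by auto
    from prime_chain_length[OF _ this yc(2)] show False
      using ideal'[OF p0(2)] gen'[of a] p0(2) by (auto simp: d_def)
  qed
  have yp: "y \<notin> p 0"
  proof
    assume "y \<in> p 0"
    then have "Idl (p 0 \<union> set ys) = m" using gen[OF p0(2) p0m] by (simp add: insert_absorb)
    moreover have "prime_chain R (p 0) m (Suc d) p" using ch by (auto simp: prime_chain_def)
    ultimately show False using prime_chain_length[OF p0i _ yc(2), of m "Suc d" p] by (auto simp: d_def)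
  qed
  obtain G where G: "G \<subseteq> carrier R" "finite G" "p 0 = Idl G" using finetely_gen[OF p0i] by blast
  have "p 0 \<subseteq> Idl (insert y a)" unfolding eq using genideal_self[of "insert y (p 0)"] yc p0s by auto
  then have "p 0 = a"
    using prime_eq_of_regular_generator[OF m units Cons.prems(1) p0(1) G(2,1,3) _ yp p0(2)] ym by auto
  then show ?case using p0(1) by simp
qed

definition regular_sequence :: "('a, 'b) ring_scheme \<Rightarrow> 'a list \<Rightarrow> bool" where
  "regular_sequence R xs \<longleftrightarrow> set xs \<subseteq> carrier R \<and> (\<forall>i<length xs. \<forall>b\<in>carrier R.
     xs ! i \<otimes>\<^bsub>R\<^esub> b \<in> Idl\<^bsub>R\<^esub> (set (take i xs)) \<longrightarrow> b \<in> Idl\<^bsub>R\<^esub> (set (take i xs)))"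

lemma (in noetherian_cring) regular_sequenceI:
  assumes m: "primeideal m R" and units: "carrier R - m \<subseteq> Units R"
    and ch: "prime_chain R {\<zero>} m (length xs) p" and xs: "set xs \<subseteq> carrier R" "Idl (set xs) = m"
  shows "regular_sequence R xs"
proof -
  define a where "a i = Idl (set (take i xs))" for i
  have sub: "set (take i xs) \<subseteq> carrier R" for i using xs(1) set_take_subset by fastforce
  have a: "ideal (a i) R" for i unfolding a_def by (rule genideal_ideal[OF sub])
  have mi: "ideal m R" using m by (simp add: primeideal_def)
  have xm: "set xs \<subseteq> m" using genideal_self[OF xs(1)] xs(2) by auto
  have take_Suc: "set (take (Suc i) xs) = insert (xs ! i) (set (take i xs))" if "i < length xs" for i
    using that by (simp add: take_Suc_conv_app_nth)
  have aSuc: "a (Suc i) = Idl (insert (xs ! i) (a i))" if i: "i < length xs" for i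
    unfolding a_def take_Suc[OF i] using Idl_Un_Idl[OF sub[of i], of "{xs ! i}"] xs(1) nth_mem[OF i]
    by auto
  have gen: "Idl (a i \<union> set (drop i xs)) = m" for i
  proof -
    have "set (take i xs) \<union> set (drop i xs) = set xs" by (metis append_take_drop_id set_append)
    then show ?thesis unfolding a_def
      using Idl_Un_Idl[OF sub[of i], of "set (drop i xs)"] xs set_drop_subset[of i xs] by auto
  qed
  have chain: "\<exists>p. prime_chain R (a i) m (length xs - i) p" if "i \<le> length xs" for i
    using that
  proof (induction i)
    case 0
    have "Idl {} = {\<zero>}" using genideal_zero Idl_mono[of "{}" "{\<zero>}"] ideal_simps(1)[OF genideal_ideal[of "{}"]]
      by auto
    then show ?case using ch by (auto simp: a_def)
  next
    case (Suc i)
    then obtain p where p: "prime_chain R (a i) m (Suc (length xs - Suc i)) p"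
      using Suc_diff_le[of "Suc i" "length xs"] by auto
    then obtain q where q: "prime_chain R (insert (xs ! i) (p 0)) m (length xs - Suc i) q"
      using prime_chain_drop[OF p, of "xs ! i"] xm Suc.prems by force
    have "ideal (q 0) R" using q by (auto simp: prime_chain_def primeideal_def)
    moreover have "insert (xs ! i) (a i) \<subseteq> q 0" using p q by (auto simp: prime_chain_def)
    ultimately have "a (Suc i) \<subseteq> q 0" using Suc.prems by (simp add: aSuc genideal_minimal)
    then have "prime_chain R (a (Suc i)) m (length xs - Suc i) q"
      using q by (simp add: prime_chain_def)
    then show ?case by blast
  qed
  have prime: "primeideal (a i) R" if i: "i \<le> length xs" for i
  proof -
    obtain p where "prime_chain R (a i) m (length (drop i xs)) p" using chain[OF i] by auto
    then show ?thesis
      using prime_of_maximal_chain[OF m units a _ _ gen] xs(1) set_drop_subset[of i xs] by blast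
  qed
  have notin: "xs ! i \<notin> a i" if i: "i < length xs" for i
  proof
    assume "xs ! i \<in> a i"
    then have "a i \<union> set (drop i xs) = a i \<union> set (drop (Suc i) xs)"
      by (subst Cons_nth_drop_Suc[OF i, symmetric]) auto
    then have g: "Idl (a i \<union> set (drop (Suc i) xs)) = m" using gen[of i] by auto
    obtain p where p: "prime_chain R (a i) m (length xs - i) p" using chain[of i] i by auto
    have "length xs - i \<le> length (drop (Suc i) xs)"
      using xs(1) set_drop_subset[of "Suc i" xs] by (intro prime_chain_length[OF a p _ g]) auto
    then show False using i by auto
  qed
  show ?thesis
    unfolding regular_sequence_def a_def[symmetric]
  proof (intro conjI allI impI ballI)
    fix i b assume i: "i < length xs" and b: "b \<in> carrier R" "xs ! i \<otimes> b \<in> a i"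
    interpret P: primeideal "a i" R using prime i by auto
    show "b \<in> a i" using P.I_prime[of "xs ! i" b] b xs(1) notin[OF i] nth_mem[OF i] by auto
  qed (rule xs)
qed

lemma (in cring) local_ring_max_ideal:
  assumes "local_ring R"
  shows "maximalideal (max_ideal R) R" "\<And>M. maximalideal M R \<Longrightarrow> M = max_ideal R"
proof -
  have ex: "\<exists>!M. maximalideal M R" using assms by (simp add: local_ring_def)
  show 1: "maximalideal (max_ideal R) R" unfolding max_ideal_def by (rule theI'[OF ex])
  show "\<And>M. maximalideal M R \<Longrightarrow> M = max_ideal R" using ex 1 by blast
qed

lemma (in noetherian_cring) exists_maximalideal_superset:
  assumes "ideal I R" "I \<noteq> carrier R"
  shows "\<exists>M. maximalideal M R \<and> I \<subseteq> M"
proof -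
  define A where "A = {J. ideal J R \<and> J \<noteq> carrier R \<and> I \<subseteq> J}"
  have "I \<in> A" using assms by (auto simp: A_def)
  define D where "D = {(I, J). ideal I R \<and> ideal J R \<and> J \<subset> I}"
  have "wf D" unfolding D_def by (rule wf_ideals)
  from wfE_min[OF this \<open>I \<in> A\<close>] obtain M where M: "M \<in> A" "\<And>y. (y, M) \<in> D \<Longrightarrow> y \<notin> A" by metis
  have "maximalideal M R"
  proof (rule maximalidealI)
    show "ideal M R" "carrier R \<noteq> M" using M by (auto simp: A_def)
    fix J assume J: "ideal J R" "M \<subseteq> J" "J \<subseteq> carrier R"
    have "(J, M) \<in> D" if "J \<noteq> M" using J M(1) that by (auto simp: A_def D_def)
    then show "J = M \<or> J = carrier R" using M J unfolding A_def by blast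
  qed
  then show ?thesis using M(1) by (auto simp: A_def)
qed

lemma (in noetherian_cring) local_ring_units:
  assumes "local_ring R"
  shows "carrier R - max_ideal R \<subseteq> Units R"
proof
  fix u assume u: "u \<in> carrier R - max_ideal R"
  have I: "ideal (PIdl u) R" using u by (intro cgenideal_ideal) auto
  have "PIdl u = carrier R"
  proof (rule ccontr)
    assume "PIdl u \<noteq> carrier R"
    then obtain M where "maximalideal M R" "PIdl u \<subseteq> M" using exists_maximalideal_superset[OF I] by auto
    then show False using local_ring_max_ideal[OF assms] cgenideal_self[of u] u by auto
  qed
  then show "u \<in> Units R" using ideal_eq_carrier_iff[of u] u by auto
qed

lemma (in noetherian_cring) regular_local_regular_sequence:
  assumes "regular_local_ring R"
  shows "\<exists>xs. regular_sequence R xs \<and> Idl (set xs) = max_ideal R"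
proof -
  define m where "m = max_ideal R"
  have loc: "local_ring R" and dim: "krull_dim R = enat (min_number_of_generators R m)"
    using assms by (auto simp: regular_local_ring_def m_def)
  define n where "n = min_number_of_generators R m"
  have max: "maximalideal m R" "\<And>M. maximalideal M R \<Longrightarrow> M = m"
    unfolding m_def by (fact local_ring_max_ideal[OF loc])+
  have mi: "ideal m R" using max(1) by (simp add: maximalideal_def)
  have "\<exists>d. \<exists>S\<subseteq>carrier R. finite S \<and> card S = d \<and> Idl S = m" using finetely_gen[OF mi] by blast
  from LeastI_ex[OF this] obtain S where S: "S \<subseteq> carrier R" "finite S" "card S = n" "Idl S = m"
    by (auto simp: n_def min_number_of_generators_def)
  then obtain xs where xs: "set xs = S" "length xs = n" by (metis distinct_card finite_distinct_list)
  define C where "C = {d. \<exists>p :: nat \<Rightarrow> 'a set. (\<forall>i\<le>d. primeideal (p i) R) \<and> (\<forall>i<d. p i \<subset> p (Suc i))}"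
  have sup: "Sup (enat ` C) = enat n"
  proof -
    have "enat ` C = {enat d | d. \<exists>p :: nat \<Rightarrow> 'a set. (\<forall>i\<le>d. primeideal (p i) R) \<and> (\<forall>i<d. p i \<subset> p (Suc i))}"
      by (auto simp: C_def)
    then show ?thesis using dim by (simp add: krull_dim_def n_def)
  qed
  have prime_m: "primeideal m R" by (rule maximalideal_prime[OF max(1)])
  have "0 \<in> C" using prime_m unfolding C_def by (auto intro!: exI[of _ "\<lambda>_. m"])
  have "finite C"
  proof (rule finite_subset)
    show "C \<subseteq> {..n}"
    proof
      fix d assume "d \<in> C"
      then have "enat d \<le> Sup (enat ` C)" by (intro Sup_upper) auto
      then show "d \<in> {..n}" using sup by auto
    qed
  qed auto
  then have "Sup (enat ` C) \<in> enat ` C" 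
    using \<open>0 \<in> C\<close> by (auto simp: Sup_enat_def intro!: Max_in)
  then have "n \<in> C" unfolding sup by auto
  then obtain p where p: "\<forall>i\<le>n. primeideal (p i) R" "\<forall>i<n. p i \<subset> p (Suc i)" by (auto simp: C_def)
  have "p n \<subseteq> m"
  proof -
    have "primeideal (p n) R" using p by auto
    then have "ideal (p n) R" "p n \<noteq> carrier R"
      by (auto simp: primeideal_def primeideal_axioms_def)
    then show ?thesis using exists_maximalideal_superset max(2) by blast
  qed
  then have "prime_chain R {\<zero>} m n (p(n := m))"
  proof -
    have "ideal (p 0) R" using p(1) by (auto simp: primeideal_def)
    then have "\<zero> \<in> p 0" "\<zero> \<in> m" using ideal_simps(1) mi by blast+
    moreover have "(p(n := m)) i \<subset> (p(n := m)) (Suc i)" if "i < n" for i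
      using p(2) that \<open>p n \<subseteq> m\<close> by (cases "Suc i = n") auto
    ultimately show ?thesis using p(1) prime_m by (auto simp: prime_chain_def)
  qed
  then have "regular_sequence R xs"
    using regular_sequenceI[OF prime_m, of xs "p(n := m)"] xs S local_ring_units[OF loc]
    by (auto simp: m_def)
  then show ?thesis using xs S by (auto simp: m_def)
qed

section \<open>The Koszul complex\<close>

lemma (in cring) signed_simps [simp]:
  "a \<in> carrier R \<Longrightarrow> signed R k a \<in> carrier R"
  "signed R k \<zero> = \<zero>" "signed R 0 a = a"
  "a \<in> carrier R \<Longrightarrow> signed R (Suc k) a = \<ominus> signed R k a"
  "a \<in> carrier R \<Longrightarrow> signed R k (signed R k a) = a"
  by (auto simp: signed_def)

lemma (in cring) signed_add:
  "a \<in> carrier R \<Longrightarrow> b \<in> carrier R \<Longrightarrow> signed R k (a \<oplus> b) = signed R k a \<oplus> signed R k b"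
  by (auto simp: signed_def minus_add)

lemma (in cring) signed_minus: "a \<in> carrier R \<Longrightarrow> signed R k (\<ominus> a) = \<ominus> signed R k a"
  by (auto simp: signed_def)

lemma (in cring) signed_mult:
  "a \<in> carrier R \<Longrightarrow> b \<in> carrier R \<Longrightarrow> signed R k (a \<otimes> b) = a \<otimes> signed R k b"
  by (auto simp: signed_def r_minus)

lemma (in cring) signed_signed:
  "a \<in> carrier R \<Longrightarrow> signed R k (signed R l a) = signed R (k + l) a"
  by (auto simp: signed_def)

lemma (in cring) signed_ideal: "ideal P R \<Longrightarrow> a \<in> P \<Longrightarrow> signed R k a \<in> P"
  by (auto simp: signed_def ideal_simps)

lemma (in cring) finsum_ideal:
  assumes "ideal P R" "\<And>i. i \<in> A \<Longrightarrow> g i \<in> P"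
  shows "finsum R g A \<in> P"
proof -
  note Ps = ideal_simps[OF assms(1)]
  show ?thesis
    using assms(2)
  proof (induction A rule: infinite_finite_induct)
    case (insert x A)
    have "finsum R g (insert x A) = g x \<oplus> finsum R g A"
      using insert Ps by (intro finsum_insert) auto
    then show ?case using insert Ps by auto
  qed (use Ps in \<open>auto simp: finsum_infinite\<close>)
qed

lemma (in cring) finsum_minus:
  assumes "\<And>i. i \<in> A \<Longrightarrow> g i \<in> carrier R"
  shows "finsum R (\<lambda>i. \<ominus> g i) A = \<ominus> finsum R g A"
  using assms
proof (induction A rule: infinite_finite_induct)
  case (insert x A)
  then have "finsum R (\<lambda>i. \<ominus> g i) (insert x A) = \<ominus> g x \<oplus> finsum R (\<lambda>i. \<ominus> g i) A"
    by (intro finsum_insert) auto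
  moreover have "finsum R g (insert x A) = g x \<oplus> finsum R g A"
    using insert by (intro finsum_insert) auto
  moreover have "finsum R g A \<in> carrier R" using insert by (intro finsum_closed) auto
  ultimately show ?case using insert by (simp add: minus_add)
qed (auto simp: finsum_infinite)

text \<open>
  The Koszul complex on the family \<open>f\<close> restricted to \<open>T\<close>; elements are extended by zero off the
  subsets of \<open>T\<close>, so that the complexes for \<open>T \<subseteq> T'\<close> are subcomplexes of each other.
\<close>

definition kos :: "('a, 'b) ring_scheme \<Rightarrow> nat set \<Rightarrow> (nat set \<Rightarrow> 'a) set" where
  "kos R T = {a. (\<forall>U. a U \<in> carrier R) \<and> (\<forall>U. \<not> U \<subseteq> T \<longrightarrow> a U = \<zero>\<^bsub>R\<^esub>)}"

definition kos_deg :: "('a, 'b) ring_scheme \<Rightarrow> nat set \<Rightarrow> nat \<Rightarrow> (nat set \<Rightarrow> 'a) set" where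
  "kos_deg R T i = {a \<in> kos R T. \<forall>U. card U \<noteq> i \<longrightarrow> a U = \<zero>\<^bsub>R\<^esub>}"

definition kos_diff :: "('a, 'b) ring_scheme \<Rightarrow> (nat \<Rightarrow> 'a) \<Rightarrow> nat set \<Rightarrow> (nat set \<Rightarrow> 'a) \<Rightarrow> nat set \<Rightarrow> 'a" where
  "kos_diff R f T a = (\<lambda>U. if U \<subseteq> T then
     (\<Oplus>\<^bsub>R\<^esub>j\<in>T - U. signed R (card {u\<in>U. u < j}) (f j \<otimes>\<^bsub>R\<^esub> a (insert j U))) else \<zero>\<^bsub>R\<^esub>)"

text \<open>Exterior multiplication by \<open>e\<^sub>j\<close> from the left.\<close>

definition wedge :: "('a, 'b) ring_scheme \<Rightarrow> nat \<Rightarrow> (nat set \<Rightarrow> 'a) \<Rightarrow> nat set \<Rightarrow> 'a" where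
  "wedge R j a = (\<lambda>U. if j \<in> U then signed R (card {u\<in>U. u < j}) (a (U - {j})) else \<zero>\<^bsub>R\<^esub>)"

definition acyclic_mod ::
    "('a, 'b) ring_scheme \<Rightarrow> (nat \<Rightarrow> 'a) \<Rightarrow> nat set \<Rightarrow> nat \<Rightarrow> 'a set \<Rightarrow> 'a set \<Rightarrow> bool" where
  "acyclic_mod R f T t P Q \<longleftrightarrow> (\<forall>i>t. \<forall>a\<in>kos_deg R T i. (\<forall>U. kos_diff R f T a U \<in> P) \<longrightarrow>
     (\<exists>u\<in>kos_deg R T (Suc i). \<forall>U. a U \<ominus>\<^bsub>R\<^esub> kos_diff R f T u U \<in> Q))"

lemma kosD: "a \<in> kos R T \<Longrightarrow> a U \<in> carrier R" "a \<in> kos R T \<Longrightarrow> \<not> U \<subseteq> T \<Longrightarrow> a U = \<zero>\<^bsub>R\<^esub>"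
  by (auto simp: kos_def)

lemma kos_mono: "T \<subseteq> T' \<Longrightarrow> kos R T \<subseteq> kos R T'"
  by (auto simp: kos_def)

lemma kos_deg_mono: "T \<subseteq> T' \<Longrightarrow> kos_deg R T i \<subseteq> kos_deg R T' i"
  unfolding kos_deg_def using kos_mono[of T T' R] by blast

lemma kos_degD: "a \<in> kos_deg R T i \<Longrightarrow> a \<in> kos R T"
    "a \<in> kos_deg R T i \<Longrightarrow> card U \<noteq> i \<Longrightarrow> a U = \<zero>\<^bsub>R\<^esub>"
  by (auto simp: kos_deg_def)

lemma card_less_insert:
  fixes U :: "nat set" assumes "finite U" "i \<notin> U"
  shows "card {u \<in> insert i U. u < j} = (if i < j then Suc (card {u\<in>U. u < j}) else card {u\<in>U. u < j})"
proof -
  have "{u \<in> insert i U. u < j} = (if i < j then insert i {u\<in>U. u < j} else {u\<in>U. u < j})" by auto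
  then show ?thesis using assms by simp
qed

context cring
begin

lemma kos_closed:
  assumes "a \<in> kos R T" "b \<in> kos R T" "c \<in> carrier R"
  shows "(\<lambda>U. a U \<oplus> b U) \<in> kos R T" "(\<lambda>U. \<ominus> a U) \<in> kos R T" "(\<lambda>U. a U \<ominus> b U) \<in> kos R T"
    "(\<lambda>U. c \<otimes> a U) \<in> kos R T" "(\<lambda>U. \<zero>) \<in> kos R T"
  using assms by (auto simp: kos_def minus_eq)

lemma kos_deg_closed:
  assumes "a \<in> kos_deg R T i" "b \<in> kos_deg R T i" "c \<in> carrier R"
  shows "(\<lambda>U. a U \<oplus> b U) \<in> kos_deg R T i" "(\<lambda>U. \<ominus> a U) \<in> kos_deg R T i" "(\<lambda>U. a U \<ominus> b U) \<in> kos_deg R T i"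
    "(\<lambda>U. c \<otimes> a U) \<in> kos_deg R T i"
  using assms by (auto simp: kos_deg_def kos_closed minus_eq)

lemma kos_deg_zero: "(\<lambda>U. \<zero>) \<in> kos_deg R T i"
  by (auto simp: kos_deg_def kos_def)

lemma kos_diff_summand:
  assumes "a \<in> kos R T" "f \<in> T \<rightarrow> carrier R" "j \<in> T"
  shows "signed R k (f j \<otimes> a U) \<in> carrier R"
  using assms by (auto simp: kos_def Pi_iff)

lemma kos_diff_kos:
  assumes "a \<in> kos R T" "f \<in> T \<rightarrow> carrier R"
  shows "kos_diff R f T a \<in> kos R T"
proof -
  have "kos_diff R f T a U \<in> carrier R" for U
    using kos_diff_summand[OF assms] by (auto simp: kos_diff_def intro!: finsum_closed)
  moreover have "kos_diff R f T a U = \<zero>" if "\<not> U \<subseteq> T" for U using that by (simp add: kos_diff_def)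
  ultimately show ?thesis by (simp add: kos_def)
qed

lemma kos_diff_deg:
  assumes "a \<in> kos_deg R T (Suc i)" "f \<in> T \<rightarrow> carrier R" "finite T"
  shows "kos_diff R f T a \<in> kos_deg R T i"
proof -
  have "kos_diff R f T a U = \<zero>" if "card U \<noteq> i" for U
  proof -
    have "signed R (card {u\<in>U. u < j}) (f j \<otimes> a (insert j U)) = \<zero>" if "U \<subseteq> T" "j \<in> T - U" for j
    proof -
      have "finite U" using that assms(3) finite_subset by auto
      then have "card (insert j U) \<noteq> Suc i" using that \<open>card U \<noteq> i\<close> by auto
      then have "a (insert j U) = \<zero>" using kos_degD(2)[OF assms(1)] by auto
      moreover have "f j \<in> carrier R" using assms that by auto
      ultimately show ?thesis by simp
    qed
    then show ?thesis by (auto simp: kos_diff_def intro!: add.finprod_one_eqI)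
  qed
  then show ?thesis using kos_diff_kos[OF _ assms(2)] assms(1) by (auto simp: kos_deg_def)
qed

lemma kos_diff_deg0:
  assumes "a \<in> kos_deg R T 0" "f \<in> T \<rightarrow> carrier R" "finite T"
  shows "kos_diff R f T a = (\<lambda>U. \<zero>)"
proof
  fix U
  have "signed R (card {u\<in>U. u < j}) (f j \<otimes> a (insert j U)) = \<zero>" if "U \<subseteq> T" "j \<in> T - U" for j
  proof -
    have "card (insert j U) \<noteq> 0" using that assms(3) finite_subset[of U T] by auto
    then have "a (insert j U) = \<zero>" by (rule kos_degD(2)[OF assms(1)])
    moreover have "f j \<in> carrier R" using assms that by auto
    ultimately show ?thesis by simp
  qed
  then show "kos_diff R f T a U = \<zero>" by (auto simp: kos_diff_def intro!: add.finprod_one_eqI)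
qed

lemma kos_diff_add:
  assumes "a \<in> kos R T" "b \<in> kos R T" "f \<in> T \<rightarrow> carrier R"
  shows "kos_diff R f T (\<lambda>U. a U \<oplus> b U) U = kos_diff R f T a U \<oplus> kos_diff R f T b U"
proof (cases "U \<subseteq> T")
  case True
  have "(\<Oplus>j\<in>T - U. signed R (card {u\<in>U. u < j}) (f j \<otimes> (a (insert j U) \<oplus> b (insert j U))))
     = (\<Oplus>j\<in>T - U. signed R (card {u\<in>U. u < j}) (f j \<otimes> a (insert j U)) \<oplus>
          signed R (card {u\<in>U. u < j}) (f j \<otimes> b (insert j U)))"
    using assms by (intro finsum_cong') (auto simp: kos_def r_distr signed_add Pi_iff)
  also have "\<dots> = kos_diff R f T a U \<oplus> kos_diff R f T b U"
    using True kos_diff_summand[OF assms(1,3)] kos_diff_summand[OF assms(2,3)]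
    by (simp add: kos_diff_def finsum_addf)
  finally show ?thesis using True by (simp add: kos_diff_def)
qed (auto simp: kos_diff_def)

lemma kos_diff_smult:
  assumes "a \<in> kos R T" "c \<in> carrier R" "f \<in> T \<rightarrow> carrier R" "finite T"
  shows "kos_diff R f T (\<lambda>U. c \<otimes> a U) U = c \<otimes> kos_diff R f T a U"
proof (cases "U \<subseteq> T")
  case True
  have "(\<Oplus>j\<in>T - U. signed R (card {u\<in>U. u < j}) (f j \<otimes> (c \<otimes> a (insert j U))))
     = (\<Oplus>j\<in>T - U. c \<otimes> signed R (card {u\<in>U. u < j}) (f j \<otimes> a (insert j U)))"
  proof (intro finsum_cong')
    fix j assume "j \<in> T - U"
    then have "f j \<in> carrier R" "a (insert j U) \<in> carrier R" using assms by (auto simp: kos_def)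
    then show "signed R (card {u\<in>U. u < j}) (f j \<otimes> (c \<otimes> a (insert j U))) =
        c \<otimes> signed R (card {u\<in>U. u < j}) (f j \<otimes> a (insert j U))"
      using assms by (simp add: m_lcomm flip: signed_mult)
  qed (use assms kos_diff_summand[OF assms(1,3)] in auto)
  also have "\<dots> = c \<otimes> kos_diff R f T a U"
    using True kos_diff_summand[OF assms(1,3)] assms
    by (simp add: kos_diff_def finsum_rdistr)
  finally show ?thesis using True by (simp add: kos_diff_def)
qed (use assms in \<open>auto simp: kos_diff_def\<close>)

lemma kos_diff_minus:
  assumes "a \<in> kos R T" "b \<in> kos R T" "f \<in> T \<rightarrow> carrier R" "finite T"
  shows "kos_diff R f T (\<lambda>U. a U \<ominus> b U) U = kos_diff R f T a U \<ominus> kos_diff R f T b U"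
proof -
  have eq: "(\<lambda>U. a U \<ominus> b U) = (\<lambda>U. a U \<oplus> (\<ominus> \<one>) \<otimes> b U)"
    using assms by (auto simp: kos_def minus_eq l_minus)
  have b: "(\<lambda>U. (\<ominus> \<one>) \<otimes> b U) \<in> kos R T" using assms by (intro kos_closed) auto
  have "kos_diff R f T b U \<in> carrier R" using kos_diff_kos[OF assms(2,3)] by (auto simp: kos_def)
  then show ?thesis unfolding eq kos_diff_add[OF assms(1) b assms(3)]
    using kos_diff_smult[OF assms(2) _ assms(3,4), of "\<ominus> \<one>"] by (simp add: minus_eq l_minus)
qed

lemma kos_diff_uminus:
  assumes "a \<in> kos R T" "f \<in> T \<rightarrow> carrier R" "finite T"
  shows "kos_diff R f T (\<lambda>U. \<ominus> a U) U = \<ominus> kos_diff R f T a U"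
proof -
  have eq: "(\<lambda>U. \<ominus> a U) = (\<lambda>U. (\<ominus> \<one>) \<otimes> a U)"
    using assms by (auto simp: kos_def l_minus)
  have "kos_diff R f T a U \<in> carrier R" using kos_diff_kos[OF assms(1,2)] by (auto simp: kos_def)
  then show ?thesis unfolding eq
    using kos_diff_smult[OF assms(1) _ assms(2,3), of "\<ominus> \<one>"] by (simp add: l_minus)
qed

lemma kos_diff_zero:
  assumes "f \<in> T \<rightarrow> carrier R" shows "kos_diff R f T (\<lambda>U. \<zero>) U = \<zero>"
proof -
  have "signed R k (f j \<otimes> \<zero>) = \<zero>" if "j \<in> T" for j k using that assms by (auto simp: Pi_iff)
  then show ?thesis by (auto simp: kos_diff_def intro!: add.finprod_one_eqI)
qed

lemma kos_diff_extend:
  assumes "a \<in> kos R T" "f \<in> T' \<rightarrow> carrier R" "finite T'" "T \<subseteq> T'"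
  shows "kos_diff R f T' a = kos_diff R f T a"
proof
  fix U
  have z: "signed R (card {u\<in>U. u < j}) (f j \<otimes> a (insert j U)) = \<zero>"
    if "j \<in> T'" "\<not> insert j U \<subseteq> T" for j
  proof -
    have "f j \<in> carrier R" "a (insert j U) = \<zero>" using that assms by (auto simp: kos_def)
    then show ?thesis by simp
  qed
  have c: "signed R (card {u\<in>U. u < j}) (f j \<otimes> a (insert j U)) \<in> carrier R" if "j \<in> T'" for j
    using that assms by (auto simp: kos_def Pi_iff)
  show "kos_diff R f T' a U = kos_diff R f T a U"
  proof (cases "U \<subseteq> T")
    case True
    then have "finsum R (\<lambda>j. signed R (card {u\<in>U. u < j}) (f j \<otimes> a (insert j U))) (T' - U)
       = finsum R (\<lambda>j. signed R (card {u\<in>U. u < j}) (f j \<otimes> a (insert j U))) (T - U)"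
      using assms z c by (intro add.finprod_mono_neutral_cong_right) auto
    moreover have "U \<subseteq> T'" using True assms(4) by auto
    ultimately show ?thesis using True by (simp only: kos_diff_def if_True)
  next
    case False
    have "finsum R (\<lambda>j. signed R (card {u\<in>U. u < j}) (f j \<otimes> a (insert j U))) (T' - U) = \<zero>"
      using False by (intro add.finprod_one_eqI z) auto
    then show ?thesis using False by (simp add: kos_diff_def)
  qed
qed

lemma wedge_kos:
  assumes "a \<in> kos R T" "j \<in> T" shows "wedge R j a \<in> kos R T"
proof -
  have "a (U - {j}) = \<zero>" if "\<not> U \<subseteq> T" for U
    using that assms by (intro kosD(2)[OF assms(1)]) auto
  then show ?thesis using assms by (auto simp: kos_def wedge_def)
qed

lemma wedge_deg:
  assumes "a \<in> kos_deg R T i" "j \<in> T" "finite T" shows "wedge R j a \<in> kos_deg R T (Suc i)"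
proof -
  have "wedge R j a U = \<zero>" if c: "card U \<noteq> Suc i" for U
  proof (cases "j \<in> U \<and> U \<subseteq> T")
    case True
    then have "finite U" using finite_subset[OF _ assms(3)] by blast
    then have "card (U - {j}) \<noteq> i" using c True card_Suc_Diff1[of U j] by auto
    then have "a (U - {j}) = \<zero>" by (rule kos_degD(2)[OF assms(1)])
    then show ?thesis by (simp add: wedge_def)
  next
    case False
    then consider "j \<notin> U" | "\<not> U \<subseteq> T" by blast
    then show ?thesis
    proof cases
      case 2
      then show ?thesis by (rule kosD(2)[OF wedge_kos[OF kos_degD(1)[OF assms(1)] assms(2)]])
    qed (simp add: wedge_def)
  qed
  then show ?thesis using wedge_kos[OF kos_degD(1)[OF assms(1)] assms(2)] by (auto simp: kos_deg_def)
qed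

lemma wedge_ideal: "ideal P R \<Longrightarrow> (\<And>U. a U \<in> P) \<Longrightarrow> wedge R j a U \<in> P"
  by (auto simp: wedge_def signed_ideal ideal_simps)

lemma wedge_minus:
  assumes "a \<in> kos R T" "b \<in> kos R T"
  shows "wedge R j (\<lambda>U. a U \<ominus> b U) U = wedge R j a U \<ominus> wedge R j b U"
  using assms by (auto simp: wedge_def kos_def signed_add signed_minus minus_eq)

lemma kos_diff_wedge:
  assumes v: "v \<in> kos R T" and f: "f \<in> T \<rightarrow> carrier R" and T: "finite T" "j \<in> T"
  shows "kos_diff R f T (wedge R j v) U = f j \<otimes> v U \<ominus> wedge R j (kos_diff R f T v) U"
proof (cases "U \<subseteq> T")
  case False
  then have "\<not> U - {j} \<subseteq> T" using T by auto
  then have "v U = \<zero>" "kos_diff R f T v (U - {j}) = \<zero>"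
    using False kosD(2)[OF v] by (auto simp: kos_diff_def)
  moreover have "f j \<in> carrier R" using f T by auto
  moreover have "kos_diff R f T (wedge R j v) U = \<zero>" using False by (simp add: kos_diff_def)
  ultimately show ?thesis by (simp add: wedge_def minus_eq)
next
  case U: True
  have fU: "finite U" by (rule finite_subset[OF U T(1)])
  have vc: "v V \<in> carrier R" for V using v by (auto simp: kos_def)
  have fc: "f i \<in> carrier R" if "i \<in> T" for i using f that by auto
  let ?c = "\<lambda>V j. card {u\<in>V. u < j}"
  have sc: "signed R k (f i \<otimes> wedge R j v V) \<in> carrier R" if "i \<in> T" for k i V
    using kos_diff_summand[OF wedge_kos[OF v T(2)] f that] .
  show ?thesis
  proof (cases "j \<in> U")
    case False
    define G where "G i = signed R (?c U i) (f i \<otimes> wedge R j v (insert i U))" for i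
    have Gc: "G i \<in> carrier R" if "i \<in> T" for i using sc[OF that] by (simp add: G_def)
    have G0: "finsum R G (T - U - {j}) = \<zero>"
    proof (rule add.finprod_one_eqI)
      fix i assume "i \<in> T - U - {j}"
      then show "G i = \<zero>" using False fc[of i] by (simp add: G_def wedge_def)
    qed
    have TU: "T - U = insert j (T - U - {j})" using False T by auto
    have "finsum R G (T - U) = G j \<oplus> finsum R G (T - U - {j})"
      by (subst TU, rule finsum_insert) (use T Gc in auto)
    then have "finsum R G (T - U) = signed R (?c U j) (f j \<otimes> wedge R j v (insert j U))"
      unfolding G0 using Gc[OF T(2)] by (simp add: G_def)
    also have "\<dots> = f j \<otimes> v U"
    proof -
      have "insert j U - {j} = U" using False by auto
      moreover have "?c (insert j U) j = ?c U j" using card_less_insert[OF fU False, of j] by simp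
      ultimately show ?thesis using fc T vc by (simp add: wedge_def flip: signed_mult)
    qed
    finally have "kos_diff R f T (wedge R j v) U = f j \<otimes> v U" using U by (simp add: kos_diff_def G_def[abs_def])
    moreover have "wedge R j (kos_diff R f T v) U = \<zero>" using False by (simp add: wedge_def)
    ultimately show ?thesis using fc[OF T(2)] vc by (simp add: minus_eq)
  next
    case True
    define V where "V = U - {j}"
    have "finite V" using fU by (simp add: V_def)
    then have V: "U = insert j V" "j \<notin> V" "finite V" "V \<subseteq> T" using True U unfolding V_def by blast+
    have cj: "?c U j = ?c V j" using card_less_insert[OF V(3,2), of j] V(1) by simp
    have TV: "T - V = insert j (T - U)" "j \<notin> T - U" using V T by auto
    define g where "g i = signed R (?c V i) (f i \<otimes> v (insert i V))" for i
    have gc: "g i \<in> carrier R" if "i \<in> T" for i using fc[OF that] vc by (simp add: g_def)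
    have "kos_diff R f T v V = finsum R g (T - V)"
      using V(4) by (simp add: kos_diff_def g_def[abs_def])
    also have "\<dots> = g j \<oplus> finsum R g (T - U)"
      unfolding TV(1) by (rule finsum_insert) (use T TV(2) gc in auto)
    finally have w: "wedge R j (kos_diff R f T v) U = signed R (?c V j) (g j \<oplus> finsum R g (T - U))"
      using True by (simp add: wedge_def V_def[symmetric] cj)
    have S: "finsum R g (T - U) \<in> carrier R" using gc by (intro finsum_closed) auto
    have gj: "signed R (?c V j) (g j) = f j \<otimes> v U"
      using fc T vc by (simp add: g_def V(1))
    have "kos_diff R f T (wedge R j v) U = finsum R (\<lambda>i. signed R (?c U i) (f i \<otimes> wedge R j v (insert i U))) (T - U)"
      using U by (simp add: kos_diff_def)
    also have "\<dots> = finsum R (\<lambda>i. \<ominus> signed R (?c V j) (g i)) (T - U)"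
    proof (intro finsum_cong')
      fix i assume i: "i \<in> T - U"
      have ij: "i \<noteq> j" "i \<notin> V" using i True by (auto simp: V_def)
      have "insert i U - {j} = insert i V" using ij V by auto
      then have "signed R (?c U i) (f i \<otimes> wedge R j v (insert i U))
          = signed R (?c U i + ?c (insert i U) j) (f i \<otimes> v (insert i V))"
        using True fc[of i] i vc by (simp add: wedge_def signed_signed flip: signed_mult)
      also have "\<dots> = signed R (Suc (?c V j + ?c V i)) (f i \<otimes> v (insert i V))"
      proof -
        have 1: "?c U i = (if j < i then Suc (?c V i) else ?c V i)"
          using card_less_insert[OF V(3,2), of i] V(1) by simp
        have "?c (insert i U) j = (if i < j then Suc (?c V j) else ?c V j)"
          using card_less_insert[OF fU, of i j] i cj by simp
        then have "?c U i + ?c (insert i U) j = Suc (?c V j + ?c V i)" using 1 ij by auto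
        then show ?thesis by simp
      qed
      also have "\<dots> = \<ominus> signed R (?c V j) (g i)"
        using fc[of i] i vc by (simp add: g_def signed_signed)
      finally show "signed R (?c U i) (f i \<otimes> wedge R j v (insert i U)) = \<ominus> signed R (?c V j) (g i)" .
    qed (use gc in auto)
    also have "\<dots> = \<ominus> signed R (?c V j) (finsum R g (T - U))"
    proof -
      have "signed R k (finsum R g (T - U)) = finsum R (\<lambda>i. signed R k (g i)) (T - U)" for k
        using gc finsum_minus[of "T - U" g] by (auto simp: signed_def)
      then show ?thesis using gc finsum_minus[of "T - U" "\<lambda>i. signed R (?c V j) (g i)"] by auto
    qed
    finally show ?thesis unfolding w using gj gc[OF T(2)] S fc[OF T(2)] vc
      by (simp add: signed_add minus_eq minus_add a_assoc[symmetric] r_neg)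
  qed
qed

end

definition null_homotopy ::
    "('a, 'b) ring_scheme \<Rightarrow> (nat \<Rightarrow> 'a) \<Rightarrow> nat set \<Rightarrow> 'a \<Rightarrow> ((nat set \<Rightarrow> 'a) \<Rightarrow> (nat set \<Rightarrow> 'a)) \<Rightarrow> bool" where
  "null_homotopy R f T y h \<longleftrightarrow> (\<forall>i. \<forall>a\<in>kos_deg R T i. h a \<in> kos_deg R T (Suc i)) \<and>
    (\<forall>a\<in>kos R T. h a \<in> kos R T \<and>
      (\<forall>U. kos_diff R f T (h a) U = y \<otimes>\<^bsub>R\<^esub> a U \<ominus>\<^bsub>R\<^esub> h (kos_diff R f T a) U)) \<and>
    (\<forall>a\<in>kos R T. \<forall>P. ideal P R \<longrightarrow> (\<forall>U. a U \<in> P) \<longrightarrow> (\<forall>U. h a U \<in> P))"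

lemma null_homotopyD:
  assumes "null_homotopy R f T y h"
  shows "a \<in> kos_deg R T i \<Longrightarrow> h a \<in> kos_deg R T (Suc i)"
    "a \<in> kos R T \<Longrightarrow> h a \<in> kos R T"
    "a \<in> kos R T \<Longrightarrow> kos_diff R f T (h a) U = y \<otimes>\<^bsub>R\<^esub> a U \<ominus>\<^bsub>R\<^esub> h (kos_diff R f T a) U"
    "a \<in> kos R T \<Longrightarrow> ideal P R \<Longrightarrow> (\<And>U. a U \<in> P) \<Longrightarrow> h a U \<in> P"
  using assms by (auto simp: null_homotopy_def)

context cring
begin

lemma null_homotopic:
  assumes f: "f \<in> T \<rightarrow> carrier R" and T: "finite T" and y: "y \<in> Idl (f ` T)"
  shows "\<exists>h. null_homotopy R f T y h"
proof -
  define H where "H h y \<longleftrightarrow> null_homotopy R f T y h" for h y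
  note H_def = H_def[unfolded null_homotopy_def]
  have HD: "h a \<in> kos R T" "kos_diff R f T (h a) U = y \<otimes> a U \<ominus> h (kos_diff R f T a) U"
      "h a U \<in> carrier R" if "H h y" "a \<in> kos R T" for h y a U
    using that by (auto simp: H_def kos_def)
  have Hdeg: "h a \<in> kos_deg R T (Suc i)" if "H h y" "a \<in> kos_deg R T i" for h y a i
    using that by (auto simp: H_def)
  have HP: "h a U \<in> P" if "H h y" "a \<in> kos R T" "ideal P R" "\<forall>U. a U \<in> P" for h y a P U
    using that by (auto simp: H_def)
  have dk: "kos_diff R f T a \<in> kos R T" if "a \<in> kos R T" for a using kos_diff_kos[OF that f] .
  have ac: "a U \<in> carrier R" if "a \<in> kos R T" for a U using that by (simp add: kos_def)
  have "Idl (f ` T) \<subseteq> {y \<in> carrier R. \<exists>h. H h y}"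
  proof (intro genideal_minimal idealI')
    have "H (\<lambda>a U. \<zero>) \<zero>"
      unfolding H_def using kos_deg_zero kos_degD(1)[OF kos_deg_zero] ac kos_diff_zero[OF f]
      by (auto simp: ideal_simps minus_eq)
    then show "\<zero> \<in> {y \<in> carrier R. \<exists>h. H h y}" by auto
  next
    fix x y assume "x \<in> {y \<in> carrier R. \<exists>h. H h y}" "y \<in> {y \<in> carrier R. \<exists>h. H h y}"
    then obtain h g where x: "x \<in> carrier R" "H h x" and y: "y \<in> carrier R" "H g y" by auto
    have "H (\<lambda>a U. h a U \<oplus> g a U) (x \<oplus> y)"
      unfolding H_def
    proof (intro conjI allI ballI impI)
      fix a i assume "a \<in> kos_deg R T i"
      then show "(\<lambda>U. h a U \<oplus> g a U) \<in> kos_deg R T (Suc i)"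
        using Hdeg x(2) y(2) by (intro kos_deg_closed) auto
    next
      fix a assume a: "a \<in> kos R T"
      then show "(\<lambda>U. h a U \<oplus> g a U) \<in> kos R T"
        using HD(1) x(2) y(2) by (intro kos_closed) auto
      fix U
      have "x \<otimes> a U \<ominus> h (kos_diff R f T a) U \<oplus> (y \<otimes> a U \<ominus> g (kos_diff R f T a) U)
         = (x \<oplus> y) \<otimes> a U \<ominus> (h (kos_diff R f T a) U \<oplus> g (kos_diff R f T a) U)"
        using x(1) y(1) ac[OF a] HD(3)[OF x(2) dk[OF a]] HD(3)[OF y(2) dk[OF a]] by algebra
      then show "kos_diff R f T (\<lambda>U. h a U \<oplus> g a U) U =
          (x \<oplus> y) \<otimes> a U \<ominus> (h (kos_diff R f T a) U \<oplus> g (kos_diff R f T a) U)"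
        using kos_diff_add[OF HD(1)[OF x(2) a] HD(1)[OF y(2) a] f]
          HD(2)[OF x(2) a] HD(2)[OF y(2) a] by simp
    next
      fix a P U assume "a \<in> kos R T" "ideal P R" "\<forall>U. a U \<in> P"
      then show "h a U \<oplus> g a U \<in> P" using HP[OF x(2)] HP[OF y(2)] by (auto simp: ideal_simps)
    qed
    then show "x \<oplus> y \<in> {y \<in> carrier R. \<exists>h. H h y}" using x y by auto
  next
    fix c y assume c: "c \<in> carrier R" and "y \<in> {y \<in> carrier R. \<exists>h. H h y}"
    then obtain g where y: "y \<in> carrier R" "H g y" by auto
    have "H (\<lambda>a U. c \<otimes> g a U) (c \<otimes> y)"
      unfolding H_def
    proof (intro conjI allI ballI impI)
      fix a i assume "a \<in> kos_deg R T i"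
      from Hdeg[OF y(2) this] show "(\<lambda>U. c \<otimes> g a U) \<in> kos_deg R T (Suc i)"
        using c by (intro kos_deg_closed(4))
    next
      fix a assume a: "a \<in> kos R T"
      show "(\<lambda>U. c \<otimes> g a U) \<in> kos R T"
        using HD(1)[OF y(2) a] c by (intro kos_closed(4))
      fix U
      have "c \<otimes> (y \<otimes> a U \<ominus> g (kos_diff R f T a) U) = (c \<otimes> y) \<otimes> a U \<ominus> c \<otimes> g (kos_diff R f T a) U"
        using c y(1) ac[OF a] HD(3)[OF y(2) dk[OF a]] by algebra
      then show "kos_diff R f T (\<lambda>U. c \<otimes> g a U) U = (c \<otimes> y) \<otimes> a U \<ominus> c \<otimes> g (kos_diff R f T a) U"
        using kos_diff_smult[OF HD(1)[OF y(2) a] c f T] HD(2)[OF y(2) a] by simp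
    next
      fix a P U assume "a \<in> kos R T" "ideal P R" "\<forall>U. a U \<in> P"
      then show "c \<otimes> g a U \<in> P" using HP[OF y(2)] c by (auto simp: ideal_simps)
    qed
    then show "c \<otimes> y \<in> {y \<in> carrier R. \<exists>h. H h y}" using c y by auto
  next
    show "f ` T \<subseteq> {y \<in> carrier R. \<exists>h. H h y}"
    proof
      fix y assume "y \<in> f ` T"
      then obtain j where j: "j \<in> T" "y = f j" by auto
      have "H (wedge R j) (f j)"
        unfolding H_def
        using wedge_deg[OF _ j(1) T] wedge_kos[OF _ j(1)] kos_diff_wedge[OF _ f T j(1)] wedge_ideal by auto
      then show "y \<in> {y \<in> carrier R. \<exists>h. H h y}" using j f by auto
    qed
  qed auto
  then show ?thesis using y unfolding H_def null_homotopy_def by auto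
qed

lemma kos_decompose:
  assumes a: "a \<in> kos_deg R (insert j T) i" and T: "finite T" "j \<notin> T"
  defines "u \<equiv> \<lambda>U. if j \<in> U then \<zero> else a U"
    and "v \<equiv> \<lambda>U. if j \<in> U then \<zero> else signed R (card {u\<in>U. u < j}) (a (insert j U))"
  shows "u \<in> kos_deg R T i" "i = Suc i' \<Longrightarrow> v \<in> kos_deg R T i'" "v \<in> kos R T"
    "a U = u U \<oplus> wedge R j v U"
proof -
  have ac: "a U \<in> carrier R" for U using a by (auto simp: kos_deg_def kos_def)
  have a0: "a U = \<zero>" if "\<not> U \<subseteq> insert j T \<or> card U \<noteq> i" for U using a that by (auto simp: kos_deg_def kos_def)
  have "u U = \<zero>" if "\<not> U \<subseteq> T" for U using that a0[of U] by (auto simp: u_def)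
  then show "u \<in> kos_deg R T i" using ac a0 by (auto simp: kos_deg_def kos_def u_def)
  have v0: "v U = \<zero>" if "\<not> U \<subseteq> T" for U
  proof -
    have "a (insert j U) = \<zero>" if "j \<notin> U" using \<open>\<not> U \<subseteq> T\<close> that by (intro a0) auto
    then show ?thesis by (auto simp: v_def)
  qed
  then show vk: "v \<in> kos R T" using ac by (auto simp: kos_def v_def)
  show "v \<in> kos_deg R T i'" if i: "i = Suc i'"
  proof -
    have "v U = \<zero>" if c: "card U \<noteq> i'" for U
    proof (cases "U \<subseteq> T")
      case True
      then have "finite U" "j \<notin> U" using T finite_subset by blast+
      then have "card (insert j U) \<noteq> i" using c i by simp
      then have "a (insert j U) = \<zero>" using a0 by blast
      then show ?thesis by (simp add: v_def)
    qed (rule v0)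
    then show ?thesis using vk by (auto simp: kos_deg_def)
  qed
  show "a U = u U \<oplus> wedge R j v U"
  proof (cases "j \<in> U \<and> U \<subseteq> insert j T")
    case True
    have "{u \<in> U - {j}. u < j} = {u \<in> U. u < j}" by auto
    then have "wedge R j v U = a U" using True ac by (simp add: wedge_def v_def insert_absorb)
    then show ?thesis using True ac by (simp add: u_def)
  next
    case False
    show ?thesis
    proof (cases "j \<in> U")
      case True
      then have "\<not> U - {j} \<subseteq> T" "\<not> U \<subseteq> insert j T" using False by auto
      then have "v (U - {j}) = \<zero>" "a U = \<zero>" using v0[of "U - {j}"] a0[of U] by auto
      then show ?thesis using True by (simp add: u_def wedge_def)
    qed (use ac in \<open>simp add: u_def wedge_def\<close>)
  qed
qed

lemma kos_diff_decompose:
  assumes f: "f \<in> insert j T \<rightarrow> carrier R" and T: "finite T" "j \<notin> T"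
    and u: "u \<in> kos R T" and v: "v \<in> kos R T" and a: "\<And>U. a U = u U \<oplus> wedge R j v U"
  shows "kos_diff R f (insert j T) a U =
    kos_diff R f T u U \<oplus> (f j \<otimes> v U \<ominus> wedge R j (kos_diff R f T v) U)"
proof -
  have T': "finite (insert j T)" "j \<in> insert j T" and fT: "f \<in> T \<rightarrow> carrier R" using T f by auto
  have k: "u \<in> kos R (insert j T)" "v \<in> kos R (insert j T)" using u v kos_mono[of T "insert j T" R] by auto
  have "a = (\<lambda>U. u U \<oplus> wedge R j v U)" using a by auto
  then have "kos_diff R f (insert j T) a U
      = kos_diff R f (insert j T) u U \<oplus> kos_diff R f (insert j T) (wedge R j v) U"
    using kos_diff_add[OF k(1) wedge_kos[OF k(2) T'(2)] f] by simp
  also have "kos_diff R f (insert j T) u = kos_diff R f T u"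
    by (rule kos_diff_extend[OF u f T'(1)]) auto
  also have "kos_diff R f (insert j T) (wedge R j v) U = f j \<otimes> v U \<ominus> wedge R j (kos_diff R f T v) U"
    using kos_diff_wedge[OF k(2) f T'] kos_diff_extend[OF v f T'(1) subset_insertI] by simp
  finally show ?thesis .
qed

lemma kos_diff_decompose_parts:
  assumes f: "f \<in> insert j T \<rightarrow> carrier R" and T: "finite T" "j \<notin> T"
    and u: "u \<in> kos R T" and v: "v \<in> kos R T" and a: "\<And>U. a U = u U \<oplus> wedge R j v U"
    and P: "ideal P R" "\<And>U. kos_diff R f (insert j T) a U \<in> P"
  shows "kos_diff R f T u U \<oplus> f j \<otimes> v U \<in> P" "kos_diff R f T v U \<in> P"
proof -
  have fT: "f \<in> T \<rightarrow> carrier R" and fj: "f j \<in> carrier R" using f by auto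
  note d = kos_diff_decompose[OF f T u v a]
  have du: "kos_diff R f T u \<in> kos R T" and dv: "kos_diff R f T v \<in> kos R T"
    using kos_diff_kos fT u v by auto
  have c: "kos_diff R f T u U \<in> carrier R" "v U \<in> carrier R" "kos_diff R f T v U \<in> carrier R" for U
    using du dv v by (auto simp: kos_def)
  show "kos_diff R f T u U \<oplus> f j \<otimes> v U \<in> P"
  proof (cases "j \<in> U")
    case True
    then have "\<not> U \<subseteq> T" using T by auto
    then have "kos_diff R f T u U = \<zero>" "v U = \<zero>" using du v by (auto simp: kos_def)
    then show ?thesis using ideal_simps(1)[OF P(1)] fj by simp
  next
    case False
    then show ?thesis using P(2)[of U] c fj by (simp add: d wedge_def minus_eq)
  qed
  show "kos_diff R f T v U \<in> P"
  proof (cases "U \<subseteq> T")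
    case True
    then have jU: "j \<notin> U" using T by auto
    then have n: "\<not> insert j U \<subseteq> T" "insert j U - {j} = U" using T by auto
    have "{u. (u = j \<or> u \<in> U) \<and> u < j} = {u \<in> U. u < j}" using jU by auto
    then have "kos_diff R f (insert j T) a (insert j U) = \<ominus> signed R (card {u\<in>U. u < j}) (kos_diff R f T v U)"
      using kosD(2)[OF du n(1)] kosD(2)[OF v n(1)] fj c n(2) by (simp add: d wedge_def minus_eq)
    then have "\<ominus> signed R (card {u\<in>U. u < j}) (kos_diff R f T v U) \<in> P" using P(2)[of "insert j U"] by simp
    then have "\<ominus> (\<ominus> signed R (card {u\<in>U. u < j}) (kos_diff R f T v U)) \<in> P" by (rule ideal_simps(4)[OF P(1)])
    then have "signed R (card {u\<in>U. u < j}) (kos_diff R f T v U) \<in> P" using c by simp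
    then have "signed R (card {u\<in>U. u < j}) (signed R (card {u\<in>U. u < j}) (kos_diff R f T v U)) \<in> P"
      by (rule signed_ideal[OF P(1)])
    then show ?thesis using c by simp
  next
    case False
    then show ?thesis using dv ideal_simps(1)[OF P(1)] by (simp add: kos_def)
  qed
qed

lemma acyclic_step:
  assumes f: "f \<in> insert j T \<rightarrow> carrier R" and T: "finite T" "j \<notin> T"
    and P: "ideal P R" "ideal Q R" "ideal Q' R" "P \<subseteq> Q" "Q \<subseteq> Q'"
    and a: "a \<in> kos_deg R (insert j T) (Suc i)" "\<And>U. kos_diff R f (insert j T) a U \<in> P"
    and w: "\<And>v. v \<in> kos_deg R T i \<Longrightarrow> (\<And>U. kos_diff R f T v U \<in> P) \<Longrightarrow>
        (\<exists>u. u \<in> kos_deg R T (Suc i) \<and> (\<forall>U. kos_diff R f T u U \<oplus> f j \<otimes> v U \<in> P)) \<Longrightarrow>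
        \<exists>w\<in>kos_deg R T (Suc i). \<forall>U. v U \<ominus> kos_diff R f T w U \<in> Q"
    and ac: "\<And>b. b \<in> kos_deg R T (Suc i) \<Longrightarrow> (\<And>U. kos_diff R f T b U \<in> Q) \<Longrightarrow>
        \<exists>u\<in>kos_deg R T (Suc (Suc i)). \<forall>U. b U \<ominus> kos_diff R f T u U \<in> Q'"
  shows "\<exists>u\<in>kos_deg R (insert j T) (Suc (Suc i)). \<forall>U. a U \<ominus> kos_diff R f (insert j T) u U \<in> Q'"
proof -
  have fT: "f \<in> T \<rightarrow> carrier R" and fj: "f j \<in> carrier R" using f by auto
  obtain u v where u: "u \<in> kos_deg R T (Suc i)" and v: "v \<in> kos_deg R T i"
      and auv: "\<And>U. a U = u U \<oplus> wedge R j v U"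
    using kos_decompose[OF a(1) T] by blast
  note uk = kos_degD(1)[OF u] and vk = kos_degD(1)[OF v]
  note parts = kos_diff_decompose_parts[OF f T uk vk auv P(1) a(2)]
  obtain w where w: "w \<in> kos_deg R T (Suc i)" "\<And>U. v U \<ominus> kos_diff R f T w U \<in> Q"
    using w[OF v] parts u by blast
  note wk = kos_degD(1)[OF w(1)]
  define b where "b U = u U \<oplus> f j \<otimes> w U" for U
  have b: "b \<in> kos_deg R T (Suc i)"
    unfolding b_def using kos_deg_closed(1)[OF u kos_deg_closed(4)[OF w(1) w(1) fj]] fj by auto
  note bk = kos_degD(1)[OF b]
  have dc: "kos_diff R f T x U \<in> carrier R" if "x \<in> kos R T" for x U
    using kos_diff_kos[OF that fT] by (simp add: kos_def)
  have xc: "x U \<in> carrier R" if "x \<in> kos R T" for x U using that by (simp add: kos_def)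
  have "kos_diff R f T b U \<in> Q" for U
  proof -
    have "kos_diff R f T b U = kos_diff R f T u U \<oplus> f j \<otimes> kos_diff R f T w U"
      unfolding b_def using kos_diff_add[OF uk kos_closed(4)[OF wk wk fj] fT]
        kos_diff_smult[OF wk fj fT T(1)] by simp
    also have "\<dots> = (kos_diff R f T u U \<oplus> f j \<otimes> v U) \<ominus> f j \<otimes> (v U \<ominus> kos_diff R f T w U)"
      using dc[OF uk] dc[OF wk] xc[OF vk] fj by algebra
    also have "\<dots> \<in> Q"
      by (rule ideal_simps(3)[OF P(2) _ ideal_simps(5)[OF P(2) fj w(2)]]) (use parts(1) P(4) in auto)
    finally show ?thesis .
  qed
  then obtain u' where u': "u' \<in> kos_deg R T (Suc (Suc i))" "\<And>U. b U \<ominus> kos_diff R f T u' U \<in> Q'"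
    using ac[OF b] by blast
  note u'k = kos_degD(1)[OF u'(1)]
  define w' where "w' U = \<ominus> w U" for U
  have w': "w' \<in> kos_deg R T (Suc i)" unfolding w'_def using kos_deg_closed(2)[OF w(1) w(1)] by auto
  note w'k = kos_degD(1)[OF w']
  define z where "z U = u' U \<oplus> wedge R j w' U" for U
  have ins: "j \<in> insert j T" "finite (insert j T)" using T by auto
  have up: "x \<in> kos_deg R (insert j T) k" if "x \<in> kos_deg R T k" for x k
    using that kos_deg_mono[of T "insert j T" R k] by auto
  have "z \<in> kos_deg R (insert j T) (Suc (Suc i))"
    unfolding z_def using kos_deg_closed(1)[OF up[OF u'(1)] wedge_deg[OF up[OF w'] ins]] by auto
  moreover have "a U \<ominus> kos_diff R f (insert j T) z U \<in> Q'" for U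
  proof -
    have dw': "kos_diff R f T w' V = \<ominus> kos_diff R f T w V" for V
      unfolding w'_def using kos_diff_uminus[OF wk fT T(1)] .
    have wd: "wedge R j (kos_diff R f T w') U = \<ominus> wedge R j (kos_diff R f T w) U"
      using dc[OF wk] by (auto simp: wedge_def dw' signed_minus)
    have wm: "wedge R j (\<lambda>U. v U \<ominus> kos_diff R f T w U) U = wedge R j v U \<ominus> wedge R j (kos_diff R f T w) U"
      by (rule wedge_minus[OF vk kos_diff_kos[OF wk fT]])
    have wc: "wedge R j x U \<in> carrier R" if "x \<in> kos R T" for x
      using xc[OF that] by (auto simp: wedge_def)
    have "kos_diff R f (insert j T) z U
        = kos_diff R f T u' U \<oplus> (f j \<otimes> w' U \<ominus> wedge R j (kos_diff R f T w') U)"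
      by (rule kos_diff_decompose[OF f T u'k w'k z_def])
    also have "\<dots> = kos_diff R f T u' U \<oplus> (f j \<otimes> (\<ominus> w U) \<ominus> (\<ominus> wedge R j (kos_diff R f T w) U))"
      by (simp only: wd w'_def)
    finally have "a U \<ominus> kos_diff R f (insert j T) z U =
        (u U \<oplus> wedge R j v U) \<ominus> (kos_diff R f T u' U \<oplus> (f j \<otimes> (\<ominus> w U) \<ominus> (\<ominus> wedge R j (kos_diff R f T w) U)))"
      using auv by simp
    also have "\<dots> = (u U \<oplus> f j \<otimes> w U \<ominus> kos_diff R f T u' U) \<oplus> (wedge R j v U \<ominus> wedge R j (kos_diff R f T w) U)"
      using xc[OF uk] wc[OF vk] dc[OF u'k] fj xc[OF wk] wc[OF kos_diff_kos[OF wk fT]] by algebra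
    also have "\<dots> = (b U \<ominus> kos_diff R f T u' U) \<oplus> wedge R j (\<lambda>U. v U \<ominus> kos_diff R f T w U) U"
      by (simp add: b_def wm)
    also have "\<dots> \<in> Q'"
      using u'(2) w(2) P(5) by (intro ideal_simps(2) wedge_ideal P) auto
    finally show ?thesis .
  qed
  ultimately show ?thesis by blast
qed

lemma acyclic_mod_insert:
  assumes f: "f \<in> insert j T \<rightarrow> carrier R" and T: "finite T" "j \<notin> T"
    and P: "ideal P R" "ideal Q R" "ideal Q' R" "P \<subseteq> Q" "Q \<subseteq> Q'"
    and ac: "acyclic_mod R f T t P Q" "acyclic_mod R f T t Q Q'"
  shows "acyclic_mod R f (insert j T) (Suc t) P Q'"
  unfolding acyclic_mod_def
proof (intro allI impI ballI)
  fix i a assume i: "Suc t < i" and a: "a \<in> kos_deg R (insert j T) i"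
    and d: "\<forall>U. kos_diff R f (insert j T) a U \<in> P"
  obtain i' where i': "i = Suc i'" "t < i'" using i by (cases i) auto
  show "\<exists>u\<in>kos_deg R (insert j T) (Suc i). \<forall>U. a U \<ominus> kos_diff R f (insert j T) u U \<in> Q'"
    unfolding i'
    by (rule acyclic_step[OF f T P]) (use a d ac i' in \<open>auto simp: acyclic_mod_def\<close>)
qed

lemma acyclic_mod_remove:
  assumes f: "f \<in> insert j T \<rightarrow> carrier R" and T: "finite T" "j \<notin> T"
    and P: "ideal P R" "ideal Q R" and j: "f j \<in> Idl (f ` T)"
    and ac: "acyclic_mod R f (insert j T) (Suc t) P Q"
  shows "acyclic_mod R f T t P Q"
  unfolding acyclic_mod_def
proof (intro allI impI ballI)
  fix i a assume i: "t < i" and a: "a \<in> kos_deg R T i" and d: "\<forall>U. kos_diff R f T a U \<in> P"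
  have fT: "f \<in> T \<rightarrow> carrier R" and fj: "f j \<in> carrier R" using f by auto
  obtain h where h: "null_homotopy R f T (f j) h" using null_homotopic[OF fT T(1) j] by auto
  note hdeg = null_homotopyD(1)[OF h] and hP = null_homotopyD(4)[OF h] and h = null_homotopyD(2,3)[OF h]
  note ak = kos_degD(1)[OF a]
  have dak: "kos_diff R f T a \<in> kos R T" by (rule kos_diff_kos[OF ak fT])
  define g where "g U = \<ominus> h a U" for U
  have g: "g \<in> kos_deg R T (Suc i)" unfolding g_def using kos_deg_closed(2)[OF hdeg[OF a] hdeg[OF a]] by auto
  note gk = kos_degD(1)[OF g]
  define b where "b U = g U \<oplus> wedge R j a U" for U
  have ins: "j \<in> insert j T" "finite (insert j T)" using T by auto
  have up: "x \<in> kos_deg R (insert j T) k" if "x \<in> kos_deg R T k" for x k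
    using that kos_deg_mono[of T "insert j T" R k] by auto
  have b: "b \<in> kos_deg R (insert j T) (Suc i)"
    unfolding b_def using kos_deg_closed(1)[OF up[OF g] wedge_deg[OF up[OF a] ins]] by auto
  have "kos_diff R f (insert j T) b U \<in> P" for U
  proof -
    have c: "a U \<in> carrier R" "h (kos_diff R f T a) U \<in> carrier R" "wedge R j (kos_diff R f T a) U \<in> carrier R"
      using ak h(1)[OF dak] dak by (auto simp: kos_def wedge_def)
    have "kos_diff R f (insert j T) b U
        = kos_diff R f T g U \<oplus> (f j \<otimes> a U \<ominus> wedge R j (kos_diff R f T a) U)"
      by (rule kos_diff_decompose[OF f T gk ak b_def])
    also have "kos_diff R f T g U = \<ominus> (f j \<otimes> a U \<ominus> h (kos_diff R f T a) U)"
      unfolding g_def using kos_diff_uminus[OF h(1)[OF ak] fT T(1)] h(2)[OF ak] by simp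
    also have "\<dots> \<oplus> (f j \<otimes> a U \<ominus> wedge R j (kos_diff R f T a) U)
        = h (kos_diff R f T a) U \<ominus> wedge R j (kos_diff R f T a) U"
      using c fj by algebra
    also have "\<dots> \<in> P"
      using d by (intro ideal_simps(3) hP wedge_ideal P dak) auto
    finally show ?thesis .
  qed
  then obtain z where z: "z \<in> kos_deg R (insert j T) (Suc (Suc i))"
    "\<And>U. b U \<ominus> kos_diff R f (insert j T) z U \<in> Q"
  proof -
    have "\<forall>a\<in>kos_deg R (insert j T) (Suc i). (\<forall>U. kos_diff R f (insert j T) a U \<in> P) \<longrightarrow>
        (\<exists>u\<in>kos_deg R (insert j T) (Suc (Suc i)). \<forall>U. a U \<ominus> kos_diff R f (insert j T) u U \<in> Q)"
      using ac i by (simp add: acyclic_mod_def)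
    then show thesis using b \<open>\<And>U. kos_diff R f (insert j T) b U \<in> P\<close> that by blast
  qed
  obtain u v where u: "u \<in> kos_deg R T (Suc (Suc i))" and v: "v \<in> kos_deg R T (Suc i)"
      and zuv: "\<And>U. z U = u U \<oplus> wedge R j v U"
    using kos_decompose[OF z(1) T] by blast
  note uk = kos_degD(1)[OF u] and vk = kos_degD(1)[OF v]
  define v' where "v' U = \<ominus> v U" for U
  have v': "v' \<in> kos_deg R T (Suc i)" unfolding v'_def using kos_deg_closed(2)[OF v v] by auto
  have "a U \<ominus> kos_diff R f T v' U \<in> Q" for U
  proof (cases "U \<subseteq> T")
    case True
    have dv: "kos_diff R f T v \<in> kos R T" and du: "kos_diff R f T u \<in> kos R T"
      using kos_diff_kos fT uk vk by auto
    have c: "a U \<in> carrier R" "kos_diff R f T v U \<in> carrier R" using ak dv by (auto simp: kos_def)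
    have jU: "j \<notin> U" using True T by auto
    have n: "\<not> insert j U \<subseteq> T" "insert j U - {j} = U" using jU T by auto
    let ?s = "signed R (card {u\<in>U. u < j})"
    have card: "{u. (u = j \<or> u \<in> U) \<and> u < j} = {u \<in> U. u < j}" by auto
    have "b (insert j U) = ?s (a U)"
      using kosD(2)[OF gk n(1)] c by (simp add: b_def wedge_def n(2) card)
    moreover have "kos_diff R f (insert j T) z (insert j U) = \<ominus> ?s (kos_diff R f T v U)"
      using kosD(2)[OF du n(1)] kosD(2)[OF vk n(1)] fj c
      by (simp add: kos_diff_decompose[OF f T uk vk zuv] wedge_def n(2) card minus_eq)
    ultimately have "?s (a U) \<oplus> ?s (kos_diff R f T v U) \<in> Q"
      using z(2)[of "insert j U"] c by (simp add: minus_eq)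
    then have "?s (a U \<oplus> kos_diff R f T v U) \<in> Q" using c by (simp add: signed_add)
    then have "?s (?s (a U \<oplus> kos_diff R f T v U)) \<in> Q" by (rule signed_ideal[OF P(2)])
    moreover have "kos_diff R f T v' U = \<ominus> kos_diff R f T v U"
      unfolding v'_def using kos_diff_uminus[OF vk fT T(1)] .
    ultimately show ?thesis using c by (simp add: minus_eq)
  next
    case False
    then have "a U = \<zero>" "kos_diff R f T v' U = \<zero>"
      using kosD(2)[OF ak] kosD(2)[OF kos_diff_kos[OF kos_degD(1)[OF v'] fT]] by auto
    then show ?thesis using ideal_simps(1)[OF P(2)] by (simp add: minus_eq)
  qed
  then show "\<exists>u\<in>kos_deg R T (Suc i). \<forall>U. a U \<ominus> kos_diff R f T u U \<in> Q" using v' by blast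
qed

lemma acyclic_insert_regular:
  assumes f: "f \<in> insert j T \<rightarrow> carrier R" and T: "finite T" "j \<notin> T"
    and ac: "acyclic_mod R f T 0 {\<zero>} {\<zero>}"
    and reg: "\<And>b. b \<in> carrier R \<Longrightarrow> f j \<otimes> b \<in> Idl (f ` T) \<Longrightarrow> b \<in> Idl (f ` T)"
  shows "acyclic_mod R f (insert j T) 0 {\<zero>} {\<zero>}"
  unfolding acyclic_mod_def
proof (intro allI impI ballI)
  fix i a assume i: "0 < i" and a: "a \<in> kos_deg R (insert j T) i"
    and d: "\<forall>U. kos_diff R f (insert j T) a U \<in> {\<zero>}"
  have fT: "f \<in> T \<rightarrow> carrier R" and fj: "f j \<in> carrier R" using f by auto
  obtain i' where i': "i = Suc i'" using i by (cases i) auto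
  show "\<exists>u\<in>kos_deg R (insert j T) (Suc i). \<forall>U. a U \<ominus> kos_diff R f (insert j T) u U \<in> {\<zero>}"
    unfolding i'
  proof (rule acyclic_step[OF f T zeroideal zeroideal zeroideal subset_refl subset_refl])
    show "a \<in> kos_deg R (insert j T) (Suc i')" using a i' by simp
    show "kos_diff R f (insert j T) a U \<in> {\<zero>}" for U using d by auto
  next
    fix b assume "b \<in> kos_deg R T (Suc i')" "\<And>U. kos_diff R f T b U \<in> {\<zero>}"
    then show "\<exists>u\<in>kos_deg R T (Suc (Suc i')). \<forall>U. b U \<ominus> kos_diff R f T u U \<in> {\<zero>}"
      using ac by (auto simp: acyclic_mod_def)
  next
    fix v assume v: "v \<in> kos_deg R T i'" and dv: "\<And>U. kos_diff R f T v U \<in> {\<zero>}"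
      and "\<exists>u. u \<in> kos_deg R T (Suc i') \<and> (\<forall>U. kos_diff R f T u U \<oplus> f j \<otimes> v U \<in> {\<zero>})"
    then obtain u where u: "u \<in> kos_deg R T (Suc i')"
      and uv: "\<And>U. kos_diff R f T u U \<oplus> f j \<otimes> v U = \<zero>" by auto
    show "\<exists>w\<in>kos_deg R T (Suc i'). \<forall>U. v U \<ominus> kos_diff R f T w U \<in> {\<zero>}"
    proof (cases "i' = 0")
      case False
      then show ?thesis using ac v dv by (auto simp: acyclic_mod_def)
    next
      case True
      have sub: "f ` T \<subseteq> carrier R" using fT by auto
      note I = genideal_ideal[OF sub]
      have v0: "v {} \<in> carrier R" using v by (auto simp: kos_deg_def kos_def)
      have uc: "u U \<in> carrier R" for U using u by (auto simp: kos_deg_def kos_def)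
      have "signed R k (f l \<otimes> u U) \<in> Idl (f ` T)" if "l \<in> T" for k l U
        using genideal_self[OF sub] that uc by (intro signed_ideal[OF I] ideal_simps(6)[OF I]) auto
      then have du: "kos_diff R f T u {} \<in> Idl (f ` T)"
        unfolding kos_diff_def if_P[OF empty_subsetI] by (intro finsum_ideal[OF I]) blast
      then have duc: "kos_diff R f T u {} \<in> carrier R" using ideal_simps(8)[OF I] by blast
      have "f j \<otimes> v {} = \<ominus> kos_diff R f T u {}"
        using uv[of "{}"] duc fj v0 by (metis add.inv_equality add.m_comm m_closed)
      then have "v {} \<in> Idl (f ` T)" using reg[OF v0] ideal_simps(4)[OF I du] by simp
      from null_homotopic[OF fT T(1) this] obtain h where h: "null_homotopy R f T (v {}) h" by auto
      note hdeg = null_homotopyD(1)[OF h] and hP = null_homotopyD(4)[OF h] and h = null_homotopyD(3)[OF h]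
      define e where "e U = (if U = {} then \<one> else \<zero>)" for U :: "nat set"
      have e: "e \<in> kos_deg R T 0"
        by (auto simp: kos_deg_def kos_def e_def)
      note ek = kos_degD(1)[OF e]
      have de: "kos_diff R f T e = (\<lambda>U. \<zero>)" by (rule kos_diff_deg0[OF e fT T(1)])
      have h0: "h (\<lambda>U. \<zero>) U = \<zero>" for U
        using hP[OF kos_closed(5)[OF ek ek one_closed] zeroideal, of U] by simp
      have "v U \<ominus> kos_diff R f T (h e) U = \<zero>" for U
      proof -
        have "v U = v {} \<otimes> e U"
        proof (cases "U = {}")
          case False
          have "card U \<noteq> 0 \<or> \<not> U \<subseteq> T" using False finite_subset[OF _ T(1), of U] by auto
          then have "v U = \<zero>" using v True by (auto simp: kos_deg_def kos_def)
          then show ?thesis using False v0 by (simp add: e_def)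
        qed (use v0 in \<open>simp add: e_def\<close>)
        moreover have "v U \<in> carrier R" using v by (auto simp: kos_deg_def kos_def)
        ultimately show ?thesis using h[OF ek, of U] de h0 by (simp add: minus_eq r_neg)
      qed
      then show ?thesis using hdeg[OF e] True by auto
    qed
  qed
qed

lemma acyclic_mod_empty:
  assumes "ideal Q R" shows "acyclic_mod R f {} t P Q"
  unfolding acyclic_mod_def
proof (intro allI impI ballI)
  fix i a assume i: "t < i" and a: "a \<in> kos_deg R {} i"
  have "a U = \<zero>" for U
    using a i by (cases "U = {}") (auto simp: kos_deg_def kos_def)
  then have "a U \<ominus> kos_diff R f {} (\<lambda>U. \<zero>) U \<in> Q" for U
    using ideal_simps(1)[OF assms] kos_diff_zero[of f "{}"] by (simp add: minus_eq)
  then show "\<exists>u\<in>kos_deg R {} (Suc i). \<forall>U. a U \<ominus> kos_diff R f {} u U \<in> Q"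
    using kos_deg_zero by blast
qed

lemma regular_sequence_acyclic:
  assumes "regular_sequence R xs" "\<And>i. i < length xs \<Longrightarrow> f (N + i) = xs ! i"
  shows "acyclic_mod R f {N..<N + length xs} 0 {\<zero>} {\<zero>}"
proof -
  have "acyclic_mod R f {N..<N + i} 0 {\<zero>} {\<zero>}" if "i \<le> length xs" for i
    using that
  proof (induction i)
    case 0
    then show ?case using acyclic_mod_empty[OF zeroideal] by simp
  next
    case (Suc i)
    have xc: "xs ! k \<in> carrier R" if "k < length xs" for k
      using assms(1) nth_mem[OF that] by (auto simp: regular_sequence_def)
    have im: "f ` {N..<N + i} = set (take i xs)"
    proof -
      have "{N..<N + i} = (+) N ` {..<i}" by (simp add: lessThan_atLeast0 add.commute)
      then have "f ` {N..<N + i} = (\<lambda>k. f (N + k)) ` {..<i}" by (simp add: image_image)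
      also have "\<dots> = (!) xs ` {..<i}" using assms(2) Suc.prems by (intro image_cong) auto
      also have "\<dots> = set (take i xs)" using Suc.prems nth_image[of i xs] by (simp add: lessThan_atLeast0)
      finally show ?thesis .
    qed
    have ins: "{N..<N + Suc i} = insert (N + i) {N..<N + i}" by auto
    show ?case unfolding ins
    proof (rule acyclic_insert_regular)
      show "f \<in> insert (N + i) {N..<N + i} \<rightarrow> carrier R"
      proof
        fix k assume "k \<in> insert (N + i) {N..<N + i}"
        then have "k = N + (k - N)" "k - N < length xs" using Suc.prems by auto
        then show "f k \<in> carrier R" using assms(2)[of "k - N"] xc[of "k - N"] by simp
      qed
      show "acyclic_mod R f {N..<N + i} 0 {\<zero>} {\<zero>}" using Suc by auto
      show "b \<in> Idl (f ` {N..<N + i})" if "b \<in> carrier R" "f (N + i) \<otimes> b \<in> Idl (f ` {N..<N + i})" for b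
        using that assms Suc.prems unfolding im by (auto simp: regular_sequence_def)
    qed auto
  qed
  then show ?thesis by simp
qed

end

section \<open>The Artin-Rees lemma\<close>

lemma nat_incseq_subsequence:
  fixes x :: "nat \<Rightarrow> nat"
  shows "\<exists>g :: nat \<Rightarrow> nat. strict_mono g \<and> incseq (x \<circ> g)"
proof -
  obtain g :: "nat \<Rightarrow> nat" where g: "strict_mono g" "monoseq (\<lambda>n. x (g n))"
    using seq_monosub[of x] by auto
  show ?thesis
  proof (cases "incseq (\<lambda>n. x (g n))")
    case False
    then have dec: "decseq (\<lambda>n. x (g n))" using g(2) by (auto simp: monoseq_iff)
    define N where "N = (ARG_MIN (\<lambda>n. x (g n)) n. True)"
    have N: "x (g N) \<le> x (g n)" for n unfolding N_def using arg_min_nat_le[of "\<lambda>_. True" _ "\<lambda>n. x (g n)"] by auto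
    have "x (g (N + n)) = x (g N)" for n
      using N[of "N + n"] dec by (auto simp: decseq_def intro: antisym)
    then have "incseq (x \<circ> (\<lambda>n. g (N + n)))" by (auto simp: incseq_def)
    moreover have "strict_mono (\<lambda>n. g (N + n))" using g(1) by (auto simp: strict_mono_def)
    ultimately show ?thesis by blast
  qed (use g(1) in \<open>auto simp: comp_def\<close>)
qed

lemma dickson_subsequence:
  fixes x :: "nat \<Rightarrow> nat \<Rightarrow> nat"
  shows "\<exists>g :: nat \<Rightarrow> nat. strict_mono g \<and> (\<forall>c<s. incseq (\<lambda>n. x (g n) c))"
proof (induction s)
  case 0
  show ?case by (intro exI[of _ id]) (auto simp: strict_mono_def)
next
  case (Suc s)
  then obtain g :: "nat \<Rightarrow> nat" where g: "strict_mono g" "\<forall>c<s. incseq (\<lambda>n. x (g n) c)" by auto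
  obtain h :: "nat \<Rightarrow> nat" where h: "strict_mono h" "incseq ((\<lambda>n. x (g n) s) \<circ> h)"
    using nat_incseq_subsequence by blast
  have "incseq (\<lambda>n. x (g (h n)) c)" if "c < Suc s" for c
  proof (cases "c = s")
    case True then show ?thesis using h(2) by (simp add: comp_def)
  next
    case False
    then have "incseq (\<lambda>n. x (g n) c)" using g(2) that by auto
    then show ?thesis using h(1) by (auto simp: incseq_def strict_mono_less_eq)
  qed
  then show ?case using g(1) h(1) by (intro exI[of _ "g \<circ> h"]) (auto simp: strict_mono_def)
qed

definition mdeg :: "(nat \<Rightarrow>\<^sub>0 nat) \<Rightarrow> nat" where
  "mdeg m = (\<Sum>i\<in>Poly_Mapping.keys m. Poly_Mapping.lookup m i)"

lemma mdeg_altdef: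
  assumes "Poly_Mapping.keys m \<subseteq> {..<s}"
  shows "mdeg m = (\<Sum>i<s. Poly_Mapping.lookup m i)"
  unfolding mdeg_def using assms by (intro sum.mono_neutral_left) (auto simp: in_keys_iff)

lemma keys_plus_nat:
  fixes m m' :: "nat \<Rightarrow>\<^sub>0 nat" shows "Poly_Mapping.keys (m + m') = Poly_Mapping.keys m \<union> Poly_Mapping.keys m'"
  by (auto simp: in_keys_iff lookup_add)

lemma mdeg_add: "mdeg (m + m') = mdeg m + mdeg m'"
proof -
  obtain s where s: "Poly_Mapping.keys m \<union> Poly_Mapping.keys m' \<subseteq> {..<s}"
    using finite_nat_set_iff_bounded[of "Poly_Mapping.keys m \<union> Poly_Mapping.keys m'"] by auto
  then show ?thesis
    using mdeg_altdef[of m s] mdeg_altdef[of m' s] mdeg_altdef[of "m + m'" s]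
    by (auto simp: keys_plus_nat lookup_add sum.distrib)
qed

lemma mdeg_0 [simp]: "mdeg 0 = 0" by (simp add: mdeg_def)

lemma mdeg_single [simp]: "mdeg (Poly_Mapping.single i k) = k" by (simp add: mdeg_def)

lemma le_imp_add:
  fixes m m' :: "nat \<Rightarrow>\<^sub>0 nat"
  assumes "\<And>i. Poly_Mapping.lookup m i \<le> Poly_Mapping.lookup m' i"
  shows "m' = m + (m' - m)"
  using assms by (intro poly_mapping_eqI) (simp add: lookup_add lookup_minus)

lemma finite_mdeg: "finite {m. Poly_Mapping.keys m \<subseteq> {..<s} \<and> mdeg m = k}"
proof (rule finite_imageD)
  show "inj_on Poly_Mapping.lookup {m. Poly_Mapping.keys m \<subseteq> {..<s} \<and> mdeg m = k}"
    by (rule inj_onI) (simp add: poly_mapping.lookup_inject)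
  have "Poly_Mapping.lookup ` {m. Poly_Mapping.keys m \<subseteq> {..<s} \<and> mdeg m = k}
     \<subseteq> {f. \<forall>i. (i \<in> {..<s} \<longrightarrow> f i \<in> {..k}) \<and> (i \<notin> {..<s} \<longrightarrow> f i = 0)}"
  proof
    fix f assume "f \<in> Poly_Mapping.lookup ` {m. Poly_Mapping.keys m \<subseteq> {..<s} \<and> mdeg m = k}"
    then obtain m where m: "Poly_Mapping.keys m \<subseteq> {..<s}" "mdeg m = k" "f = Poly_Mapping.lookup m" by auto
    have "f i \<le> k" if "i < s" for i
      using member_le_sum[of i "{..<s}" f] that mdeg_altdef[OF m(1)] m(2,3) by simp
    moreover have "f i = 0" if "\<not> i < s" for i
      using m(1,3) that by (metis in_keys_iff lessThan_iff subsetD)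
    ultimately show "f \<in> {f. \<forall>i. (i \<in> {..<s} \<longrightarrow> f i \<in> {..k}) \<and> (i \<notin> {..<s} \<longrightarrow> f i = 0)}" by auto
  qed
  then show "finite (Poly_Mapping.lookup ` {m. Poly_Mapping.keys m \<subseteq> {..<s} \<and> mdeg m = k})"
    by (rule finite_subset) (rule finite_set_of_finite_funs, auto)
qed

lemma dickson:
  fixes x :: "nat \<Rightarrow> (nat \<Rightarrow>\<^sub>0 nat)"
  assumes x: "\<And>n. Poly_Mapping.keys (x n) \<subseteq> {..<s}"
  shows "\<exists>g :: nat \<Rightarrow> nat. strict_mono g \<and>
    (\<forall>k n. k \<le> n \<longrightarrow> (\<exists>m. x (g n) = x (g k) + m \<and> Poly_Mapping.keys m \<subseteq> {..<s}))"
proof -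
  obtain g :: "nat \<Rightarrow> nat" where g: "strict_mono g" "\<forall>c<s. incseq (\<lambda>n. Poly_Mapping.lookup (x (g n)) c)"
    using dickson_subsequence[of s "\<lambda>n. Poly_Mapping.lookup (x n)"] by auto
  have "\<exists>m. x (g n) = x (g k) + m \<and> Poly_Mapping.keys m \<subseteq> {..<s}" if "k \<le> n" for k n
  proof -
    have dvd: "x (g n) = x (g k) + (x (g n) - x (g k))"
    proof (rule le_imp_add)
      fix i
      show "Poly_Mapping.lookup (x (g k)) i \<le> Poly_Mapping.lookup (x (g n)) i"
      proof (cases "i < s")
        case False
        then have "i \<notin> Poly_Mapping.keys (x (g k))" using x by auto
        then show ?thesis by (simp add: in_keys_iff)
      qed (use g(2) that in \<open>auto simp: incseq_def\<close>)
    qed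
    have "Poly_Mapping.keys (x (g n) - x (g k)) \<subseteq> Poly_Mapping.keys (x (g n))"
      by (subst (2) dvd) (simp add: keys_plus_nat)
    then show ?thesis using dvd x[of "g n"] by blast
  qed
  then show ?thesis using g(1) by blast
qed

lemma (in noetherian_cring) ideal_family_stabilizes:
  fixes L :: "(nat \<Rightarrow>\<^sub>0 nat) \<Rightarrow> 'a set"
  assumes L: "\<And>m. Poly_Mapping.keys m \<subseteq> {..<s} \<Longrightarrow> ideal (L m) R"
    and mono: "\<And>m m'. Poly_Mapping.keys m \<subseteq> {..<s} \<Longrightarrow> Poly_Mapping.keys m' \<subseteq> {..<s} \<Longrightarrow> L m \<subseteq> L (m + m')"
  shows "\<exists>d. \<forall>m. Poly_Mapping.keys m \<subseteq> {..<s} \<longrightarrow> 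
    (\<exists>m0 m1. m = m0 + m1 \<and> Poly_Mapping.keys m0 \<subseteq> {..<s} \<and> mdeg m0 \<le> d \<and> L m0 = L m)"
proof (rule ccontr)
  assume "\<not> ?thesis"
  then have "\<forall>d. \<exists>m. Poly_Mapping.keys m \<subseteq> {..<s} \<and> (\<forall>m0 m1. m = m0 + m1 \<longrightarrow>
      Poly_Mapping.keys m0 \<subseteq> {..<s} \<longrightarrow> mdeg m0 \<le> d \<longrightarrow> L m0 \<noteq> L m)" by blast
  then obtain x where x: "\<And>d. Poly_Mapping.keys (x d) \<subseteq> {..<s}"
    and bad: "\<And>d m0 m1. x d = m0 + m1 \<Longrightarrow> Poly_Mapping.keys m0 \<subseteq> {..<s} \<Longrightarrow> mdeg m0 \<le> d \<Longrightarrow> L m0 \<noteq> L (x d)"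
    by metis
  obtain g :: "nat \<Rightarrow> nat" where g: "strict_mono g"
    "\<And>k n. k \<le> n \<Longrightarrow> \<exists>m. x (g n) = x (g k) + m \<and> Poly_Mapping.keys m \<subseteq> {..<s}"
    using dickson[of x s] x by auto
  define y where "y n = x (g n)" for n
  have yk: "Poly_Mapping.keys (y n) \<subseteq> {..<s}" for n using x by (simp add: y_def)
  have Lm: "L (y k) \<subseteq> L (y n)" if kn: "k \<le> n" for k n
  proof -
    obtain m where "y n = y k + m" "Poly_Mapping.keys m \<subseteq> {..<s}" using g(2)[OF kn] by (auto simp: y_def)
    then show ?thesis using mono[OF yk[of k]] by simp
  qed
  define D where "D = {(I, J). ideal I R \<and> ideal J R \<and> J \<subset> I}"
  have "wf D" unfolding D_def by (rule wf_ideals)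
  from wfE_min[OF this, of "L (y 0)" "range (\<lambda>n. L (y n))"]
  obtain z where z: "z \<in> range (\<lambda>n. L (y n))" "\<And>w. (w, z) \<in> D \<Longrightarrow> w \<notin> range (\<lambda>n. L (y n))"
    by auto
  then obtain k where "z = L (y k)" by blast
  then have k: "(L (y n), L (y k)) \<notin> D" for n using z(2) by blast
  define n where "n = max k (mdeg (y k))"
  have "L (y k) = L (y n)"
    using k[of n] Lm[of k n] L[OF yk] by (auto simp: D_def n_def)
  moreover have "mdeg (y k) \<le> g n"
    using strict_mono_imp_increasing[OF g(1), of n] by (simp add: n_def)
  moreover obtain m where "x (g n) = y k + m" using g(2)[of k n] by (auto simp: n_def y_def)
  ultimately show False using bad[of "g n" "y k" m] yk[of k] by (metis y_def)
qed

text \<open>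
  Linear combinations of the elements \<open>mn \<alpha> e\<^sub>j\<close>, \<open>(\<alpha>, j) \<in> S\<close>, of a free module with coordinates
  indexed by \<open>e 0, e 1, \<dots>\<close>.
\<close>

inductive_set mspan :: "('a, 'b) ring_scheme \<Rightarrow> ('m \<Rightarrow> 'a) \<Rightarrow> (nat \<Rightarrow> 'i) \<Rightarrow> ('m \<times> nat) set \<Rightarrow> ('i \<Rightarrow> 'a) set"
  for R mn e S where
  zero: "(\<lambda>U. \<zero>\<^bsub>R\<^esub>) \<in> mspan R mn e S"
| add: "u \<in> mspan R mn e S \<Longrightarrow> (m, j) \<in> S \<Longrightarrow> c \<in> carrier R \<Longrightarrow>
    (\<lambda>U. u U \<oplus>\<^bsub>R\<^esub> (if U = e j then c \<otimes>\<^bsub>R\<^esub> mn m else \<zero>\<^bsub>R\<^esub>)) \<in> mspan R mn e S"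

context cring
begin

lemma mspan_closed:
  assumes "u \<in> mspan R mn e S" "\<And>m. mn m \<in> carrier R"
  shows "u U \<in> carrier R"
  using assms(1) by induction (use assms(2) in auto)

lemma mspan_add:
  assumes mn: "\<And>m. mn m \<in> carrier R" and u: "u \<in> mspan R mn e S" and w: "w \<in> mspan R mn e S"
  shows "(\<lambda>U. u U \<oplus> w U) \<in> mspan R mn e S"
  using w
proof induction
  case zero
  then show ?case using u mspan_closed[OF u mn] by simp
next
  case (add w m j c)
  have "(\<lambda>U. u U \<oplus> (w U \<oplus> (if U = e j then c \<otimes> mn m else \<zero>)))
      = (\<lambda>U. (u U \<oplus> w U) \<oplus> (if U = e j then c \<otimes> mn m else \<zero>))"
    using mspan_closed[OF u mn] mspan_closed[OF add(1) mn] mn add(3) by (intro ext) (simp add: a_assoc)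
  then show ?case using mspan.add[OF add(4,2,3)] by simp
qed

lemma mspan_smult:
  assumes mn: "\<And>m. mn m \<in> carrier R" and u: "u \<in> mspan R mn e S" and r: "r \<in> carrier R"
  shows "(\<lambda>U. r \<otimes> u U) \<in> mspan R mn e S"
  using u
proof induction
  case zero
  then show ?case using r by (simp add: mspan.zero)
next
  case (add w m j c)
  have "(\<lambda>U. r \<otimes> (w U \<oplus> (if U = e j then c \<otimes> mn m else \<zero>)))
      = (\<lambda>U. (r \<otimes> w U) \<oplus> (if U = e j then (r \<otimes> c) \<otimes> mn m else \<zero>))"
    using mspan_closed[OF add(1) mn] mn add(3) r by (intro ext) (simp add: r_distr m_assoc)
  then show ?case using mspan.add[OF add(4,2), of "r \<otimes> c"] r add(3) by simp
qed

lemma mspan_shift: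
  assumes mn: "\<And>m. mn m \<in> carrier R" "\<And>m m'. mn (m + m') = mn m \<otimes> mn m'"
    and u: "u \<in> mspan R mn e S" and S': "\<And>m j. (m, j) \<in> S \<Longrightarrow> (m + m', j) \<in> S'"
  shows "(\<lambda>U. mn m' \<otimes> u U) \<in> mspan R mn e S'"
  using u
proof induction
  case zero
  then show ?case using mn(1) by (simp add: mspan.zero)
next
  case (add w m j c)
  have "(\<lambda>U. mn m' \<otimes> (w U \<oplus> (if U = e j then c \<otimes> mn m else \<zero>)))
      = (\<lambda>U. (mn m' \<otimes> w U) \<oplus> (if U = e j then c \<otimes> mn (m + m') else \<zero>))"
    using mspan_closed[OF add(1) mn(1)] mn add(3) by (intro ext) (simp add: r_distr m_ac)
  then show ?case using mspan.add[OF add(4) S'[OF add(2)] add(3)] by simp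
qed

lemma mspan_insert:
  assumes mn: "\<And>m. mn m \<in> carrier R" and u: "u \<in> mspan R mn e (insert (m, j) S)"
  shows "\<exists>w\<in>mspan R mn e S. \<exists>c\<in>carrier R. u = (\<lambda>U. w U \<oplus> (if U = e j then c \<otimes> mn m else \<zero>))"
  using u
proof induction
  case zero
  show ?case
    by (rule bexI[OF _ mspan.zero], rule bexI[of _ \<zero>]) (use mn in auto)
next
  case (add u m' j' c')
  then obtain w c where w: "w \<in> mspan R mn e S" "c \<in> carrier R"
    "u = (\<lambda>U. w U \<oplus> (if U = e j then c \<otimes> mn m else \<zero>))" by blast
  have wc: "w U \<in> carrier R" for U using mspan_closed[OF w(1) mn] .
  show ?case
  proof (cases "(m', j') = (m, j)")
    case True
    have "(\<lambda>U. u U \<oplus> (if U = e j' then c' \<otimes> mn m' else \<zero>))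
        = (\<lambda>U. w U \<oplus> (if U = e j then (c \<oplus> c') \<otimes> mn m else \<zero>))"
      using True wc mn w add(3) by (intro ext) (simp add: l_distr a_assoc)
    then show ?thesis using w add(3) by (intro bexI[OF _ w(1)] bexI[of _ "c \<oplus> c'"]) auto
  next
    case False
    then have "(m', j') \<in> S" using add(2) by auto
    then have 1: "(\<lambda>U. w U \<oplus> (if U = e j' then c' \<otimes> mn m' else \<zero>)) \<in> mspan R mn e S"
      using mspan.add[OF w(1) _ add(3)] by blast
    have 2: "(\<lambda>U. u U \<oplus> (if U = e j' then c' \<otimes> mn m' else \<zero>))
        = (\<lambda>U. (w U \<oplus> (if U = e j' then c' \<otimes> mn m' else \<zero>)) \<oplus> (if U = e j then c \<otimes> mn m else \<zero>))"
      using wc mn w add(3) by (intro ext) (simp add: a_ac)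
    show ?thesis by (rule bexI[OF _ 1], rule bexI[OF _ w(2)], rule 2)
  qed
qed

end

definition pos_less :: "('m::linorder \<times> nat) \<Rightarrow> ('m \<times> nat) \<Rightarrow> bool" where
  "pos_less p q \<longleftrightarrow> snd p < snd q \<or> (snd p = snd q \<and> fst p < fst q)"

lemma finite_pos_max:
  assumes "finite S" "S \<noteq> {}"
  shows "\<exists>p\<in>S. \<forall>q\<in>S. q \<noteq> p \<longrightarrow> pos_less q p"
proof -
  define j where "j = Max (snd ` S)"
  have j: "j \<in> snd ` S" "\<And>q. q \<in> S \<Longrightarrow> snd q \<le> j" using assms by (auto simp: j_def)
  define A where "A = fst ` {p \<in> S. snd p = j}"
  have A: "finite A" "A \<noteq> {}" using assms j by (auto simp: A_def)
  then have "Max A \<in> A" by (rule Max_in)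
  then have "(Max A, j) \<in> S" by (auto simp: A_def)
  moreover have "pos_less q (Max A, j)" if "q \<in> S" "q \<noteq> (Max A, j)" for q
  proof (cases "snd q = j")
    case True
    then have "fst q \<in> A" using that by (auto simp: A_def)
    then have "fst q \<le> Max A" using A by simp
    then show ?thesis using True that by (cases q) (auto simp: pos_less_def)
  qed (use j(2)[OF that(1)] in \<open>auto simp: pos_less_def\<close>)
  ultimately show ?thesis by blast
qed

text \<open>
  The leading coefficients of elements of \<open>N\<close> at the positions \<open>(\<alpha>, j)\<close> form ideals that increase with \<open>\<alpha>\<close>, so they are all attained in bounded
  degree; elements of \<open>N\<close> of high degree are then reduced by multiples of elements of \<open>N\<close>.
\<close>

lemma (in noetherian_cring) artin_rees:
  fixes mn :: "(nat \<Rightarrow>\<^sub>0 nat) \<Rightarrow> 'a" and e :: "nat \<Rightarrow> 'i" and s n :: nat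
  assumes mn: "\<And>m. mn m \<in> carrier R" "\<And>m m'. mn (m + m') = mn m \<otimes> mn m'"
    and N: "(\<lambda>U. \<zero>) \<in> N" "\<And>g h. g \<in> N \<Longrightarrow> h \<in> N \<Longrightarrow> (\<lambda>U. g U \<oplus> h U) \<in> N"
      "\<And>r g. r \<in> carrier R \<Longrightarrow> g \<in> N \<Longrightarrow> (\<lambda>U. r \<otimes> g U) \<in> N"
  defines "D k \<equiv> {m. Poly_Mapping.keys m \<subseteq> {..<s} \<and> mdeg m = k} \<times> {..<n}"
  shows "\<exists>r. \<forall>k Q. (\<lambda>U. \<zero>) \<in> Q \<longrightarrow> (\<forall>g\<in>Q. \<forall>h\<in>Q. (\<lambda>U. g U \<oplus> h U) \<in> Q) \<longrightarrow>
     (\<forall>m g. k - r \<le> mdeg m \<longrightarrow> Poly_Mapping.keys m \<subseteq> {..<s} \<longrightarrow> g \<in> N \<longrightarrow> (\<lambda>U. mn m \<otimes> g U) \<in> Q) \<longrightarrow>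
     N \<inter> mspan R mn e (D k) \<subseteq> Q"
proof -
  define v where "v c m j = (\<lambda>U. if U = e j then c \<otimes> mn m else \<zero>)" for c m j
  define below where "below m j = {q \<in> D (mdeg m). pos_less q (m, j)}" for m j
  define L where "L j m = {c \<in> carrier R. \<exists>u\<in>mspan R mn e (below m j). (\<lambda>U. u U \<oplus> v c m j U) \<in> N}" for j m
  have uc: "u U \<in> carrier R" if "u \<in> mspan R mn e S" for u S U using mspan_closed[OF that mn(1)] .
  have LI: "c \<in> L j m" if "u \<in> mspan R mn e (below m j)" "c \<in> carrier R" "(\<lambda>U. u U \<oplus> v c m j U) \<in> N"
    for c j m u
    unfolding L_def by (rule CollectI, rule conjI[OF that(2)], rule bexI[OF _ that(1)], rule that(3))
  have L_ideal: "ideal (L j m) R" for j m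
  proof (rule idealI')
    have "(\<lambda>U. \<zero> \<oplus> v \<zero> m j U) = (\<lambda>U. \<zero>)" using mn(1) by (auto simp: v_def)
    then show "\<zero> \<in> L j m"
      by (intro LI[of "\<lambda>U. \<zero>"] mspan.zero) (use N(1) in auto)
  next
    fix c c' assume "c \<in> L j m" "c' \<in> L j m"
    then obtain u u' where c: "c \<in> carrier R" "c' \<in> carrier R" and
      u: "u \<in> mspan R mn e (below m j)" "u' \<in> mspan R mn e (below m j)"
      "(\<lambda>U. u U \<oplus> v c m j U) \<in> N" "(\<lambda>U. u' U \<oplus> v c' m j U) \<in> N" by (auto simp: L_def)
    have "(\<lambda>U. (u U \<oplus> v c m j U) \<oplus> (u' U \<oplus> v c' m j U)) = (\<lambda>U. (u U \<oplus> u' U) \<oplus> v (c \<oplus> c') m j U)"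
      using uc[OF u(1)] uc[OF u(2)] c mn(1) by (intro ext) (auto simp: v_def l_distr a_ac)
    then show "c \<oplus> c' \<in> L j m"
      using N(2)[OF u(3,4)] mspan_add[OF mn(1) u(1,2)] c by (auto simp: L_def)
  next
    fix r c assume r: "r \<in> carrier R" and "c \<in> L j m"
    then obtain u where c: "c \<in> carrier R" and
      u: "u \<in> mspan R mn e (below m j)" "(\<lambda>U. u U \<oplus> v c m j U) \<in> N" by (auto simp: L_def)
    have "(\<lambda>U. r \<otimes> (u U \<oplus> v c m j U)) = (\<lambda>U. (r \<otimes> u U) \<oplus> v (r \<otimes> c) m j U)"
      using uc[OF u(1)] c mn(1) r by (intro ext) (auto simp: v_def r_distr m_assoc)
    then show "r \<otimes> c \<in> L j m"
      using N(3)[OF r u(2)] mspan_smult[OF mn(1) u(1) r] c r by (auto simp: L_def)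
  qed (auto simp: L_def)
  have shift_below: "(m1 + m', j1) \<in> below (m + m') j"
    if "(m1, j1) \<in> below m j" "Poly_Mapping.keys m' \<subseteq> {..<s}" for m m' m1 j j1
    using that by (auto simp: below_def D_def keys_plus_nat mdeg_add pos_less_def)
  have shift_v: "(\<lambda>U. mn m' \<otimes> (u U \<oplus> v c m j U)) = (\<lambda>U. (mn m' \<otimes> u U) \<oplus> v c (m + m') j U)"
    if "u \<in> mspan R mn e S" "c \<in> carrier R" for u S c m m' j
    using uc[OF that(1)] that(2) mn by (intro ext) (auto simp: v_def r_distr m_ac)
  have L_mono: "L j m \<subseteq> L j (m + m')" if "Poly_Mapping.keys m' \<subseteq> {..<s}" for j m m'
  proof
    fix c assume "c \<in> L j m"
    then obtain u where c: "c \<in> carrier R" and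
      u: "u \<in> mspan R mn e (below m j)" "(\<lambda>U. u U \<oplus> v c m j U) \<in> N" by (auto simp: L_def)
    have "(\<lambda>U. mn m' \<otimes> u U) \<in> mspan R mn e (below (m + m') j)"
      by (rule mspan_shift[OF mn u(1)]) (use shift_below that in auto)
    then show "c \<in> L j (m + m')"
      by (rule LI[OF _ c]) (use N(3)[OF mn(1)[of m'] u(2)] in \<open>simp only: shift_v[OF u(1) c]\<close>)
  qed
  have "\<exists>d. \<forall>m. Poly_Mapping.keys m \<subseteq> {..<s} \<longrightarrow> 
    (\<exists>m0 m1. m = m0 + m1 \<and> Poly_Mapping.keys m0 \<subseteq> {..<s} \<and> mdeg m0 \<le> d \<and> L j m0 = L j m)" for j
    by (rule ideal_family_stabilizes[OF L_ideal]) (rule L_mono)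
  then obtain d where d: "\<And>j m. Poly_Mapping.keys m \<subseteq> {..<s} \<Longrightarrow>
    \<exists>m0 m1. m = m0 + m1 \<and> Poly_Mapping.keys m0 \<subseteq> {..<s} \<and> mdeg m0 \<le> d j \<and> L j m0 = L j m" by metis
  define r where "r = Max (insert 0 (d ` {..<n}))"
  have dr: "d j \<le> r" if "j < n" for j unfolding r_def using that by (intro Max_ge) auto
  show ?thesis
  proof (intro exI[of _ r] allI impI)
    fix k Q
    assume Q0: "(\<lambda>U. \<zero>) \<in> Q" and Qadd: "\<forall>g\<in>Q. \<forall>h\<in>Q. (\<lambda>U. g U \<oplus> h U) \<in> Q"
      and Qm: "\<forall>m g. k - r \<le> mdeg m \<longrightarrow> Poly_Mapping.keys m \<subseteq> {..<s} \<longrightarrow> g \<in> N \<longrightarrow> (\<lambda>U. mn m \<otimes> g U) \<in> Q"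
    have "g \<in> Q" if "finite S" "S \<subseteq> D k" "\<And>p q. p \<in> S \<Longrightarrow> q \<in> D k \<Longrightarrow> pos_less q p \<Longrightarrow> q \<in> S"
      "g \<in> N" "g \<in> mspan R mn e S" for S g
      using that
    proof (induction "card S" arbitrary: S g)
      case 0
      then have "S = {}" by auto
      have "g = (\<lambda>U. \<zero>)" using 0(6) unfolding \<open>S = {}\<close> by (induction rule: mspan.induct) auto
      then show ?case using Q0 by simp
    next
      case (Suc l)
      then have "S \<noteq> {}" by auto
      with Suc.prems(1) obtain p where p: "p \<in> S" "\<forall>q\<in>S. q \<noteq> p \<longrightarrow> pos_less q p"
        using finite_pos_max by blast
      obtain m j where pm: "p = (m, j)" by (cases p)
      have mj: "Poly_Mapping.keys m \<subseteq> {..<s}" "mdeg m = k" "j < n"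
        using p(1) Suc.prems(2) by (auto simp: pm D_def)
      define S' where "S' = S - {p}"
      have S: "S = insert (m, j) S'" using p(1) by (auto simp: S'_def pm)
      have S'b: "S' = below m j"
      proof
        show "S' \<subseteq> below m j" using p(2) Suc.prems(2) mj by (auto simp: S'_def below_def pm)
        show "below m j \<subseteq> S'"
          using Suc.prems(3)[OF p(1)] mj by (auto simp: S'_def below_def pm) (auto simp: pos_less_def)
      qed
      obtain w c where w: "w \<in> mspan R mn e S'" "c \<in> carrier R" "g = (\<lambda>U. w U \<oplus> v c m j U)"
        using mspan_insert[OF mn(1) Suc.prems(5)[unfolded S]] unfolding v_def by blast
      have "c \<in> L j m" using w Suc.prems(4) unfolding L_def S'b by auto
      moreover obtain m0 m1 where m01: "m = m0 + m1" "Poly_Mapping.keys m0 \<subseteq> {..<s}" "mdeg m0 \<le> d j" "L j m0 = L j m"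
        using d[OF mj(1)] by blast
      ultimately obtain u where u: "u \<in> mspan R mn e (below m0 j)" "(\<lambda>U. u U \<oplus> v c m0 j U) \<in> N"
        by (auto simp: L_def)
      have m1: "Poly_Mapping.keys m1 \<subseteq> {..<s}" using mj(1) m01(1) by (auto simp: keys_plus_nat)
      have "k - r \<le> mdeg m1" using mj(2) m01 dr[OF mj(3)] by (simp add: mdeg_add)
      define u' where "u' = (\<lambda>U. mn m1 \<otimes> u U)"
      have u': "u' \<in> mspan R mn e S'"
        unfolding S'b m01(1) u'_def by (rule mspan_shift[OF mn u(1)]) (use shift_below m1 in auto)
      define g1 where "g1 = (\<lambda>U. u' U \<oplus> v c m j U)"
      have g1_eq: "g1 = (\<lambda>U. mn m1 \<otimes> (u U \<oplus> v c m0 j U))"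
        unfolding g1_def u'_def m01(1) shift_v[OF u(1) w(2)] ..
      have "g1 \<in> Q" unfolding g1_eq using Qm \<open>k - r \<le> mdeg m1\<close> m1 u(2) by blast
      have "g1 \<in> N" unfolding g1_eq using N(3)[OF mn(1) u(2)] .
      define g2 where "g2 = (\<lambda>U. g U \<oplus> (\<ominus> \<one>) \<otimes> g1 U)"
      have vc: "v c m j U \<in> carrier R" for U using w(2) mn(1) by (auto simp: v_def)
      have g2_eq: "g2 = (\<lambda>U. w U \<oplus> (\<ominus> \<one>) \<otimes> u' U)"
      proof
        fix U
        show "g2 U = w U \<oplus> (\<ominus> \<one>) \<otimes> u' U"
          unfolding g2_def g1_def w(3) using uc[OF w(1), of U] uc[OF u', of U] vc[of U] by algebra
      qed
      have "g2 \<in> Q"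
      proof (rule Suc.hyps(1)[of S'])
        show "l = card S'" using Suc.hyps(2) Suc.prems(1) p(1) by (simp add: S'_def)
        show "finite S'" "S' \<subseteq> D k" using Suc.prems by (auto simp: S'_def)
        show "g2 \<in> N" unfolding g2_def by (intro N(2,3) Suc.prems \<open>g1 \<in> N\<close>) auto
        show "g2 \<in> mspan R mn e S'"
          unfolding g2_eq by (intro mspan_add[OF mn(1) w(1)] mspan_smult[OF mn(1) u']) auto
        fix p' q assume "p' \<in> S'" "q \<in> D k" "pos_less q p'"
        then show "q \<in> S'" using mj unfolding S'b below_def by (auto simp: pos_less_def)
      qed
      moreover have "g = (\<lambda>U. g2 U \<oplus> g1 U)"
      proof
        fix U
        have "g U \<in> carrier R" "g1 U \<in> carrier R"
          using uc[OF Suc.prems(5)] uc[OF u', of U] vc[of U] by (auto simp: g1_def)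
        then show "g U = g2 U \<oplus> g1 U" unfolding g2_def by algebra
      qed
      ultimately show ?case using Qadd \<open>g1 \<in> Q\<close> by metis
    qed
    moreover have "finite (D k)" unfolding D_def using finite_mdeg by auto
    ultimately show "N \<inter> mspan R mn e (D k) \<subseteq> Q" by blast
  qed
qed

lemma (in cring) ideal_power_mult:
  assumes I: "ideal I R" and x: "x \<in> ideal_power R I k" and y: "y \<in> ideal_power R I l"
  shows "x \<otimes> y \<in> ideal_power R I (k + l)"
proof -
  interpret S: comm_monoid "ideals_set R" by (rule ideals_set_is_comm_monoid)
  have "I \<in> carrier (ideals_set R)" using I by (simp add: ideals_set_def)
  from S.nat_pow_mult[OF this, of k l] show ?thesis using ideal_prod.prod[OF x y, of R] by simp
qed

lemma (in cring) ideal_power_antimono: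
  assumes I: "ideal I R" and "k \<le> l"
  shows "ideal_power R I l \<subseteq> ideal_power R I k"
  using assms(2)
proof (induction l rule: dec_induct)
  case (step l)
  have "ideal_prod R (ideal_power R I l) I \<subseteq> ideal_power R I l"
    using ideal_prod_inter[OF ideal_power_ideal[OF I] I] by auto
  then show ?case using step by auto
qed auto

definition eval_monom :: "('a, 'b) ring_scheme \<Rightarrow> (nat \<Rightarrow> 'a) \<Rightarrow> nat \<Rightarrow> (nat \<Rightarrow>\<^sub>0 nat) \<Rightarrow> 'a" where
  "eval_monom R g s m = (\<Otimes>\<^bsub>R\<^esub>i\<in>{..<s}. g i [^]\<^bsub>R\<^esub> Poly_Mapping.lookup m i)"

context cring
begin

lemma eval_monom_closed: "g \<in> {..<s} \<rightarrow> carrier R \<Longrightarrow> eval_monom R g s m \<in> carrier R"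
  unfolding eval_monom_def by (intro finprod_closed) auto

lemma eval_monom_add:
  assumes "g \<in> {..<s} \<rightarrow> carrier R"
  shows "eval_monom R g s (m + m') = eval_monom R g s m \<otimes> eval_monom R g s m'"
proof -
  have gc: "g i \<in> carrier R" if "i < s" for i using assms that by auto
  have "eval_monom R g s (m + m')
      = (\<Otimes>i\<in>{..<s}. g i [^] Poly_Mapping.lookup m i \<otimes> g i [^] Poly_Mapping.lookup m' i)"
    unfolding eval_monom_def using gc by (intro finprod_cong') (auto simp: lookup_add nat_pow_mult)
  also have "\<dots> = eval_monom R g s m \<otimes> eval_monom R g s m'"
    unfolding eval_monom_def using gc by (intro finprod_multf) auto
  finally show ?thesis .
qed

lemma eval_monom_0: "eval_monom R g s 0 = \<one>"
  by (simp add: eval_monom_def finprod_one_eqI)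

lemma eval_monom_single:
  assumes "g \<in> {..<s} \<rightarrow> carrier R" "i < s"
  shows "eval_monom R g s (Poly_Mapping.single i 1) = g i"
proof -
  have gc: "g i \<in> carrier R" if "i < s" for i using assms that by auto
  have "eval_monom R g s (Poly_Mapping.single i 1) = (\<Otimes>k\<in>{..<s}. if i = k then g k else \<one>)"
    unfolding eval_monom_def using gc by (intro finprod_cong') (auto simp: lookup_single when_def)
  also have "\<dots> = g i" using finprod_singleton[of i "{..<s}" g] assms by auto
  finally show ?thesis .
qed

lemma eval_monom_power:
  assumes I: "ideal I R" and g: "g \<in> {..<s} \<rightarrow> I" and m: "Poly_Mapping.keys m \<subseteq> {..<s}"
  shows "eval_monom R g s m \<in> ideal_power R I (mdeg m)"
proof -
  have gc: "g i \<in> carrier R" if "i < s" for i using ideal_simps(8)[OF I] g that by auto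
  have pw: "g i [^] k \<in> ideal_power R I k" if "i < s" for i and k :: nat
  proof (induction k)
    case (Suc k)
    then show ?case using ideal_prod.prod[OF Suc, of "g i" I R] g that by auto
  qed auto
  have "(\<Otimes>i\<in>{..<l}. g i [^] Poly_Mapping.lookup m i) \<in> ideal_power R I (\<Sum>i<l. Poly_Mapping.lookup m i)"
    if "l \<le> s" for l
    using that
  proof (induction l)
    case (Suc l)
    have "(\<Otimes>i\<in>{..<Suc l}. g i [^] Poly_Mapping.lookup m i)
        = g l [^] Poly_Mapping.lookup m l \<otimes> (\<Otimes>i\<in>{..<l}. g i [^] Poly_Mapping.lookup m i)"
      unfolding lessThan_Suc using gc Suc.prems by (intro finprod_insert) auto
    also have "\<dots> \<in> ideal_power R I (Poly_Mapping.lookup m l + (\<Sum>i<l. Poly_Mapping.lookup m i))"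
      using Suc by (intro ideal_power_mult[OF I] pw) auto
    finally show ?case by (simp add: add.commute)
  qed auto
  then show ?thesis using mdeg_altdef[OF m] by (simp add: eval_monom_def)
qed

lemma ideal_power_subset_span:
  assumes I: "I = Idl (g ` {..<s})" and g: "g \<in> {..<s} \<rightarrow> carrier R" and j: "j < n"
    and x: "x \<in> ideal_power R I k"
  shows "(\<lambda>U. if U = e j then x else \<zero>) \<in>
    mspan R (eval_monom R g s) e ({m. Poly_Mapping.keys m \<subseteq> {..<s} \<and> mdeg m = k} \<times> {..<n})"
proof -
  define mn where "mn = eval_monom R g s"
  define D where "D k = {m. Poly_Mapping.keys m \<subseteq> {..<s} \<and> mdeg m = k} \<times> {..<n}" for k
  have mn: "mn m \<in> carrier R" "mn (m + m') = mn m \<otimes> mn m'" for m m'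
    using eval_monom_closed[OF g] eval_monom_add[OF g] by (auto simp: mn_def)
  have sub: "g ` {..<s} \<subseteq> carrier R" using g by auto
  define S where "S k = {x \<in> carrier R. (\<lambda>U. if U = e j then x else \<zero>) \<in> mspan R mn e (D k)}" for k
  have S: "ideal (S k) R" for k
  proof (rule idealI')
    show "\<zero> \<in> S k" using mspan.zero[of R mn e "D k"] by (simp add: S_def)
  next
    fix x y assume "x \<in> S k" "y \<in> S k"
    then have x: "x \<in> carrier R" "y \<in> carrier R"
      "(\<lambda>U. if U = e j then x else \<zero>) \<in> mspan R mn e (D k)" "(\<lambda>U. if U = e j then y else \<zero>) \<in> mspan R mn e (D k)"
      by (auto simp: S_def)
    have "(\<lambda>U. (if U = e j then x else \<zero>) \<oplus> (if U = e j then y else \<zero>)) = (\<lambda>U. if U = e j then x \<oplus> y else \<zero>)"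
      by auto
    then show "x \<oplus> y \<in> S k" using mspan_add[OF mn(1) x(3,4)] x by (simp add: S_def)
  next
    fix r x assume r: "r \<in> carrier R" and "x \<in> S k"
    then have x: "x \<in> carrier R" "(\<lambda>U. if U = e j then x else \<zero>) \<in> mspan R mn e (D k)"
      by (auto simp: S_def)
    have "(\<lambda>U. r \<otimes> (if U = e j then x else \<zero>)) = (\<lambda>U. if U = e j then r \<otimes> x else \<zero>)" using r by auto
    then show "r \<otimes> x \<in> S k" using mspan_smult[OF mn(1) x(2) r] x r by (simp add: S_def)
  qed (auto simp: S_def)
  have I': "ideal I R" unfolding I by (rule genideal_ideal[OF sub])
  have "ideal_power R I k \<subseteq> S k"
  proof (induction k)
    case 0
    have "(0, j) \<in> D 0" using j by (auto simp: D_def)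
    then have "(\<lambda>U. \<zero> \<oplus> (if U = e j then c \<otimes> mn 0 else \<zero>)) \<in> mspan R mn e (D 0)" if "c \<in> carrier R" for c
      using mspan.add[OF mspan.zero] that by fastforce
    moreover have "(\<lambda>U. \<zero> \<oplus> (if U = e j then c \<otimes> mn 0 else \<zero>)) = (\<lambda>U. if U = e j then c else \<zero>)"
      if "c \<in> carrier R" for c using that eval_monom_0[of g s] by (auto simp: mn_def)
    ultimately show ?case by (auto simp: S_def)
  next
    case (Suc k)
    have "ideal_prod R (ideal_power R I k) I \<subseteq> S (Suc k)"
    proof (rule ideal_prod_minimal[OF S])
      fix x y assume x: "x \<in> ideal_power R I k" and y: "y \<in> I"
      have xS: "x \<in> carrier R" "(\<lambda>U. if U = e j then x else \<zero>) \<in> mspan R mn e (D k)"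
        using x Suc by (auto simp: S_def)
      have "I \<subseteq> {y \<in> carrier R. x \<otimes> y \<in> S (Suc k)}"
        unfolding I
      proof (rule genideal_minimal[OF ideal_colon[OF S xS(1)]], safe)
        fix i assume i: "i < s"
        show gi: "g i \<in> carrier R" using g i by auto
        have gm: "mn (Poly_Mapping.single i 1) = g i" using eval_monom_single[OF g i] by (simp add: mn_def)
        have "(\<lambda>U. g i \<otimes> (if U = e j then x else \<zero>)) \<in> mspan R mn e (D (Suc k))"
          unfolding gm[symmetric]
          by (rule mspan_shift[OF mn xS(2)]) (use i in \<open>auto simp: D_def mdeg_add keys_plus_nat\<close>)
        moreover have "(\<lambda>U. g i \<otimes> (if U = e j then x else \<zero>)) = (\<lambda>U. if U = e j then x \<otimes> g i else \<zero>)"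
          using xS(1) gi by (auto simp: m_comm)
        ultimately show "x \<otimes> g i \<in> S (Suc k)" using xS(1) gi by (simp add: S_def)
      qed
      then show "x \<otimes> y \<in> S (Suc k)" using y by auto
    qed
    then show ?case by simp
  qed
  then show ?thesis using x by (auto simp: S_def mn_def D_def)
qed

lemma kos_in_span:
  assumes I: "I = Idl (g ` {..<s})" and g: "g \<in> {..<s} \<rightarrow> carrier R"
    and e: "bij_betw e {..<n} (Pow T)"
    and a: "a \<in> kos R T" "\<And>U. a U \<in> ideal_power R I k"
  shows "a \<in> mspan R (eval_monom R g s) e ({m. Poly_Mapping.keys m \<subseteq> {..<s} \<and> mdeg m = k} \<times> {..<n})"
proof -
  define M where "M = mspan R (eval_monom R g s) e ({m. Poly_Mapping.keys m \<subseteq> {..<s} \<and> mdeg m = k} \<times> {..<n})"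
  have ac: "a U \<in> carrier R" for U using a by (simp add: kos_def)
  have "(\<lambda>U. if U \<in> e ` {..<l} then a U else \<zero>) \<in> M" if "l \<le> n" for l
    using that
  proof (induction l)
    case 0
    then show ?case unfolding M_def by (simp add: mspan.zero)
  next
    case (Suc l)
    have inj: "e l \<notin> e ` {..<l}" 
    proof
      assume "e l \<in> e ` {..<l}"
      then obtain l' where "l' < l" "e l = e l'" by auto
      then show False using inj_onD[OF bij_betw_imp_inj_on[OF e], of l l'] Suc.prems by auto
    qed
    have "(\<lambda>U. if U = e l then a (e l) else \<zero>) \<in> M"
      unfolding M_def using Suc.prems by (intro ideal_power_subset_span[OF I g _ a(2)]) auto
    then have "(\<lambda>U. (if U \<in> e ` {..<l} then a U else \<zero>) \<oplus> (if U = e l then a (e l) else \<zero>)) \<in> M"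
      using Suc unfolding M_def by (intro mspan_add eval_monom_closed[OF g]) auto
    moreover have "(\<lambda>U. (if U \<in> e ` {..<l} then a U else \<zero>) \<oplus> (if U = e l then a (e l) else \<zero>))
      = (\<lambda>U. if U \<in> e ` {..<Suc l} then a U else \<zero>)"
      using ac inj by (auto simp: lessThan_Suc)
    ultimately show ?case by simp
  qed
  from this[of n] have "(\<lambda>U. if U \<in> Pow T then a U else \<zero>) \<in> M" using e by (simp add: bij_betw_def)
  moreover have "(\<lambda>U. if U \<in> Pow T then a U else \<zero>) = a" using kosD(2)[OF a(1)] by auto
  ultimately show ?thesis by (simp add: M_def)
qed

lemma acyclic_mod_mono:
  "acyclic_mod R f T t P Q \<Longrightarrow> P' \<subseteq> P \<Longrightarrow> Q \<subseteq> Q' \<Longrightarrow> t \<le> t' \<Longrightarrow> acyclic_mod R f T t' P' Q'"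
  unfolding acyclic_mod_def by (meson le_less_trans subset_iff)

lemma acyclic_mod_cong:
  assumes "\<And>j. j \<in> T \<Longrightarrow> f j = g j" "f \<in> T \<rightarrow> carrier R"
  shows "acyclic_mod R f T t P Q = acyclic_mod R g T t P Q"
proof -
  have "kos_diff R f T a = kos_diff R g T a" if "a \<in> kos R T" for a
    unfolding kos_diff_def using assms kosD(1)[OF that] 
    by (intro ext) (auto intro!: finsum_cong' simp: Pi_iff)
  then show ?thesis unfolding acyclic_mod_def using kos_degD(1) by (metis (no_types, lifting))
qed

end

lemma (in noetherian_cring) acyclic_mod_powers:
  assumes I: "ideal I R" and T: "finite T" and f: "f \<in> T \<rightarrow> carrier R"
    and ac: "acyclic_mod R f T 0 {\<zero>} {\<zero>}"
  shows "\<exists>r. \<forall>k. acyclic_mod R f T 0 (ideal_power R I k) (ideal_power R I (k - r))"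
proof -
  obtain A where A: "A \<subseteq> carrier R" "finite A" "I = Idl A" using finetely_gen[OF I] by blast
  obtain g s where gs: "A = g ` {i::nat. i < s}" using finite_imp_nat_seg_image_inj_on[OF A(2)] by blast
  have g: "g \<in> {..<s} \<rightarrow> carrier R" using A(1) gs by auto
  have Ig: "I = Idl (g ` {..<s})" using A(3) gs by (simp add: lessThan_def)
  have gI: "g \<in> {..<s} \<rightarrow> I" using genideal_self[OF A(1)] A(3) gs by auto
  obtain e where e: "bij_betw e {..<card (Pow T)} (Pow T)"
    using ex_bij_betw_nat_finite[of "Pow T"] T by (auto simp: lessThan_atLeast0)
  define n where "n = card (Pow T)"
  define D where "D k = {m. Poly_Mapping.keys m \<subseteq> {..<s} \<and> mdeg m = k} \<times> {..<n}" for k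
  define mn where "mn = eval_monom R g s"
  have mn: "mn m \<in> carrier R" "mn (m + m') = mn m \<otimes> mn m'" for m m'
    using eval_monom_closed[OF g] eval_monom_add[OF g] by (auto simp: mn_def)
  define N where "N i = kos_diff R f T ` kos_deg R T i" for i
  have dsum: "kos_diff R f T (\<lambda>U. a U \<oplus> b U) = (\<lambda>U. kos_diff R f T a U \<oplus> kos_diff R f T b U)"
    if "a \<in> kos_deg R T i" "b \<in> kos_deg R T i" for a b i
    using kos_diff_add[OF kos_degD(1)[OF that(1)] kos_degD(1)[OF that(2)] f] by auto
  have dsmult: "kos_diff R f T (\<lambda>U. c \<otimes> a U) = (\<lambda>U. c \<otimes> kos_diff R f T a U)"
    if "a \<in> kos_deg R T i" "c \<in> carrier R" for a c i
    using kos_diff_smult[OF kos_degD(1)[OF that(1)] that(2) f T] by auto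
  have dzero: "kos_diff R f T (\<lambda>U. \<zero>) = (\<lambda>U. \<zero>)" using kos_diff_zero[OF f] by auto
  have N: "(\<lambda>U. \<zero>) \<in> N i" "\<And>g h. g \<in> N i \<Longrightarrow> h \<in> N i \<Longrightarrow> (\<lambda>U. g U \<oplus> h U) \<in> N i"
      "\<And>r g. r \<in> carrier R \<Longrightarrow> g \<in> N i \<Longrightarrow> (\<lambda>U. r \<otimes> g U) \<in> N i" for i
  proof -
    show "(\<lambda>U. \<zero>) \<in> N i" unfolding N_def using dzero kos_deg_zero by (metis imageI)
    show "(\<lambda>U. g U \<oplus> h U) \<in> N i" if gh: "g \<in> N i" "h \<in> N i" for g h
    proof -
      obtain a b where ab: "a \<in> kos_deg R T i" "b \<in> kos_deg R T i" "g = kos_diff R f T a" "h = kos_diff R f T b"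
        using gh by (auto simp: N_def)
      show ?thesis unfolding ab(3,4) dsum[OF ab(1,2), symmetric] N_def
        using kos_deg_closed(1)[OF ab(1,2)] by auto
    qed
    show "(\<lambda>U. r \<otimes> g U) \<in> N i" if rg: "r \<in> carrier R" "g \<in> N i" for r g
    proof -
      obtain a where a: "a \<in> kos_deg R T i" "g = kos_diff R f T a" using rg(2) by (auto simp: N_def)
      show ?thesis unfolding a(2) dsmult[OF a(1) rg(1), symmetric] N_def
        using kos_deg_closed(4)[OF a(1,1) rg(1)] by auto
    qed
  qed
  define AR where "AR i r \<longleftrightarrow> (\<forall>k Q. (\<lambda>U. \<zero>) \<in> Q \<longrightarrow> (\<forall>g\<in>Q. \<forall>h\<in>Q. (\<lambda>U. g U \<oplus> h U) \<in> Q) \<longrightarrow>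
     (\<forall>m g. k - r \<le> mdeg m \<longrightarrow> Poly_Mapping.keys m \<subseteq> {..<s} \<longrightarrow> g \<in> N i \<longrightarrow> (\<lambda>U. mn m \<otimes> g U) \<in> Q) \<longrightarrow>
     N i \<inter> mspan R mn e (D k) \<subseteq> Q)" for i r
  have "\<exists>r. AR i r" for i
    unfolding AR_def D_def by (rule artin_rees[OF mn N])
  then obtain r where r: "\<And>i. AR i (r i)" by metis
  define r0 where "r0 = Max (r ` {..card T})"
  have acI: "acyclic_mod R f T 0 (ideal_power R I k) (ideal_power R I (k - r0))" for k
    unfolding acyclic_mod_def
  proof (intro allI impI ballI)
    fix i a assume i: "0 < i" and a: "a \<in> kos_deg R T i" and d: "\<forall>U. kos_diff R f T a U \<in> ideal_power R I k"
    define J where "J = ideal_power R I (k - r0)"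
    have J: "ideal J R" unfolding J_def by (rule ideal_power_ideal[OF I])
    show "\<exists>u\<in>kos_deg R T (Suc i). \<forall>U. a U \<ominus> kos_diff R f T u U \<in> ideal_power R I (k - r0)"
      unfolding J_def[symmetric]
    proof (cases "i \<le> card T")
      case False
      have "a U = \<zero>" for U
      proof (cases "U \<subseteq> T")
        case True
        then have "card U \<noteq> i" using False card_mono[OF T True] by auto
        then show ?thesis by (rule kos_degD(2)[OF a])
      qed (rule kosD(2)[OF kos_degD(1)[OF a]])
      then have "a U \<ominus> kos_diff R f T (\<lambda>U. \<zero>) U \<in> J" for U
        using ideal_simps(1)[OF J] by (simp add: dzero minus_eq)
      then show "\<exists>u\<in>kos_deg R T (Suc i). \<forall>U. a U \<ominus> kos_diff R f T u U \<in> J" using kos_deg_zero by blast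
    next
      case True
      then have ri: "r i \<le> r0" by (auto simp: r0_def)
      define Q where "Q = kos_diff R f T ` {w \<in> kos_deg R T i. \<forall>U. w U \<in> J}"
      have Qmem: "kos_diff R f T w \<in> Q" if "w \<in> kos_deg R T i" "\<And>U. w U \<in> J" for w
        using that by (auto simp: Q_def)
      have "N i \<inter> mspan R mn e (D k) \<subseteq> Q"
      proof (rule r[of i, unfolded AR_def, rule_format])
        show "(\<lambda>U. \<zero>) \<in> Q" using Qmem[OF kos_deg_zero] ideal_simps(1)[OF J] by (simp add: dzero)
      next
        fix g h assume "g \<in> Q" "h \<in> Q"
        then obtain v w where vw: "v \<in> kos_deg R T i" "w \<in> kos_deg R T i" "\<And>U. v U \<in> J" "\<And>U. w U \<in> J"
          "g = kos_diff R f T v" "h = kos_diff R f T w" by (auto simp: Q_def)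
        show "(\<lambda>U. g U \<oplus> h U) \<in> Q"
          unfolding vw(5,6) dsum[OF vw(1,2), symmetric]
          using vw(3,4) kos_deg_closed(1)[OF vw(1,2)] by (intro Qmem ideal_simps(2)[OF J]) auto
      next
        fix m h assume m: "k - r i \<le> mdeg m" "Poly_Mapping.keys m \<subseteq> {..<s}" and "h \<in> N i"
        then obtain w where w: "w \<in> kos_deg R T i" "h = kos_diff R f T w" by (auto simp: N_def)
        have "mn m \<in> J"
        proof -
          have "k - r0 \<le> mdeg m" using m(1) ri by auto
          from ideal_power_antimono[OF I this] show ?thesis
            using eval_monom_power[OF I gI m(2)] unfolding J_def mn_def by blast
        qed
        then have "mn m \<otimes> w U \<in> J" for U
          using kosD(1)[OF kos_degD(1)[OF w(1)]] by (intro ideal_simps(6)[OF J])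
        then show "(\<lambda>U. mn m \<otimes> h U) \<in> Q"
          unfolding w(2) dsmult[OF w(1) mn(1), symmetric]
          using kos_deg_closed(4)[OF w(1,1) mn(1)] by (intro Qmem)
      qed
      moreover have "kos_diff R f T a \<in> N i" using a by (auto simp: N_def)
      moreover have "kos_diff R f T a \<in> mspan R mn e (D k)"
        unfolding mn_def D_def n_def
        using kos_in_span[OF Ig g e kos_diff_kos[OF kos_degD(1)[OF a] f]] d by blast
      ultimately have "kos_diff R f T a \<in> Q" by blast
      then obtain w where w: "w \<in> kos_deg R T i" "\<And>U. w U \<in> J" "kos_diff R f T a = kos_diff R f T w"
        by (auto simp: Q_def)
      have aw: "(\<lambda>U. a U \<ominus> w U) \<in> kos_deg R T i" using kos_deg_closed(3)[OF a w(1)] by auto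
      have "kos_diff R f T (\<lambda>U. a U \<ominus> w U) U = \<zero>" for U
        using kos_diff_minus[OF kos_degD(1)[OF a] kos_degD(1)[OF w(1)] f T] w(3)
          kosD(1)[OF kos_diff_kos[OF kos_degD(1)[OF w(1)] f]] by (simp add: minus_eq r_neg)
      then obtain u where u: "u \<in> kos_deg R T (Suc i)" "\<And>U. (a U \<ominus> w U) \<ominus> kos_diff R f T u U = \<zero>"
        using ac aw i unfolding acyclic_mod_def by blast
      have "a U \<ominus> kos_diff R f T u U \<in> J" for U
      proof -
        have c: "a U \<in> carrier R" "w U \<in> carrier R" "kos_diff R f T u U \<in> carrier R"
          using a w(1) kos_diff_kos[OF kos_degD(1)[OF u(1)] f] by (auto simp: kos_deg_def kos_def)
        have "a U \<ominus> kos_diff R f T u U = ((a U \<ominus> w U) \<ominus> kos_diff R f T u U) \<oplus> w U"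
          using c by algebra
        then show ?thesis using u(2) w(2) c by simp
      qed
      then show "\<exists>u\<in>kos_deg R T (Suc i). \<forall>U. a U \<ominus> kos_diff R f T u U \<in> J" using u(1) by blast
    qed
  qed
  then show ?thesis by blast
qed

section \<open>Polynomial rings\<close>

definition lead_monom :: "((nat \<Rightarrow>\<^sub>0 nat) \<Rightarrow>\<^sub>0 'k::zero) \<Rightarrow> (nat \<Rightarrow>\<^sub>0 nat)" where
  "lead_monom p = Max (Poly_Mapping.keys p)"

lemma lookup_single_mult:
  fixes g :: "(nat \<Rightarrow>\<^sub>0 nat) \<Rightarrow>\<^sub>0 'k::field"
  shows "Poly_Mapping.lookup (Poly_Mapping.single m c * g) (m + a) = c * Poly_Mapping.lookup g a"
  by (simp add: lookup_mult lookup_single when_mult)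

lemma keys_single_mult:
  "Poly_Mapping.keys (Poly_Mapping.single m c * g) \<subseteq> (+) m ` Poly_Mapping.keys (g :: (nat \<Rightarrow>\<^sub>0 nat) \<Rightarrow>\<^sub>0 'k::field)"
  using keys_mult[of "Poly_Mapping.single m c" g] by (auto split: if_splits)

lemma poly_mapping_sum_single:
  "p = (\<Sum>m\<in>Poly_Mapping.keys p. Poly_Mapping.single m (Poly_Mapping.lookup p m))"
  by (rule poly_mapping_eqI) (simp add: lookup_sum lookup_single when_def in_keys_iff)

definition poly_var :: "nat \<Rightarrow> ((nat \<Rightarrow>\<^sub>0 nat) \<Rightarrow>\<^sub>0 'k::field)" where
  "poly_var i = Poly_Mapping.single (Poly_Mapping.single i 1) 1"

locale polynomials =
  fixes n :: nat and P :: "((nat \<Rightarrow>\<^sub>0 nat) \<Rightarrow>\<^sub>0 'k::field) ring"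
  defines "P \<equiv> polynomial_ring n"
begin

lemma P_simps [simp]: "monoid.mult P = (*)" "one P = 1" "ring.zero P = 0" "add P = (+)"
  by (simp_all add: P_def polynomial_ring_def)

lemma P_carrier: "p \<in> carrier P \<longleftrightarrow> (\<forall>m\<in>Poly_Mapping.keys p. Poly_Mapping.keys m \<subseteq> {..<n})"
  by (simp add: P_def polynomial_ring_def)

lemma P_closed:
  "p \<in> carrier P \<Longrightarrow> q \<in> carrier P \<Longrightarrow> p + q \<in> carrier P"
  "p \<in> carrier P \<Longrightarrow> q \<in> carrier P \<Longrightarrow> p * q \<in> carrier P"
  "p \<in> carrier P \<Longrightarrow> - p \<in> carrier P"
  "p \<in> carrier P \<Longrightarrow> q \<in> carrier P \<Longrightarrow> p - q \<in> carrier P"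
  "0 \<in> carrier P" "1 \<in> carrier P"
  "Poly_Mapping.keys m \<subseteq> {..<n} \<Longrightarrow> Poly_Mapping.single m c \<in> carrier P"
proof -
  show "p \<in> carrier P \<Longrightarrow> q \<in> carrier P \<Longrightarrow> p + q \<in> carrier P"
    using Poly_Mapping.keys_add[of p q] by (auto simp: P_carrier)
  show "p * q \<in> carrier P" if "p \<in> carrier P" "q \<in> carrier P"
    unfolding P_carrier
  proof
    fix m assume "m \<in> Poly_Mapping.keys (p * q)"
    then obtain a b where "m = a + b" "a \<in> Poly_Mapping.keys p" "b \<in> Poly_Mapping.keys q"
      using keys_mult[of p q] by blast
    then show "Poly_Mapping.keys m \<subseteq> {..<n}" using that by (simp add: P_carrier keys_plus_nat)
  qed
  show m: "p \<in> carrier P \<Longrightarrow> - p \<in> carrier P" for p by (auto simp: P_carrier in_keys_iff)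
  show "p \<in> carrier P \<Longrightarrow> q \<in> carrier P \<Longrightarrow> p - q \<in> carrier P"
  proof -
    have "Poly_Mapping.keys (p - q) \<subseteq> Poly_Mapping.keys p \<union> Poly_Mapping.keys q"
      by (auto simp: in_keys_iff lookup_minus)
    then show "p \<in> carrier P \<Longrightarrow> q \<in> carrier P \<Longrightarrow> p - q \<in> carrier P" unfolding P_carrier by blast
  qed
  show "0 \<in> carrier P" "1 \<in> carrier P" by (auto simp: P_carrier)
  show "Poly_Mapping.keys m \<subseteq> {..<n} \<Longrightarrow> Poly_Mapping.single m c \<in> carrier P" by (auto simp: P_carrier)
qed

sublocale cring P
proof (rule cringI)
  show "abelian_group P"
    by (rule abelian_groupI) (auto simp: P_closed algebra_simps intro!: bexI[of _ "- _"])
  show "comm_monoid P"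
    by (rule comm_monoidI) (auto simp: P_closed algebra_simps)
qed (auto simp: P_closed algebra_simps)

lemma P_uminus: "p \<in> carrier P \<Longrightarrow> \<ominus>\<^bsub>P\<^esub> p = - p"
  using minus_equality[of "- p" p] P_closed(3) by simp

lemma P_minus: "p \<in> carrier P \<Longrightarrow> q \<in> carrier P \<Longrightarrow> p \<ominus>\<^bsub>P\<^esub> q = p - q"
  by (simp add: a_minus_def P_uminus)

lemma P_ideal:
  assumes "ideal J P"
  shows "0 \<in> J" "p \<in> J \<Longrightarrow> q \<in> J \<Longrightarrow> p + q \<in> J" "p \<in> J \<Longrightarrow> q \<in> J \<Longrightarrow> p - q \<in> J"
    "r \<in> carrier P \<Longrightarrow> p \<in> J \<Longrightarrow> r * p \<in> J" "p \<in> J \<Longrightarrow> p \<in> carrier P"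
  using ideal_simps[OF assms] P_minus by auto

lemma P_idealI:
  assumes "J \<subseteq> carrier P" "0 \<in> J" "\<And>p q. p \<in> J \<Longrightarrow> q \<in> J \<Longrightarrow> p + q \<in> J"
    "\<And>r p. r \<in> carrier P \<Longrightarrow> p \<in> J \<Longrightarrow> r * p \<in> J"
  shows "ideal J P"
  by (rule idealI') (use assms in auto)

lemma P_ideal_sum: "ideal J P \<Longrightarrow> (\<And>i. i \<in> A \<Longrightarrow> p i \<in> J) \<Longrightarrow> sum p A \<in> J"
  by (induction A rule: infinite_finite_induct) (auto simp: P_ideal)

lemma wf_monom: "wf {(a, b :: nat \<Rightarrow>\<^sub>0 nat). a < b \<and> Poly_Mapping.keys a \<subseteq> {..<n} \<and> Poly_Mapping.keys b \<subseteq> {..<n}}"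
  unfolding wf_iff_no_infinite_down_chain
proof
  assume "\<exists>f. \<forall>i. (f (Suc i), f i) \<in>
    {(a, b :: nat \<Rightarrow>\<^sub>0 nat). a < b \<and> Poly_Mapping.keys a \<subseteq> {..<n} \<and> Poly_Mapping.keys b \<subseteq> {..<n}}"
  then obtain f :: "nat \<Rightarrow> (nat \<Rightarrow>\<^sub>0 nat)" where f: "\<And>i. f (Suc i) < f i" "\<And>i. Poly_Mapping.keys (f i) \<subseteq> {..<n}"
    by blast
  obtain g :: "nat \<Rightarrow> nat" where g: "strict_mono g"
    "\<forall>k l. k \<le> l \<longrightarrow> (\<exists>m. f (g l) = f (g k) + m \<and> Poly_Mapping.keys m \<subseteq> {..<n})"
    using dickson[of f n] f(2) by auto
  then obtain m where m: "f (g 1) = f (g 0) + m" by (meson zero_le)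
  have "g 0 < g 1" using g(1) by (auto simp: strict_mono_def)
  then have "f (g 1) < f (g 0)" by (induction rule: less_Suc_induct) (auto intro: f(1) less_trans)
  moreover have "\<not> m < 0"
    by (simp add: less_poly_mapping.rep_eq less_fun_def)
  ultimately show False using m add_left_mono[of 0 m "f (g 0)"] by (auto simp: not_less)
qed

lemma P_noetherian: "noetherian_ring P"
proof (rule noetherian_ringI)
  fix J assume J: "ideal J P"
  note Js = P_ideal[OF J]
  define M where "M = lead_monom ` (J - {0})"
  have lm: "lead_monom p \<in> Poly_Mapping.keys p" "\<And>m. m \<in> Poly_Mapping.keys p \<Longrightarrow> m \<le> lead_monom p"
    if "p \<noteq> 0" for p :: "(nat \<Rightarrow>\<^sub>0 nat) \<Rightarrow>\<^sub>0 'k"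
    using that Max_in[of "Poly_Mapping.keys p"] by (auto simp: lead_monom_def keys_eq_empty)
  have lmJ: "Poly_Mapping.keys (lead_monom p) \<subseteq> {..<n}" if "p \<in> J" "p \<noteq> 0" for p
    using lm(1)[OF that(2)] Js(5)[OF that(1)] by (auto simp: P_carrier)
  have "\<exists>d. \<forall>m\<in>M. \<exists>m0\<in>M. \<exists>m1. m = m0 + m1 \<and> mdeg m0 \<le> d"
  proof (rule ccontr)
    assume "\<not> ?thesis"
    then have "\<forall>d. \<exists>m\<in>M. \<forall>m0\<in>M. \<forall>m1. m = m0 + m1 \<longrightarrow> \<not> mdeg m0 \<le> d" by blast
    then obtain x where x: "\<And>d. x d \<in> M" "\<And>d m0 m1. m0 \<in> M \<Longrightarrow> x d = m0 + m1 \<Longrightarrow> \<not> mdeg m0 \<le> d"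
      by metis
    have "Poly_Mapping.keys (x d) \<subseteq> {..<n}" for d
    proof -
      obtain p where "p \<in> J" "p \<noteq> 0" "x d = lead_monom p" using x(1)[of d] by (auto simp: M_def)
      then show ?thesis using lmJ by simp
    qed
    then obtain g :: "nat \<Rightarrow> nat" where g: "strict_mono g"
      "\<forall>k l. k \<le> l \<longrightarrow> (\<exists>m. x (g l) = x (g k) + m \<and> Poly_Mapping.keys m \<subseteq> {..<n})"
      using dickson[of x n] by auto
    define l where "l = mdeg (x (g 0))"
    obtain m where "x (g l) = x (g 0) + m" using g(2) by (meson zero_le)
    moreover have "l \<le> g l" by (rule strict_mono_imp_increasing[OF g(1)])
    ultimately show False using x(2)[of "x (g 0)" "g l" m] x(1) by (simp add: l_def)
  qed
  then obtain d where d: "\<And>m. m \<in> M \<Longrightarrow> \<exists>m0\<in>M. \<exists>m1. m = m0 + m1 \<and> mdeg m0 \<le> d" by blast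
  define F where "F = {m \<in> M. mdeg m \<le> d}"
  have "F \<subseteq> (\<Union>k\<le>d. {m. Poly_Mapping.keys m \<subseteq> {..<n} \<and> mdeg m = k})"
    using lmJ unfolding F_def M_def by blast
  then have F: "finite F" by (rule finite_subset) (auto intro: finite_mdeg)
  have "\<forall>m\<in>F. \<exists>p. p \<in> J \<and> p \<noteq> 0 \<and> lead_monom p = m" by (auto simp: F_def M_def)
  then obtain G where G: "\<And>m. m \<in> F \<Longrightarrow> G m \<in> J \<and> G m \<noteq> 0 \<and> lead_monom (G m) = m" by metis
  have GJ: "G ` F \<subseteq> J" using G by auto
  then have Gc: "G ` F \<subseteq> carrier P" using Js(5) by auto
  note I = genideal_ideal[OF Gc] and GI = genideal_self[OF Gc]
  have "p \<in> Idl\<^bsub>P\<^esub> (G ` F)" if "p \<in> J" for p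
  proof (cases "p = 0")
    case False
    have "\<forall>p. p \<in> J \<longrightarrow> p \<noteq> 0 \<longrightarrow> lead_monom p = m \<longrightarrow> p \<in> Idl\<^bsub>P\<^esub> (G ` F)" for m
    proof (induction m rule: wf_induct_rule[OF wf_monom])
      case (1 m)
      show ?case
      proof (intro allI impI)
        fix p assume p: "p \<in> J" "p \<noteq> 0" "lead_monom p = m"
        then have "m \<in> M" by (auto simp: M_def)
        then obtain m0 m1 where m: "m0 \<in> F" "m = m0 + m1" using d[of m] unfolding F_def by blast
        have m1: "Poly_Mapping.keys m1 \<subseteq> {..<n}" using lmJ[OF p(1,2)] p(3) m(2) by (simp add: keys_plus_nat)
        define g where "g = G m0"
        have g: "g \<in> J" "g \<noteq> 0" "lead_monom g = m0" "g \<in> Idl\<^bsub>P\<^esub> (G ` F)"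
          using G[OF m(1)] GI m(1) by (auto simp: g_def)
        define c where "c = Poly_Mapping.lookup p m / Poly_Mapping.lookup g m0"
        define t where "t = Poly_Mapping.single m1 c * g"
        have s: "Poly_Mapping.single m1 c \<in> carrier P" by (rule P_closed(7)[OF m1])
        have t: "t \<in> J" "t \<in> Idl\<^bsub>P\<^esub> (G ` F)" using P_ideal(4)[OF _ s] J I g by (auto simp: t_def)
        have q: "p - t \<in> J" using Js(3) p t by auto
        have g0: "Poly_Mapping.lookup g m0 \<noteq> 0" using lm(1)[OF g(2)] g(3) by (simp add: in_keys_iff)
        have tm: "Poly_Mapping.lookup t m = Poly_Mapping.lookup p m"
          unfolding t_def m(2) using lookup_single_mult[of m1 c g m0] g0 by (simp add: c_def m(2) add.commute)
        have tle: "a \<le> m" if a: "a \<in> Poly_Mapping.keys t" for a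
        proof -
          obtain b where "b \<in> Poly_Mapping.keys g" "a = m1 + b"
            using keys_single_mult[of m1 c g] a by (auto simp: t_def)
          then show ?thesis using lm(2)[OF g(2)] g(3) m(2) by (auto simp: add.commute add_left_mono)
        qed
        have "p - t \<in> Idl\<^bsub>P\<^esub> (G ` F)"
        proof (cases "p - t = 0")
          case False
          define b where "b = lead_monom (p - t)"
          have b: "b \<in> Poly_Mapping.keys (p - t)" using lm(1)[OF False] by (simp add: b_def)
          then have "b \<noteq> m" using tm by (auto simp: in_keys_iff lookup_minus)
          moreover have "b \<in> Poly_Mapping.keys p \<union> Poly_Mapping.keys t"
            using b by (auto simp: in_keys_iff lookup_minus)
          then have "b \<le> m" using tle lm(2)[OF p(2)] p(3) by auto
          ultimately have "b < m" by simp
          then show ?thesis using 1[of b] q False lmJ[OF q False] lmJ[OF p(1,2)] p(3) by (simp add: b_def)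
        qed (use P_ideal(1)[OF I] in simp)
        then have "(p - t) + t \<in> Idl\<^bsub>P\<^esub> (G ` F)" using P_ideal(2)[OF I] t by blast
        then show "p \<in> Idl\<^bsub>P\<^esub> (G ` F)" by simp
      qed
    qed
    then show ?thesis using that False by blast
  qed (use P_ideal(1)[OF I] in simp)
  then have "J = Idl\<^bsub>P\<^esub> (G ` F)" using genideal_minimal[OF J GJ] by auto
  then show "\<exists>A\<subseteq>carrier P. finite A \<and> J = Idl\<^bsub>P\<^esub> A" using Gc F by (intro exI[of _ "G ` F"]) auto
qed

sublocale noetherian_cring P
  using P_noetherian cring_axioms by (intro noetherian_cring.intro)

lemma poly_var_closed: "i < n \<Longrightarrow> poly_var i \<in> carrier P"
  by (auto simp: poly_var_def intro!: P_closed)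

lemma Idl_vars:
  assumes "A \<subseteq> {..<n}"
  shows "Idl\<^bsub>P\<^esub> (poly_var ` A) = {p \<in> carrier P. \<forall>m\<in>Poly_Mapping.keys p. Poly_Mapping.keys m \<inter> A \<noteq> {}}"
    (is "_ = ?V")
proof
  have sub: "poly_var ` A \<subseteq> carrier P" using assms poly_var_closed by auto
  note I = genideal_ideal[OF sub]
  have V: "ideal ?V P"
  proof (rule P_idealI)
    show "0 \<in> ?V" by (simp add: P_closed)
    fix p q assume "p \<in> ?V" "q \<in> ?V"
    then show "p + q \<in> ?V" using Poly_Mapping.keys_add[of p q] P_closed(1) by blast
  next
    fix r p assume r: "r \<in> carrier P" "p \<in> ?V"
    have "Poly_Mapping.keys m \<inter> A \<noteq> {}" if m: "m \<in> Poly_Mapping.keys (r * p)" for m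
    proof -
      obtain a b where "m = a + b" "b \<in> Poly_Mapping.keys p" using keys_mult[of r p] m by blast
      then show ?thesis using r(2) by (auto simp: keys_plus_nat)
    qed
    then show "r * p \<in> ?V" using r P_closed(2) by auto
  qed auto
  show "Idl\<^bsub>P\<^esub> (poly_var ` A) \<subseteq> ?V"
  proof (rule genideal_minimal[OF V])
    show "poly_var ` A \<subseteq> ?V" using sub by (auto simp: poly_var_def)
  qed
  show "?V \<subseteq> Idl\<^bsub>P\<^esub> (poly_var ` A)"
  proof
    fix p assume p: "p \<in> ?V"
    have "Poly_Mapping.single m (Poly_Mapping.lookup p m) \<in> Idl\<^bsub>P\<^esub> (poly_var ` A)"
      if m: "m \<in> Poly_Mapping.keys p" for m
    proof -
      obtain i where i: "i \<in> A" "i \<in> Poly_Mapping.keys m" using p m by blast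
      define m' where "m' = m - Poly_Mapping.single i 1"
      have mm: "m = Poly_Mapping.single i 1 + m'"
        unfolding m'_def using i(2) by (intro le_imp_add) (auto simp: lookup_single when_def in_keys_iff)
      have "Poly_Mapping.keys m \<subseteq> {..<n}" using p m by (simp add: P_carrier)
      then have "Poly_Mapping.keys m' \<subseteq> {..<n}" by (subst (asm) mm) (simp add: keys_plus_nat)
      then have "Poly_Mapping.single m' (Poly_Mapping.lookup p m) * poly_var i \<in> Idl\<^bsub>P\<^esub> (poly_var ` A)"
        using i genideal_self[OF sub] by (intro P_ideal(4)[OF I] P_closed) auto
      also have "Poly_Mapping.single m' (Poly_Mapping.lookup p m) * poly_var i =
          Poly_Mapping.single m (Poly_Mapping.lookup p m)"
        unfolding poly_var_def mult_single by (simp add: mm[unfolded One_nat_def, symmetric] add.commute[of m'])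
      finally show ?thesis .
    qed
    then have "(\<Sum>m\<in>Poly_Mapping.keys p. Poly_Mapping.single m (Poly_Mapping.lookup p m)) \<in> Idl\<^bsub>P\<^esub> (poly_var ` A)"
      by (intro P_ideal_sum[OF I])
    then show "p \<in> Idl\<^bsub>P\<^esub> (poly_var ` A)" using poly_mapping_sum_single[of p] by simp
  qed
qed

definition M0 :: "((nat \<Rightarrow>\<^sub>0 nat) \<Rightarrow>\<^sub>0 'k) set" where
  "M0 = {p \<in> carrier P. Poly_Mapping.lookup p 0 = 0}"

lemma M0_vars: "M0 = Idl\<^bsub>P\<^esub> (poly_var ` {..<n})"
proof -
  have "Poly_Mapping.lookup p 0 = 0 \<longleftrightarrow> (\<forall>m\<in>Poly_Mapping.keys p. Poly_Mapping.keys m \<inter> {..<n} \<noteq> {})"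
    if "p \<in> carrier P" for p :: "(nat \<Rightarrow>\<^sub>0 nat) \<Rightarrow>\<^sub>0 'k"
  proof -
    have "Poly_Mapping.keys m \<inter> {..<n} \<noteq> {} \<longleftrightarrow> m \<noteq> 0" if m: "m \<in> Poly_Mapping.keys p" for m
    proof -
      have "Poly_Mapping.keys m \<inter> {..<n} = Poly_Mapping.keys m" using that \<open>p \<in> carrier P\<close> by (auto simp: P_carrier)
      moreover have "Poly_Mapping.keys m = {} \<longleftrightarrow> m = 0" by (auto simp: poly_mapping_eq_iff fun_eq_iff in_keys_iff)
      ultimately show ?thesis by simp
    qed
    then show ?thesis by (metis in_keys_iff)
  qed
  then show ?thesis unfolding Idl_vars[OF order_refl] M0_def by auto
qed

lemma M0_ideal: "ideal M0 P"
  unfolding M0_vars using poly_var_closed by (intro genideal_ideal) auto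

lemma M0_maximal: "maximalideal M0 P"
proof (rule maximalidealI[OF M0_ideal])
  have "1 \<notin> M0" by (simp add: M0_def)
  then show "carrier P \<noteq> M0" using P_closed(6) by auto
  fix J assume J: "ideal J P" "M0 \<subseteq> J" "J \<subseteq> carrier P"
  show "J = M0 \<or> J = carrier P"
  proof (cases "J \<subseteq> M0")
    case False
    then obtain p where p: "p \<in> J" "p \<notin> M0" by auto
    define c where "c = Poly_Mapping.lookup p 0"
    have pc: "p \<in> carrier P" "c \<noteq> 0" using p J(3) by (auto simp: M0_def c_def)
    have sc: "Poly_Mapping.single 0 a \<in> carrier P" for a :: 'k by (rule P_closed) simp
    have "p - Poly_Mapping.single 0 c \<in> M0" using pc sc P_closed(4) by (auto simp: M0_def lookup_minus c_def)
    then have "p - (p - Poly_Mapping.single 0 c) \<in> J" using P_ideal(3)[OF J(1) p(1)] J(2) by blast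
    then have "Poly_Mapping.single 0 (1 / c) * Poly_Mapping.single 0 c \<in> J"
      using P_ideal(4)[OF J(1) sc] by simp
    then have "1 \<in> J" using pc(2) by (simp add: mult_single)
    then show ?thesis using ideal.one_imp_carrier[OF J(1)] by simp
  qed (use J in auto)
qed

lemma vars_regular: "regular_sequence P (map poly_var [0..<n])"
  unfolding regular_sequence_def
proof (intro conjI allI impI ballI)
  show "set (map poly_var [0..<n]) \<subseteq> carrier P" using poly_var_closed by auto
  fix i b assume i: "i < length (map poly_var [0..<n] :: ((nat \<Rightarrow>\<^sub>0 nat) \<Rightarrow>\<^sub>0 'k) list)" and b: "b \<in> carrier P"
    and ib: "map poly_var [0..<n] ! i \<otimes>\<^bsub>P\<^esub> b \<in> Idl\<^bsub>P\<^esub> (set (take i (map poly_var [0..<n])))"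
  have i': "i < n" using i by simp
  have "take i (map poly_var [0..<n] :: ((nat \<Rightarrow>\<^sub>0 nat) \<Rightarrow>\<^sub>0 'k) list) = map poly_var [0..<i]"
    using i' by (simp add: take_map)
  then have st: "set (take i (map poly_var [0..<n])) = (poly_var ` {..<i} :: ((nat \<Rightarrow>\<^sub>0 nat) \<Rightarrow>\<^sub>0 'k) set)"
    by (simp add: lessThan_atLeast0)
  have A: "{..<i} \<subseteq> {..<n}" using i' by auto
  have "Poly_Mapping.keys m \<inter> {..<i} \<noteq> {}" if m: "m \<in> Poly_Mapping.keys b" for m
  proof -
    have "Poly_Mapping.lookup (poly_var i * b) (Poly_Mapping.single i 1 + m) \<noteq> 0"
      unfolding poly_var_def lookup_single_mult using m by (simp add: in_keys_iff)
    then have "Poly_Mapping.single i 1 + m \<in> Poly_Mapping.keys (poly_var i * b)" by (simp add: in_keys_iff)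
    moreover have "poly_var i * b \<in> Idl\<^bsub>P\<^esub> (poly_var ` {..<i})" using ib i' unfolding st by simp
    ultimately have "Poly_Mapping.keys (Poly_Mapping.single i 1 + m) \<inter> {..<i} \<noteq> {}"
      unfolding Idl_vars[OF A] by blast
    then show ?thesis by (auto simp: keys_plus_nat)
  qed
  then show "b \<in> Idl\<^bsub>P\<^esub> (set (take i (map poly_var [0..<n])))"
    using b unfolding st Idl_vars[OF A] by blast
qed

lemma grading_def': "polynomial_grading n d = {p \<in> carrier P. \<forall>m\<in>Poly_Mapping.keys p. mdeg m = d}"
  by (simp add: polynomial_grading_def mdeg_def P_def)

lemma graded_max_ideal_P: "graded_max_ideal P (polynomial_grading n) = M0"
proof -
  have sub: "(\<Union>i\<in>{1..}. polynomial_grading n i) \<subseteq> carrier P" by (auto simp: grading_def')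
  have "(\<Union>i\<in>{1..}. polynomial_grading n i) \<subseteq> M0"
  proof
    fix p :: "(nat \<Rightarrow>\<^sub>0 nat) \<Rightarrow>\<^sub>0 'k" assume "p \<in> (\<Union>i\<in>{1..}. polynomial_grading n i)"
    then obtain i where i: "i \<ge> 1" "p \<in> carrier P" "\<forall>m\<in>Poly_Mapping.keys p. mdeg m = i" by (auto simp: grading_def')
    then have "0 \<notin> Poly_Mapping.keys p" by force
    then show "p \<in> M0" using i by (simp add: M0_def in_keys_iff)
  qed
  then have 1: "Idl\<^bsub>P\<^esub> (\<Union>i\<in>{1..}. polynomial_grading n i) \<subseteq> M0" by (rule genideal_minimal[OF M0_ideal])
  have "poly_var ` {..<n} \<subseteq> (\<Union>i\<in>{1..}. polynomial_grading n i :: ((nat \<Rightarrow>\<^sub>0 nat) \<Rightarrow>\<^sub>0 'k) set)"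
  proof
    fix p :: "(nat \<Rightarrow>\<^sub>0 nat) \<Rightarrow>\<^sub>0 'k" assume "p \<in> poly_var ` {..<n}"
    then obtain i where "i < n" "p = poly_var i" by auto
    then have "p \<in> polynomial_grading n 1" using poly_var_closed[of i] by (auto simp: grading_def') (auto simp: poly_var_def)
    then show "p \<in> (\<Union>i\<in>{1..}. polynomial_grading n i)" by auto
  qed
  then have "M0 \<subseteq> Idl\<^bsub>P\<^esub> (\<Union>i\<in>{1..}. polynomial_grading n i)"
    unfolding M0_vars by (intro Idl_mono sub)
  then show ?thesis using 1 by (auto simp: graded_max_ideal_def)
qed

definition linear_part :: "((nat \<Rightarrow>\<^sub>0 nat) \<Rightarrow>\<^sub>0 'k) \<Rightarrow> ((nat \<Rightarrow>\<^sub>0 nat) \<Rightarrow>\<^sub>0 'k)" where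
  "linear_part p = (\<Sum>m\<in>{m \<in> Poly_Mapping.keys p. mdeg m = 1}. Poly_Mapping.single m (Poly_Mapping.lookup p m))"

lemma lookup_linear_part:
  "Poly_Mapping.lookup (linear_part p) m = (if mdeg m = 1 then Poly_Mapping.lookup p m else 0)"
  by (auto simp: linear_part_def lookup_sum lookup_single when_def in_keys_iff)

lemma linear_part_add: "linear_part (p + q) = linear_part p + linear_part q"
  by (rule poly_mapping_eqI) (simp add: lookup_linear_part lookup_add)

lemma linear_part_mult:
  assumes "p \<in> M0"
  shows "linear_part (b * p) = Poly_Mapping.single 0 (Poly_Mapping.lookup b 0) * linear_part p"
proof -
  define c where "c = Poly_Mapping.lookup b 0"
  define b' where "b' = b - Poly_Mapping.single 0 c"
  have lc: "Poly_Mapping.lookup (Poly_Mapping.single 0 c * q) m = c * Poly_Mapping.lookup q m"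
    for q :: "(nat \<Rightarrow>\<^sub>0 nat) \<Rightarrow>\<^sub>0 'k" and m
    using lookup_single_mult[of 0 c q m] by simp
  have "linear_part (b' * p) = 0"
  proof (rule poly_mapping_eqI)
    fix m
    have "m \<notin> Poly_Mapping.keys (b' * p)" if m: "mdeg m = 1"
    proof
      assume "m \<in> Poly_Mapping.keys (b' * p)"
      then obtain x y where xy: "m = x + y" "x \<in> Poly_Mapping.keys b'" "y \<in> Poly_Mapping.keys p"
        using keys_mult[of b' p] by blast
      have nz: "mdeg z \<noteq> 0" if "z \<noteq> 0" for z
        using that by (auto simp: mdeg_def poly_mapping_eq_iff fun_eq_iff in_keys_iff)
      have "x \<noteq> 0" using xy(2) by (auto simp: in_keys_iff b'_def lookup_minus c_def)
      moreover have "y \<noteq> 0" using xy(3) assms by (auto simp: in_keys_iff M0_def)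
      ultimately have "mdeg x \<noteq> 0" "mdeg y \<noteq> 0" using nz by auto
      then show False using m xy(1) by (simp add: mdeg_add)
    qed
    then show "Poly_Mapping.lookup (linear_part (b' * p)) m = Poly_Mapping.lookup 0 m"
      by (simp add: lookup_linear_part in_keys_iff)
  qed
  moreover have "b * p = Poly_Mapping.single 0 c * p + b' * p" by (simp add: b'_def algebra_simps)
  moreover have "linear_part (Poly_Mapping.single 0 c * p) = Poly_Mapping.single 0 c * linear_part p"
    by (rule poly_mapping_eqI) (simp add: lookup_linear_part lc)
  ultimately show ?thesis by (simp add: linear_part_add c_def)
qed

text \<open>It suffices to reach the variables, hence to consider linear parts.\<close>

lemma graded_nakayama:
  assumes Y: "Y \<subseteq> homogeneous_elements (polynomial_grading n)" "Y \<subseteq> M0"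
    and gen: "M0 \<subseteq> Idl\<^bsub>P\<^esub> (Y \<union> ideal_prod P M0 M0)"
  shows "Idl\<^bsub>P\<^esub> Y = M0"
proof
  have Yc: "Y \<subseteq> carrier P" using Y(2) by (auto simp: M0_def)
  note I = genideal_ideal[OF Yc]
  show "Idl\<^bsub>P\<^esub> Y \<subseteq> M0" by (rule genideal_minimal[OF M0_ideal Y(2)])
  have sc: "Poly_Mapping.single 0 a \<in> carrier P" for a :: 'k by (rule P_closed) simp
  define W where "W = {p \<in> M0. linear_part p \<in> Idl\<^bsub>P\<^esub> Y}"
  have lin0: "linear_part 0 = 0" by (simp add: linear_part_def)
  have "ideal W P"
  proof (rule P_idealI)
    show "W \<subseteq> carrier P" by (auto simp: W_def M0_def)
    show "0 \<in> W" using P_ideal(1)[OF M0_ideal] P_ideal(1)[OF I] by (simp add: W_def lin0)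
    fix p q assume "p \<in> W" "q \<in> W"
    then show "p + q \<in> W" using P_ideal(2)[OF M0_ideal] P_ideal(2)[OF I] by (simp add: W_def linear_part_add)
  next
    fix r p assume "r \<in> carrier P" "p \<in> W"
    then show "r * p \<in> W"
      using P_ideal(4)[OF M0_ideal] P_ideal(4)[OF I sc] by (simp add: W_def linear_part_mult)
  qed
  moreover have "Y \<subseteq> W"
  proof
    fix y assume y: "y \<in> Y"
    then obtain d where d: "\<forall>m\<in>Poly_Mapping.keys y. mdeg m = d"
      using Y(1) by (auto simp: homogeneous_elements_def grading_def')
    have "linear_part y = (if d = 1 then y else 0)"
      using d by (intro poly_mapping_eqI) (auto simp: lookup_linear_part in_keys_iff)
    then have "linear_part y \<in> Idl\<^bsub>P\<^esub> Y" using y genideal_self[OF Yc] P_ideal(1)[OF I] by auto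
    then show "y \<in> W" using y Y(2) by (auto simp: W_def)
  qed
  moreover have "ideal_prod P M0 M0 \<subseteq> W"
  proof (rule ideal_prod_minimal[OF \<open>ideal W P\<close>])
    fix p q assume pq: "p \<in> M0" "q \<in> M0"
    then have "linear_part (p * q) = 0" by (simp add: linear_part_mult) (simp add: M0_def)
    moreover have "p * q \<in> M0" using pq P_ideal(4)[OF M0_ideal _ pq(2)] by (auto simp: M0_def)
    ultimately show "p \<otimes>\<^bsub>P\<^esub> q \<in> W" using P_ideal(1)[OF I] by (simp add: W_def)
  qed
  ultimately have "Idl\<^bsub>P\<^esub> (Y \<union> ideal_prod P M0 M0) \<subseteq> W" by (intro genideal_minimal) auto
  then have MW: "M0 \<subseteq> W" using gen by auto
  have vM: "poly_var ` {..<n} \<subseteq> M0" unfolding M0_vars using poly_var_closed by (intro genideal_self) auto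
  show "M0 \<subseteq> Idl\<^bsub>P\<^esub> Y"
  proof (subst M0_vars, rule genideal_minimal[OF I])
    show "poly_var ` {..<n} \<subseteq> Idl\<^bsub>P\<^esub> Y"
    proof
      fix p :: "(nat \<Rightarrow>\<^sub>0 nat) \<Rightarrow>\<^sub>0 'k" assume p: "p \<in> poly_var ` {..<n}"
      then have "p \<in> W" using vM MW by blast
      moreover have "linear_part p = p"
        using p by (intro poly_mapping_eqI) (auto simp: lookup_linear_part poly_var_def lookup_single when_def)
      ultimately show "p \<in> Idl\<^bsub>P\<^esub> Y" by (simp add: W_def)
    qed
  qed
qed

end

section \<open>The Golod property\<close>

lemma (in cring) exchange_cancel:
  assumes m: "maximalideal m R" and G: "ideal G R" "ideal_prod R m m \<subseteq> G"
    and c: "c \<in> carrier R" "c \<notin> m" and w: "w \<in> m" "c \<otimes> w \<in> G"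
  shows "w \<in> G"
proof -
  interpret m: maximalideal m R by fact
  have wc: "w \<in> carrier R" using w by auto
  have sub: "insert c m \<subseteq> carrier R" using c m.a_subset by auto
  have "Idl (insert c m) = carrier R"
    using m.I_maximal[OF genideal_ideal[OF sub]] genideal_self[OF sub] c(2)
      ideal_simps(7)[OF genideal_ideal[OF sub]] by auto
  then obtain d z where d: "d \<in> carrier R" "z \<in> m" "\<one> = d \<otimes> c \<oplus> z"
    using Idl_insert[OF m.a_subset c(1)] Idl_eq[OF m.is_ideal] by blast
  have "w = \<one> \<otimes> w" using wc by simp
  also have "\<dots> = (d \<otimes> c \<oplus> z) \<otimes> w" by (simp only: d(3))
  also have "\<dots> = d \<otimes> (c \<otimes> w) \<oplus> z \<otimes> w" using d c wc by (simp add: l_distr m_assoc)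
  also have "\<dots> \<in> G"
    using G(2) ideal_prod.prod[OF d(2) w(1), of R]
    by (intro ideal_simps(2)[OF G(1) ideal_simps(5)[OF G(1) d(1) w(2)]]) auto
  finally show ?thesis .
qed

lemma (in cring) generators_exchange:
  assumes m: "maximalideal m R" and fin: "finite X'" "finite Y" and sub: "X' \<subseteq> m" "Y \<subseteq> m"
    and gen: "m \<subseteq> Idl (X' \<union> ideal_prod R m m)" "m \<subseteq> Idl (Y \<union> ideal_prod R m m)"
    and irr: "\<And>y. y \<in> Y \<Longrightarrow> \<not> m \<subseteq> Idl (Y - {y} \<union> ideal_prod R m m)"
  shows "card Y \<le> card X'"
  using fin(2) sub(2) gen(2) irr
proof (induction "card (Y - X')" arbitrary: Y)
  case 0
  then show ?case by (auto intro: card_mono[OF fin(1)])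
next
  case (Suc l)
  interpret m: maximalideal m R by fact
  define G where "G S = Idl (S \<union> ideal_prod R m m)" for S
  have mmc: "ideal_prod R m m \<subseteq> carrier R" by (rule ideal_prod_in_carrier[OF m.is_ideal m.is_ideal])
  have subc: "S \<union> ideal_prod R m m \<subseteq> carrier R" if "S \<subseteq> m" for S using that mmc m.a_subset by auto
  have G: "ideal (G S) R" "S \<subseteq> G S" "ideal_prod R m m \<subseteq> G S" if "S \<subseteq> m" for S
    using genideal_ideal[OF subc[OF that]] genideal_self[OF subc[OF that]] by (auto simp: G_def)
  have Gmin: "G S \<subseteq> G S'" if "S \<subseteq> G S'" "S' \<subseteq> m" for S S'
    unfolding G_def[of S] using that G by (intro genideal_minimal G) auto
  have Gins: "\<exists>c z. c \<in> carrier R \<and> z \<in> G S \<and> v = c \<otimes> y \<oplus> z"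
    if "v \<in> G (insert y S)" "insert y S \<subseteq> m" for v y S
  proof -
    have "y \<in> carrier R" "S \<subseteq> m" using that m.a_subset by auto
    then show ?thesis using that(1) Idl_insert[OF subc[of S], of y] by (auto simp: G_def)
  qed
  note irr = Suc.prems(4)[folded G_def] and gen' = Suc.prems(3)[folded G_def]
  have "Y - X' \<noteq> {}" using Suc.hyps(2) by (metis card.empty nat.distinct(1))
  then obtain y where y: "y \<in> Y" "y \<notin> X'" by auto
  have Yy: "Y - {y} \<subseteq> m" using Suc.prems(2) by auto
  have "\<not> X' \<subseteq> G (Y - {y})"
  proof
    assume "X' \<subseteq> G (Y - {y})"
    then have "m \<subseteq> G (Y - {y})" using Gmin[OF _ Yy] gen(1) by (auto simp: G_def)
    then show False using irr y(1) by blast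
  qed
  then obtain x where x: "x \<in> X'" "x \<notin> G (Y - {y})" by auto
  have xm: "x \<in> m" using x sub by auto
  have ym: "y \<in> m" using y Suc.prems(2) by auto
  have insY: "insert y (Y - {y}) = Y" using y by auto
  obtain c z where c: "c \<in> carrier R" "z \<in> G (Y - {y})" "x = c \<otimes> y \<oplus> z"
    using Gins[of x y "Y - {y}"] gen' xm Suc.prems(2) unfolding insY by blast
  have cm: "c \<notin> m"
  proof
    assume "c \<in> m"
    then have "c \<otimes> y \<in> G (Y - {y})" using ideal_prod.prod[of c m y m R] ym G(3)[OF Yy] by auto
    then show False using c G(1)[OF Yy] x(2) by (auto simp: ideal_simps)
  qed
  define Y' where "Y' = insert x (Y - {y})"
  have Y'm: "Y' \<subseteq> m" using xm Yy by (auto simp: Y'_def)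
  have mon: "G S \<subseteq> G S'" if "S \<subseteq> S'" "S' \<subseteq> m" for S S' using Gmin[of S S'] G(2)[OF that(2)] that by auto
  have zc: "z \<in> carrier R" "y \<in> carrier R" using ideal_simps(8)[OF G(1)[OF Yy] c(2)] ym by auto
  have cy: "c \<otimes> y = x \<ominus> z" unfolding c(3) using c(1) zc by (simp add: minus_eq a_assoc r_neg)
  have "x \<ominus> z \<in> G Y'"
    using c(2) mon[of "Y - {y}" Y'] G(2)[OF Y'm] Y'm
    by (intro ideal_simps(3)[OF G(1)[OF Y'm]]) (auto simp: Y'_def)
  then have yG: "y \<in> G Y'" using exchange_cancel[OF m G(1,3)[OF Y'm] c(1) cm ym] cy by auto
  have "Y \<subseteq> G Y'" using yG G(2)[OF Y'm] by (auto simp: Y'_def)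
  then have gY': "m \<subseteq> G Y'" using Gmin[OF _ Y'm] gen' by blast
  have xY: "x \<notin> Y - {y}" using x(2) G(2)[OF Yy] by auto
  have "card Y' \<le> card X'"
  proof (rule Suc.hyps(1))
    have "Y' - X' = (Y - X') - {y}" using x(1) by (auto simp: Y'_def)
    then show "l = card (Y' - X')" using Suc.hyps(2) Suc.prems(1) y by simp
    show "finite Y'" using Suc.prems(1) by (simp add: Y'_def)
    show "m \<subseteq> Idl (Y' \<union> ideal_prod R m m)" using gY' by (simp add: G_def)
    fix w assume w: "w \<in> Y'"
    show "\<not> m \<subseteq> Idl (Y' - {w} \<union> ideal_prod R m m)"
      unfolding G_def[symmetric]
    proof
      assume mw: "m \<subseteq> G (Y' - {w})"
      show False
      proof (cases "w = x")
        case True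
        then have "Y' - {w} = Y - {y}" using xY by (auto simp: Y'_def)
        then show False using mw irr y by auto
      next
        case False
        define B where "B = Y - {y} - {w}"
        have wY: "w \<in> Y" "w \<noteq> y" using w False by (auto simp: Y'_def)
        have wm: "w \<in> m" using wY Suc.prems(2) by auto
        have Bm: "B \<subseteq> m" "insert x B \<subseteq> m" "insert w B \<subseteq> m" using Yy xm wm by (auto simp: B_def)
        have e: "Y' - {w} = insert x B" "insert w B = Y - {y}" using False wY by (auto simp: Y'_def B_def)
        obtain a b where a: "a \<in> carrier R" "b \<in> G B" "w = a \<otimes> x \<oplus> b"
          using Gins[of w x B] mw wm Bm unfolding e by blast
        have "a \<notin> m"
        proof
          assume "a \<in> m"
          then have "a \<otimes> x \<in> G B" using ideal_prod.prod[of a m x m R] xm G(3)[OF Bm(1)] by auto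
          then have "w \<in> G B" using a G(1)[OF Bm(1)] by (auto simp: ideal_simps)
          then have wG: "w \<in> G (Y - {w})" using mon[of B "Y - {w}"] Suc.prems(2) by (auto simp: B_def)
          have "Y - {w} \<subseteq> m" using Suc.prems(2) by auto
          then have "Y \<subseteq> G (Y - {w})" using wG G(2) by auto
          then have "m \<subseteq> G (Y - {w})" using Gmin[of Y "Y - {w}"] gen' Suc.prems(2) by auto
          then show False using irr wY(1) by blast
        qed
        have bc: "b \<in> carrier R" "x \<in> carrier R" using ideal_simps(8)[OF G(1)[OF Bm(1)] a(2)] xm by auto
        have ax: "a \<otimes> x = w \<ominus> b" unfolding a(3) using a(1) bc by (simp add: minus_eq a_assoc r_neg)
        have "w \<ominus> b \<in> G (insert w B)"
          using a(2) mon[of B "insert w B"] G(2)[OF Bm(3)] Bm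
          by (intro ideal_simps(3)[OF G(1)[OF Bm(3)]]) auto
        then have "x \<in> G (insert w B)"
          using exchange_cancel[OF m G(1,3)[OF Bm(3)] a(1) \<open>a \<notin> m\<close> xm] ax by auto
        then show False using x(2) unfolding e by simp
      qed
    qed
  qed (rule Y'm)
  moreover have "card Y' = card Y"
    using card_insert_disjoint[OF _ xY] card.remove[OF Suc.prems(1) y(1)] Suc.prems(1) by (simp add: Y'_def)
  ultimately show ?case by simp
qed

context cring
begin

lemma kos_diff_diff:
  assumes T: "finite T" and f: "f \<in> T \<rightarrow> carrier R" and a: "a \<in> kos_deg R T i"
  shows "kos_diff R f T (kos_diff R f T a) U = \<zero>"
  using T f a
proof (induction T arbitrary: a i U rule: finite_induct)
  case empty
  then show ?case by (simp add: kos_diff_def)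
next
  case (insert j T)
  have fT: "f \<in> T \<rightarrow> carrier R" and fj: "f j \<in> carrier R" using insert.prems(1) by auto
  show ?case
  proof (cases i)
    case 0
    then have "kos_diff R f (insert j T) a = (\<lambda>U. \<zero>)"
      using kos_diff_deg0[OF _ insert.prems(1)] insert by auto
    then show ?thesis using kos_diff_zero[OF insert.prems(1)] by simp
  next
    case (Suc i')
    obtain u v where u: "u \<in> kos_deg R T (Suc i')" and v: "v \<in> kos_deg R T i'"
        and auv: "\<And>U. a U = u U \<oplus> wedge R j v U"
      using kos_decompose[OF insert.prems(2)[unfolded Suc] insert.hyps(1,2)] by blast
    note uk = kos_degD(1)[OF u] and vk = kos_degD(1)[OF v]
    have du: "kos_diff R f T u \<in> kos R T" and dv: "kos_diff R f T v \<in> kos R T"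
      using kos_diff_kos fT uk vk by auto
    have c: "v U \<in> carrier R" "kos_diff R f T u U \<in> carrier R" "kos_diff R f T v U \<in> carrier R" for U
      using vk du dv by (auto simp: kos_def)
    define u' where "u' U = kos_diff R f T u U \<oplus> f j \<otimes> v U" for U
    define v' where "v' U = \<ominus> kos_diff R f T v U" for U
    have k': "u' \<in> kos R T" "v' \<in> kos R T"
      unfolding u'_def v'_def
      using kos_closed(1)[OF du kos_closed(4)[OF vk vk fj] fj] kos_closed(2)[OF dv dv fj] by auto
    have "kos_diff R f (insert j T) a U = u' U \<oplus> wedge R j v' U" for U
    proof -
      have "wedge R j v' U = \<ominus> wedge R j (kos_diff R f T v) U" using c by (auto simp: wedge_def v'_def signed_minus)
      moreover have "wedge R j (kos_diff R f T v) U \<in> carrier R" using c by (auto simp: wedge_def)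
      ultimately show ?thesis
        unfolding kos_diff_decompose[OF insert.prems(1) insert.hyps(1,2) uk vk auv] u'_def
        using c fj by (simp add: minus_eq a_assoc)
    qed
    note d = kos_diff_decompose[OF insert.prems(1) insert.hyps(1,2) k' this]
    have dv': "kos_diff R f T v' U = \<zero>" for U
      unfolding v'_def kos_diff_uminus[OF dv fT insert.hyps(1)] insert.IH[OF fT v] by simp
    have "kos_diff R f T u' U = \<zero> \<oplus> f j \<otimes> kos_diff R f T v U"
      unfolding u'_def kos_diff_add[OF du kos_closed(4)[OF vk vk fj] fT]
        kos_diff_smult[OF vk fj fT insert.hyps(1)] insert.IH[OF fT u] ..
    then have "kos_diff R f T u' U \<oplus> f j \<otimes> v' U = \<zero>"
      using c fj by (simp add: v'_def r_minus r_neg)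
    moreover have "wedge R j (kos_diff R f T v') U = \<zero>" using dv' by (simp add: wedge_def)
    ultimately show ?thesis unfolding d using c fj k' by (simp add: minus_eq v'_def)
  qed
qed

end

lemma a_r_coset_image: "H +>\<^bsub>G\<^esub> a = (\<lambda>h. h \<oplus>\<^bsub>G\<^esub> a) ` H"
  by (auto simp: a_r_coset_def')

locale koszul_quotient = noetherian_cring R + K: ideal K R for R (structure) and K +
  fixes ys :: "'a list"
  assumes ys: "set ys \<subseteq> carrier R"
begin

abbreviation "A \<equiv> R Quot K"
abbreviation "p \<equiv> (\<lambda>r. K +>\<^bsub>R\<^esub> r)"
abbreviation "T \<equiv> {..<length ys}"
abbreviation "f \<equiv> (!) ys"
abbreviation "zs \<equiv> map p ys"

sublocale pi: ring_hom_cring R A p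
  by (rule K.rcos_ring_hom_cring[OF cring_axioms])

definition red :: "(nat set \<Rightarrow> 'a) \<Rightarrow> nat set \<Rightarrow> 'a set" where
  "red a = (\<lambda>U\<in>Pow T. p (a U))"

lemma f: "f \<in> T \<rightarrow> carrier R" using ys by auto

lemma p_eq_zero: "x \<in> carrier R \<Longrightarrow> p x = \<zero>\<^bsub>A\<^esub> \<longleftrightarrow> x \<in> K"
  using K.rcos_const_imp_mem[of x] a_rcos_zero[OF K.is_ideal, of x] unfolding FactRing_def by simp blast

lemma p_surj: "y \<in> carrier A \<Longrightarrow> \<exists>x\<in>carrier R. y = p x"
  unfolding FactRing_def A_RCOSETS_def' by simp

lemma signed_p: "x \<in> carrier R \<Longrightarrow> p (signed R k x) = signed A k (p x)"
  by (auto simp: signed_def)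

lemma carrier_K: "carrier (koszul_algebra A zs) = Pow T \<rightarrow>\<^sub>E carrier A"
  by (simp add: koszul_algebra_def)

lemma red_closed: "a \<in> kos R T \<Longrightarrow> red a \<in> carrier (koszul_algebra A zs)"
  by (auto simp: red_def carrier_K kos_def)

lemma red_surj:
  assumes "z \<in> carrier (koszul_algebra A zs)"
  shows "\<exists>a\<in>kos R T. z = red a \<and> (z \<in> koszul_component A zs i \<longrightarrow> a \<in> kos_deg R T i)"
proof -
  have zc: "z U \<in> carrier A" if "U \<subseteq> T" for U using assms that by (auto simp: carrier_K)
  define a where "a U = (if U \<subseteq> T \<and> z U \<noteq> \<zero>\<^bsub>A\<^esub> then SOME x. x \<in> carrier R \<and> z U = p x else \<zero>)" for U
  have a: "a U \<in> carrier R" "U \<subseteq> T \<Longrightarrow> p (a U) = z U" for U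
  proof -
    have ex: "(SOME x. x \<in> carrier R \<and> z U = p x) \<in> carrier R \<and> z U = p (SOME x. x \<in> carrier R \<and> z U = p x)"
      if "U \<subseteq> T" using someI_ex[of "\<lambda>x. x \<in> carrier R \<and> z U = p x"] p_surj[OF zc[OF that]] by blast
    then show "a U \<in> carrier R" "U \<subseteq> T \<Longrightarrow> p (a U) = z U" by (auto simp: a_def)
  qed
  have "a \<in> kos R T" using a(1) by (auto simp: kos_def a_def)
  moreover have "z = red a"
  proof
    fix U show "z U = red a U"
      using a(2)[of U] assms by (cases "U \<subseteq> T") (simp_all add: red_def carrier_K PiE_iff extensional_def)
  qed
  moreover have "a \<in> kos_deg R T i" if "z \<in> koszul_component A zs i"
    using that \<open>a \<in> kos R T\<close> by (auto simp: kos_deg_def a_def koszul_component_def)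
  ultimately show ?thesis by blast
qed

lemma red_add:
  assumes "a \<in> kos R T" "b \<in> kos R T"
  shows "red a \<oplus>\<^bsub>koszul_algebra A zs\<^esub> red b = red (\<lambda>U. a U \<oplus> b U)"
  unfolding red_def koszul_algebra_def using kosD(1)[OF assms(1)] kosD(1)[OF assms(2)]
  by (simp, intro restrict_ext) simp

lemma red_zero: "(\<forall>U\<subseteq>T. a U \<in> K) \<Longrightarrow> a \<in> kos R T \<Longrightarrow> red a = \<zero>\<^bsub>koszul_algebra A zs\<^esub>"
  unfolding red_def koszul_algebra_def by (simp, intro restrict_ext) (simp add: p_eq_zero kos_def)

lemma red_diff:
  assumes a: "a \<in> kos R T"
  shows "koszul_diff A zs (red a) = red (kos_diff R f T a)"
proof -
  have ac: "a U \<in> carrier R" for U using a by (simp add: kos_def)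
  have "(\<Oplus>\<^bsub>A\<^esub>j\<in>T - U. signed A (card {u\<in>U. u < j}) (zs ! j \<otimes>\<^bsub>A\<^esub> red a (insert j U)))
     = p (\<Oplus>j\<in>T - U. signed R (card {u\<in>U. u < j}) (f j \<otimes> a (insert j U)))" if U: "U \<subseteq> T" for U
  proof -
    have c: "signed R (card {u\<in>U. u < j}) (f j \<otimes> a (insert j U)) \<in> carrier R" if "j \<in> T" for j
      using kos_diff_summand[OF a f that] .
    have "p (\<Oplus>j\<in>T - U. signed R (card {u\<in>U. u < j}) (f j \<otimes> a (insert j U)))
      = (\<Oplus>\<^bsub>A\<^esub>j\<in>T - U. p (signed R (card {u\<in>U. u < j}) (f j \<otimes> a (insert j U))))"
      using c by (subst pi.hom_finsum) (auto simp: comp_def)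
    also have "\<dots> = (\<Oplus>\<^bsub>A\<^esub>j\<in>T - U. signed A (card {u\<in>U. u < j}) (zs ! j \<otimes>\<^bsub>A\<^esub> red a (insert j U)))"
    proof (rule pi.S.finsum_cong'[OF refl])
      have eq: "p (signed R (card {u\<in>U. u < j}) (f j \<otimes> a (insert j U)))
        = signed A (card {u\<in>U. u < j}) (zs ! j \<otimes>\<^bsub>A\<^esub> red a (insert j U))" if j: "j \<in> T - U" for j
      proof -
        have "f j \<in> carrier R" using j f by auto
        then show ?thesis using j U ac by (simp add: signed_p red_def)
      qed
      then show "\<And>j. j \<in> T - U \<Longrightarrow> p (signed R (card {u\<in>U. u < j}) (f j \<otimes> a (insert j U)))
        = signed A (card {u\<in>U. u < j}) (zs ! j \<otimes>\<^bsub>A\<^esub> red a (insert j U))" .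
      show "(\<lambda>j. signed A (card {u\<in>U. u < j}) (zs ! j \<otimes>\<^bsub>A\<^esub> red a (insert j U))) \<in> T - U \<rightarrow> carrier A"
      proof
        fix j assume j: "j \<in> T - U"
        show "signed A (card {u\<in>U. u < j}) (zs ! j \<otimes>\<^bsub>A\<^esub> red a (insert j U)) \<in> carrier A"
          unfolding eq[OF j, symmetric] using c[of j] j by (intro pi.hom_closed) auto
      qed
    qed
    finally show ?thesis ..
  qed
  then show ?thesis
    unfolding koszul_diff_def red_def[of "kos_diff R f T a"] length_map
    by (intro restrict_ext) (simp add: kos_diff_def)
qed

lemma koszul_abelian_monoid: "abelian_monoid (koszul_algebra A zs)"
proof (rule abelian_monoidI)
  let ?Z = "koszul_algebra A zs"
  have add: "x \<oplus>\<^bsub>?Z\<^esub> y = (\<lambda>U\<in>Pow T. x U \<oplus>\<^bsub>A\<^esub> y U)" for x y by (simp add: koszul_algebra_def)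
  have zero: "\<zero>\<^bsub>?Z\<^esub> = (\<lambda>U\<in>Pow T. \<zero>\<^bsub>A\<^esub>)" by (simp add: koszul_algebra_def)
  have c: "x U \<in> carrier A" if "x \<in> carrier ?Z" "U \<in> Pow T" for x U using that by (auto simp: carrier_K)
  show "x \<oplus>\<^bsub>?Z\<^esub> y \<in> carrier ?Z" if "x \<in> carrier ?Z" "y \<in> carrier ?Z" for x y
    unfolding add carrier_K using c[OF that(1)] c[OF that(2)] by (intro restrict_PiE_iff[THEN iffD2]) auto
  show "\<zero>\<^bsub>?Z\<^esub> \<in> carrier ?Z" unfolding zero carrier_K by (intro restrict_PiE_iff[THEN iffD2]) auto
  show "x \<oplus>\<^bsub>?Z\<^esub> y \<oplus>\<^bsub>?Z\<^esub> z = x \<oplus>\<^bsub>?Z\<^esub> (y \<oplus>\<^bsub>?Z\<^esub> z)"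
    if "x \<in> carrier ?Z" "y \<in> carrier ?Z" "z \<in> carrier ?Z" for x y z
    unfolding add using c[OF that(1)] c[OF that(2)] c[OF that(3)]
    by (intro restrict_ext) (simp add: pi.S.a_assoc)
  show "\<zero>\<^bsub>?Z\<^esub> \<oplus>\<^bsub>?Z\<^esub> x = x" if "x \<in> carrier ?Z" for x
  proof
    fix U show "(\<zero>\<^bsub>?Z\<^esub> \<oplus>\<^bsub>?Z\<^esub> x) U = x U"
      using c[OF that, of U] that unfolding add zero carrier_K
      by (cases "U \<in> Pow T") (simp_all add: PiE_iff extensional_def)
  qed
  show "x \<oplus>\<^bsub>?Z\<^esub> y = y \<oplus>\<^bsub>?Z\<^esub> x" if "x \<in> carrier ?Z" "y \<in> carrier ?Z" for x y
    unfolding add using c[OF that(1)] c[OF that(2)]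
    by (intro restrict_ext) (simp add: pi.S.a_comm)
qed

lemma golod_wrt_quotient:
  assumes m: "ideal m R" and L: "ideal L R" "L \<subseteq> m" "\<And>x y. x \<in> L \<Longrightarrow> y \<in> L \<Longrightarrow> x \<otimes> y \<in> K"
    and ac: "acyclic_mod R f T 0 K L"
  shows "golod_wrt A (p ` m) zs"
  unfolding golod_wrt_def
proof (intro allI impI)
  let ?Z = "koszul_algebra A zs"
  interpret Z: abelian_monoid ?Z by (rule koszul_abelian_monoid)
  have Tf: "finite T" by simp
  fix S assume S: "S \<subseteq> (\<Union>i\<in>{1..length zs}. koszul_homology A zs i)"
  have "\<exists>w. w \<in> kos R T \<and> (\<forall>U. w U \<in> L) \<and> red w \<in> koszul_cycles A zs \<and> h = homology_class A zs (red w)"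
    if h: "h \<in> S" for h
  proof -
    obtain i z where i: "i \<ge> 1" and z: "z \<in> koszul_cycles A zs" "z \<in> koszul_component A zs i" "h = homology_class A zs z"
    proof -
      have "h \<in> (\<Union>i\<in>{1..length zs}. koszul_homology A zs i)" using S h by blast
      then obtain i where "i \<in> {1..length zs}" "h \<in> koszul_homology A zs i" by blast
      then show thesis using that[of i] unfolding koszul_homology_def by auto
    qed
    have "z \<in> carrier ?Z" using z(1) by (simp add: koszul_cycles_def)
    from red_surj[OF this, of i] obtain a where a: "a \<in> kos_deg R T i" "z = red a" using z(2) by blast
    note ak = kos_degD(1)[OF a(1)]
    have "kos_diff R f T a U \<in> K" for U
    proof (cases "U \<subseteq> T")
      case True
      have "red (kos_diff R f T a) = \<zero>\<^bsub>?Z\<^esub>" using z(1) red_diff[OF ak] a(2) by (simp add: koszul_cycles_def)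
      then have "red (kos_diff R f T a) U = \<zero>\<^bsub>?Z\<^esub> U" by simp
      then have "p (kos_diff R f T a U) = \<zero>\<^bsub>A\<^esub>" using True by (simp add: red_def koszul_algebra_def)
      then show ?thesis using p_eq_zero kosD(1)[OF kos_diff_kos[OF ak f]] by blast
    next
      case False
      then show ?thesis using kosD(2)[OF kos_diff_kos[OF ak f]] K.zero_closed by simp
    qed
    then obtain u where u: "u \<in> kos_deg R T (Suc i)" "\<And>U. a U \<ominus> kos_diff R f T u U \<in> L"
      using ac a(1) i unfolding acyclic_mod_def by (meson less_le_trans zero_less_one)
    note uk = kos_degD(1)[OF u(1)]
    have du: "kos_diff R f T u \<in> kos_deg R T i" by (rule kos_diff_deg[OF u(1) f Tf])
    note duk = kos_degD(1)[OF du]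
    define w where "w U = a U \<ominus> kos_diff R f T u U" for U
    have w: "w \<in> kos R T" unfolding w_def using kos_closed(3)[OF ak duk one_closed] .
    have c: "a U \<in> carrier R" "kos_diff R f T u U \<in> carrier R" "w U \<in> carrier R" for U
      using ak duk w by (auto simp: kos_def)
    have "kos_diff R f T w = kos_diff R f T a"
    proof
      fix U
      have "kos_diff R f T a U \<in> carrier R" using kos_diff_kos[OF ak f] by (simp add: kos_def)
      then show "kos_diff R f T w U = kos_diff R f T a U"
        unfolding w_def kos_diff_minus[OF ak duk f Tf] kos_diff_diff[OF Tf f u(1)] by (simp add: minus_eq)
    qed
    then have cyc: "red w \<in> koszul_cycles A zs"
      using z(1) red_diff[OF ak] red_diff[OF w] red_closed[OF w] a(2) by (simp add: koszul_cycles_def)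
    have B: "koszul_boundaries A zs = {red (kos_diff R f T b) | b. b \<in> kos R T}"
    proof
      show "koszul_boundaries A zs \<subseteq> {red (kos_diff R f T b) | b. b \<in> kos R T}"
        using red_surj red_diff unfolding koszul_boundaries_def by blast
      show "{red (kos_diff R f T b) | b. b \<in> kos R T} \<subseteq> koszul_boundaries A zs"
        using red_closed red_diff[symmetric] unfolding koszul_boundaries_def by blast
    qed
    have cl: "homology_class A zs (red x) = (\<lambda>b. red (\<lambda>U. kos_diff R f T b U \<oplus> x U)) ` kos R T"
      if x: "x \<in> kos R T" for x
    proof -
      have "homology_class A zs (red x) = (\<lambda>b. red (kos_diff R f T b) \<oplus>\<^bsub>?Z\<^esub> red x) ` kos R T"
        unfolding homology_class_def B a_r_coset_image[where G = "?Z"] setcompr_eq_image image_image by simp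
      also have "\<dots> = (\<lambda>b. red (\<lambda>U. kos_diff R f T b U \<oplus> x U)) ` kos R T"
        by (rule image_cong[OF refl]) (rule red_add[OF kos_diff_kos[OF _ f] x])
      finally show ?thesis .
    qed
    have "homology_class A zs (red a) = homology_class A zs (red w)"
      unfolding cl[OF ak] cl[OF w]
    proof (intro subset_antisym image_subsetI)
      fix b assume b: "b \<in> kos R T"
      have bc: "kos_diff R f T b U \<in> carrier R" for U using kos_diff_kos[OF b f] by (simp add: kos_def)
      have eq: "kos_diff R f T (\<lambda>U. b U \<oplus> u U) U \<oplus> w U = kos_diff R f T b U \<oplus> a U" for U
        unfolding kos_diff_add[OF b uk f] w_def using c(1,2)[of U] bc[of U] by algebra
      show "red (\<lambda>U. kos_diff R f T b U \<oplus> a U) \<in> (\<lambda>b. red (\<lambda>U. kos_diff R f T b U \<oplus> w U)) ` kos R T"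
        by (rule image_eqI[OF _ kos_closed(1)[OF b uk one_closed]]) (simp only: eq)
      have eq: "kos_diff R f T (\<lambda>U. b U \<ominus> u U) U \<oplus> a U = kos_diff R f T b U \<oplus> w U" for U
        unfolding kos_diff_minus[OF b uk f Tf] w_def using c(1,2)[of U] bc[of U] by algebra
      show "red (\<lambda>U. kos_diff R f T b U \<oplus> w U) \<in> (\<lambda>b. red (\<lambda>U. kos_diff R f T b U \<oplus> a U)) ` kos R T"
        by (rule image_eqI[OF _ kos_closed(3)[OF b uk one_closed]]) (simp only: eq)
    qed
    then show ?thesis using w u(2) cyc z(3) a(2) by (auto simp: w_def)
  qed
  then obtain w where w: "\<And>h. h \<in> S \<Longrightarrow> w h \<in> kos R T" "\<And>h U. h \<in> S \<Longrightarrow> w h U \<in> L"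
    "\<And>h. h \<in> S \<Longrightarrow> red (w h) \<in> koszul_cycles A zs" "\<And>h. h \<in> S \<Longrightarrow> h = homology_class A zs (red (w h))"
    by metis
  define W where "W hs = (if length hs = 1 then w (hd hs) else (\<lambda>U. \<zero>))" for hs
  have W: "W hs \<in> kos R T" "W hs U \<in> L" if "hs \<in> lists S" for hs U
  proof -
    have "hd hs \<in> S" if "length hs = 1" using that \<open>hs \<in> lists S\<close> by (cases hs) auto
    then show "W hs \<in> kos R T" "W hs U \<in> L"
      using w(1,2) kos_degD(1)[OF kos_deg_zero] ideal_simps(1)[OF L(1)] by (auto simp: W_def)
  qed
  define \<gamma> where "\<gamma> hs = red (W hs)" for hs
  have prod0: "koszul_bar A zs (\<gamma> hs) \<otimes>\<^bsub>?Z\<^esub> \<gamma> hs' = \<zero>\<^bsub>?Z\<^esub>" if hs: "hs \<in> lists S" "hs' \<in> lists S" for hs hs'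
  proof -
    have z: "signed A k (koszul_bar A zs (\<gamma> hs) V \<otimes>\<^bsub>A\<^esub> \<gamma> hs' V') = \<zero>\<^bsub>A\<^esub>" if V: "V \<subseteq> T" "V' \<subseteq> T" for k V V'
    proof -
      have x: "W hs V \<in> carrier R" "W hs' V' \<in> carrier R" using W(1) hs by (auto simp: kos_def)
      have "W hs V \<otimes> W hs' V' \<in> K" using W(2) hs L(3) by blast
      then have "p (W hs V) \<otimes>\<^bsub>A\<^esub> p (W hs' V') = \<zero>\<^bsub>A\<^esub>" using p_eq_zero[of "W hs V \<otimes> W hs' V'"] x by simp
      then have "signed A l (p (W hs V)) \<otimes>\<^bsub>A\<^esub> p (W hs' V') = \<zero>\<^bsub>A\<^esub>" for l
        using x by (auto simp: signed_def pi.S.l_minus)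
      then show ?thesis using V by (simp add: koszul_bar_def \<gamma>_def red_def)
    qed
    have "(\<Oplus>\<^bsub>A\<^esub>V\<in>Pow U. signed A (inversions V (U - V)) (koszul_bar A zs (\<gamma> hs) V \<otimes>\<^bsub>A\<^esub> \<gamma> hs' (U - V))) = \<zero>\<^bsub>A\<^esub>"
      if U: "U \<subseteq> T" for U
    proof (rule pi.S.add.finprod_one_eqI)
      fix V assume "V \<in> Pow U"
      then have "V \<subseteq> T" "U - V \<subseteq> T" using U by auto
      then show "signed A (inversions V (U - V)) (koszul_bar A zs (\<gamma> hs) V \<otimes>\<^bsub>A\<^esub> \<gamma> hs' (U - V)) = \<zero>\<^bsub>A\<^esub>"
        by (rule z)
    qed
    then show ?thesis unfolding koszul_algebra_def by (simp, intro restrict_ext) simp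
  qed
  show "\<exists>\<gamma>. (\<forall>hs\<in>lists S. \<gamma> hs \<in> carrier ?Z \<and> \<gamma> hs {} \<in> p ` m) \<and>
      (\<forall>h\<in>S. \<gamma> [h] \<in> koszul_cycles A zs \<and> h = homology_class A zs (\<gamma> [h])) \<and>
      (\<forall>hs\<in>lists S. length hs > 1 \<longrightarrow> koszul_diff A zs (\<gamma> hs) =
         (\<Oplus>\<^bsub>?Z\<^esub>l\<in>{1..length hs - 1}. koszul_bar A zs (\<gamma> (take l hs)) \<otimes>\<^bsub>?Z\<^esub> \<gamma> (drop l hs)))"
  proof (intro exI[of _ \<gamma>] conjI ballI impI)
    fix hs assume hs: "hs \<in> lists S"
    show "\<gamma> hs \<in> carrier ?Z" unfolding \<gamma>_def by (rule red_closed[OF W(1)[OF hs]])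
    show "\<gamma> hs {} \<in> p ` m" using W(2)[OF hs, of "{}"] L(2) by (auto simp: \<gamma>_def red_def)
    assume len: "length hs > 1"
    have "koszul_diff A zs (\<gamma> hs) = red (kos_diff R f T (\<lambda>U. \<zero>))"
      unfolding \<gamma>_def red_diff[OF W(1)[OF hs]] using len by (simp add: W_def)
    also have "\<dots> = \<zero>\<^bsub>?Z\<^esub>"
      using kos_diff_zero[OF f] kos_diff_kos[OF kos_degD(1)[OF kos_deg_zero] f]
      by (intro red_zero) auto
    also have "\<dots> = (\<Oplus>\<^bsub>?Z\<^esub>l\<in>{1..length hs - 1}. koszul_bar A zs (\<gamma> (take l hs)) \<otimes>\<^bsub>?Z\<^esub> \<gamma> (drop l hs))"
      using hs by (intro Z.add.finprod_one_eqI[symmetric] prod0) (auto dest: in_set_takeD in_set_dropD)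
    finally show "koszul_diff A zs (\<gamma> hs) =
        (\<Oplus>\<^bsub>?Z\<^esub>l\<in>{1..length hs - 1}. koszul_bar A zs (\<gamma> (take l hs)) \<otimes>\<^bsub>?Z\<^esub> \<gamma> (drop l hs))" .
  next
    fix h assume "h \<in> S"
    then show "\<gamma> [h] \<in> koszul_cycles A zs" "h = homology_class A zs (\<gamma> [h])"
      using w(3,4) by (auto simp: \<gamma>_def W_def)
  qed
qed

end

text \<open>
  The complexes on \<open>ys\<close> and on \<open>xs\<close> are compared inside the complex on both sequences; this makes
  the Artin-Rees number independent of \<open>ys\<close>. The indices \<open>\<ge> length xs\<close> belong to \<open>xs\<close>.
\<close>

lemma (in noetherian_cring) acyclic_mod_uniform:
  assumes xs: "regular_sequence R xs" "Idl (set xs) = m" and I: "ideal I R"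
  shows "\<exists>r. \<forall>ys k. set ys \<subseteq> carrier R \<longrightarrow> Idl (set ys) = m \<longrightarrow> length ys \<le> length xs \<longrightarrow>
    acyclic_mod R ((!) ys) {..<length ys} 0 (ideal_power R I k) (ideal_power R I (k - r))"
proof -
  define n where "n = length xs"
  define g where "g j = xs ! (j - n)" for j
  define T0 where "T0 = {n..<n + n}"
  have xc: "set xs \<subseteq> carrier R" using xs(1) by (simp add: regular_sequence_def)
  have g: "g \<in> T0 \<rightarrow> carrier R"
  proof
    fix j assume "j \<in> T0"
    then have "j - n < length xs" by (auto simp: T0_def n_def)
    then show "g j \<in> carrier R" using xc nth_mem[of "j - n" xs] by (auto simp: g_def)
  qed
  have "acyclic_mod R g T0 0 {\<zero>} {\<zero>}"
    unfolding T0_def using regular_sequence_acyclic[OF xs(1), of g n] by (simp add: g_def n_def)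
  from acyclic_mod_powers[OF I _ g this] obtain r0 where
    r0: "\<And>k. acyclic_mod R g T0 0 (ideal_power R I k) (ideal_power R I (k - r0))" by (auto simp: T0_def)
  define r where "r = 2 ^ n * r0"
  note pI = ideal_power_ideal[OF I] and pa = ideal_power_antimono[OF I]
  have "acyclic_mod R ((!) ys) {..<length ys} 0 (ideal_power R I k) (ideal_power R I (k - r))"
    if ys: "set ys \<subseteq> carrier R" "Idl (set ys) = m" "length ys \<le> length xs" for ys k
  proof -
    define e where "e = length ys"
    define f where "f j = (if j < e then ys ! j else g j)" for j
    have en: "e \<le> n" using ys by (simp add: e_def n_def)
    have f: "f \<in> {..<e} \<union> T0 \<rightarrow> carrier R"
    proof (rule Pi_I)
      fix j assume j: "j \<in> {..<e} \<union> T0"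
      show "f j \<in> carrier R"
      proof (cases "j < e")
        case True
        then show ?thesis using ys(1) nth_mem[of j ys] by (auto simp: f_def e_def)
      next
        case False
        then have "j \<in> T0" using j by auto
        then show ?thesis using False g by (auto simp: f_def Pi_iff)
      qed
    qed
    have up: "acyclic_mod R f ({..<i} \<union> T0) i (ideal_power R I k) (ideal_power R I (k - 2 ^ i * r0))"
      if "i \<le> e" for i k
      using that
    proof (induction i arbitrary: k)
      case 0
      have "acyclic_mod R g T0 0 (ideal_power R I k) (ideal_power R I (k - r0))
          = acyclic_mod R f T0 0 (ideal_power R I k) (ideal_power R I (k - r0))"
        using en g by (intro acyclic_mod_cong) (auto simp: f_def T0_def)
      then show ?case using r0 by simp
    next
      case (Suc i)
      have ins: "{..<Suc i} \<union> T0 = insert i ({..<i} \<union> T0)" by auto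
      have e: "k - 2 ^ Suc i * r0 = (k - 2 ^ i * r0) - 2 ^ i * r0" by simp
      show ?case unfolding ins e
      proof (rule acyclic_mod_insert[where Q = "ideal_power R I (k - 2 ^ i * r0)"])
        show "f \<in> insert i ({..<i} \<union> T0) \<rightarrow> carrier R" using f Suc.prems by auto
        show "i \<notin> {..<i} \<union> T0" using Suc.prems en by (auto simp: T0_def)
        show "acyclic_mod R f ({..<i} \<union> T0) i (ideal_power R I k) (ideal_power R I (k - 2 ^ i * r0))"
          "acyclic_mod R f ({..<i} \<union> T0) i (ideal_power R I (k - 2 ^ i * r0))
            (ideal_power R I (k - 2 ^ i * r0 - 2 ^ i * r0))"
          by (rule Suc.IH, use Suc.prems in simp)+
      qed (use pI pa in \<open>auto simp: T0_def\<close>)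
    qed
    have "2 ^ e * r0 \<le> r" unfolding r_def using en by (intro mult_right_mono power_increasing) auto
    then have top: "acyclic_mod R f ({..<e} \<union> T0) n (ideal_power R I k) (ideal_power R I (k - r))"
      using acyclic_mod_mono[OF up[of e k] order_refl pa[of "k - r" "k - 2 ^ e * r0"] en] by auto
    have down: "acyclic_mod R f ({..<e} \<union> {n..<n + i}) i (ideal_power R I k) (ideal_power R I (k - r))"
      if "i \<le> n" for i
      using that
    proof (induction i rule: inc_induct)
      case base
      then show ?case using top by (simp add: T0_def)
    next
      case (step i)
      define T where "T = {..<e} \<union> {n..<n + i}"
      have ins: "{..<e} \<union> {n..<n + Suc i} = insert (n + i) T" by (auto simp: T_def)
      have fT: "f \<in> insert (n + i) T \<rightarrow> carrier R" using f step.hyps by (auto simp: T0_def T_def)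
      show ?case unfolding T_def[symmetric]
      proof (rule acyclic_mod_remove[OF fT])
        show "finite T" "n + i \<notin> T" using en by (auto simp: T_def)
        have "f (n + i) = xs ! i" using en by (simp add: f_def g_def)
        then have "f (n + i) \<in> m" using genideal_self[OF xc] xs(2) step.hyps by (auto simp: n_def)
        also have "m \<subseteq> Idl (f ` T)"
        proof -
          have "set ys \<subseteq> f ` T"
            by (auto simp: in_set_conv_nth f_def e_def T_def image_iff intro!: bexI)
          moreover have "f ` T \<subseteq> carrier R" using fT by auto
          ultimately show ?thesis using ys(2) Idl_mono[of "set ys" "f ` T"] by simp
        qed
        finally show "f (n + i) \<in> Idl (f ` T)" .
        show "acyclic_mod R f (insert (n + i) T) (Suc i) (ideal_power R I k) (ideal_power R I (k - r))"
          using step.IH unfolding ins .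
      qed (rule pI)+
    qed
    have "acyclic_mod R f {..<e} 0 (ideal_power R I k) (ideal_power R I (k - r))" using down[of 0] by simp
    moreover have "acyclic_mod R f {..<e} 0 (ideal_power R I k) (ideal_power R I (k - r))
        = acyclic_mod R ((!) ys) {..<e} 0 (ideal_power R I k) (ideal_power R I (k - r))"
      using f by (intro acyclic_mod_cong) (auto simp: f_def)
    ultimately show ?thesis by (simp add: e_def)
  qed
  then show ?thesis by blast
qed

lemma (in cring) Idl_quotient:
  assumes K: "ideal K R" and S: "S \<subseteq> carrier R"
  shows "Idl\<^bsub>R Quot K\<^esub> ((+>) K ` S) = (+>) K ` (Idl S)"
proof
  interpret K: ideal K R by fact
  interpret pi: ring_hom_cring R "R Quot K" "(+>) K" by (rule K.rcos_ring_hom_cring[OF cring_axioms])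
  have sub: "(+>) K ` S \<subseteq> carrier (R Quot K)" using S by auto
  note I = genideal_ideal[OF S]
  show "Idl\<^bsub>R Quot K\<^esub> ((+>) K ` S) \<subseteq> (+>) K ` (Idl S)"
    using ring_ideal_imp_quot_ideal[OF K I] genideal_self[OF S] by (intro pi.S.genideal_minimal) auto
  have "ideal {r \<in> carrier R. K +> r \<in> Idl\<^bsub>R Quot K\<^esub> ((+>) K ` S)} R"
    by (rule ring_hom_ring.ideal_vimage[OF K.rcos_ring_hom_ring pi.S.genideal_ideal[OF sub]])
  then have "Idl S \<subseteq> {r \<in> carrier R. K +> r \<in> Idl\<^bsub>R Quot K\<^esub> ((+>) K ` S)}"
    using S pi.S.genideal_self[OF sub] by (intro genideal_minimal) auto
  then show "(+>) K ` (Idl S) \<subseteq> Idl\<^bsub>R Quot K\<^esub> ((+>) K ` S)" by auto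
qed

lemma (in cring) coset_imageD:
  assumes K: "ideal K R" and r: "r \<in> carrier R" "K +> r \<in> (+>) K ` J" and J: "J \<subseteq> carrier R"
  shows "\<exists>j\<in>J. \<exists>k\<in>K. r = k \<oplus> j"
proof -
  interpret K: ideal K R by fact
  obtain j where j: "j \<in> J" "K +> r = K +> j" using r(2) by auto
  have "r \<in> K +> r" using K.a_rcos_self[OF r(1)] .
  then show ?thesis unfolding j(2) using j(1) by (auto simp: a_r_coset_def')
qed

lemma (in noetherian_cring) golod_quotient_powers:
  assumes m: "maximalideal m R" and xs: "regular_sequence R xs" "Idl (set xs) = m"
    and I: "ideal I R" "I \<subseteq> m" and H: "H \<subseteq> carrier R"
    and nak: "\<And>Y. Y \<subseteq> H \<Longrightarrow> Y \<subseteq> m \<Longrightarrow> m \<subseteq> Idl (Y \<union> ideal_prod R m m) \<Longrightarrow> Idl Y = m"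
  shows "\<exists>k0\<ge>1. \<forall>k\<ge>k0. \<forall>zs. minimal_generators (R Quot ideal_power R I k) ((+>) (ideal_power R I k) ` m) zs \<longrightarrow>
    set zs \<subseteq> (+>) (ideal_power R I k) ` H \<longrightarrow>
    golod_wrt (R Quot ideal_power R I k) ((+>) (ideal_power R I k) ` m) zs"
proof -
  interpret m: maximalideal m R by fact
  note mi = m.is_ideal
  obtain r where r: "\<And>ys k. set ys \<subseteq> carrier R \<Longrightarrow> Idl (set ys) = m \<Longrightarrow> length ys \<le> length xs \<Longrightarrow>
    acyclic_mod R ((!) ys) {..<length ys} 0 (ideal_power R I k) (ideal_power R I (k - r))"
    using acyclic_mod_uniform[OF xs I(1)] by blast
  have xc: "set xs \<subseteq> carrier R" using xs(1) by (simp add: regular_sequence_def)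
  have xm: "set xs \<subseteq> m" using genideal_self[OF xc] xs(2) by simp
  have mm: "ideal (ideal_prod R m m) R" by (rule ideal_prod_is_ideal[OF mi mi])
  have "golod_wrt (R Quot ideal_power R I k) ((+>) (ideal_power R I k) ` m) zs"
    if k: "k \<ge> 2 * r + 2" and zs: "minimal_generators (R Quot ideal_power R I k) ((+>) (ideal_power R I k) ` m) zs"
      "set zs \<subseteq> (+>) (ideal_power R I k) ` H" for k zs
  proof -
    define K where "K = ideal_power R I k"
    have K: "ideal K R" unfolding K_def by (rule ideal_power_ideal[OF I(1)])
    have K2: "K \<subseteq> ideal_prod R m m"
    proof -
      have "K \<subseteq> ideal_power R I 2" unfolding K_def by (rule ideal_power_antimono[OF I(1)]) (use k in auto)
      also have "ideal_power R I 2 = ideal_prod R (ideal_prod R (carrier R) I) I" by (simp add: numeral_2_eq_2)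
      also have "\<dots> \<subseteq> ideal_prod R m m"
      proof (rule ideal_prod_minimal[OF mm])
        fix i j assume "i \<in> ideal_prod R (carrier R) I" "j \<in> I"
        moreover have "ideal_prod R (carrier R) I \<subseteq> I" using ideal_prod_inter[OF oneideal I(1)] by auto
        ultimately show "i \<otimes> j \<in> ideal_prod R m m" using I(2) by (auto intro: ideal_prod.prod)
      qed
      finally show ?thesis .
    qed
    have Km: "K \<subseteq> m" using K2 ideal_prod_inter[OF mi mi] by auto
    note zs = zs[folded K_def]
    have "\<forall>z\<in>set zs. \<exists>y\<in>H. z = K +> y" using zs(2) by auto
    then obtain h where h: "\<And>z. z \<in> set zs \<Longrightarrow> h z \<in> H" "\<And>z. z \<in> set zs \<Longrightarrow> z = K +> h z" by metis
    define ys where "ys = map h zs"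
    have len: "length ys = length zs" by (simp add: ys_def)
    have zy: "zs = map ((+>) K) ys" unfolding ys_def map_map using h(2) by (intro map_idI[symmetric]) auto
    have yH: "set ys \<subseteq> H" using h(1) by (auto simp: ys_def)
    then have yc: "set ys \<subseteq> carrier R" using H by auto
    have genm: "m \<subseteq> Idl (Y \<union> ideal_prod R m m)" if Y: "Y \<subseteq> carrier R" "(+>) K ` m \<subseteq> (+>) K ` (Idl Y)" for Y
    proof
      fix x assume x: "x \<in> m"
      then have "x \<in> carrier R" "K +> x \<in> (+>) K ` (Idl Y)" using Y(2) by auto
      from coset_imageD[OF K this ideal_simps(7)[OF genideal_ideal[OF Y(1)]]]
      obtain j k where jk: "j \<in> Idl Y" "k \<in> K" "x = k \<oplus> j" by auto
      have sub: "Y \<union> ideal_prod R m m \<subseteq> carrier R" using Y(1) ideal_simps(7)[OF mm] by auto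
      have "k \<in> Idl (Y \<union> ideal_prod R m m)" using jk(2) K2 genideal_self[OF sub] by auto
      moreover have "j \<in> Idl (Y \<union> ideal_prod R m m)" using jk(1) Idl_mono[OF _ sub, of Y] by auto
      ultimately show "x \<in> Idl (Y \<union> ideal_prod R m m)"
        unfolding jk(3) by (rule ideal_simps(2)[OF genideal_ideal[OF sub]])
    qed
    have Idl_zs: "Idl\<^bsub>R Quot K\<^esub> (set zs) = (+>) K ` m" using zs(1) by (simp add: minimal_generators_def)
    have im: "(+>) K ` m = (+>) K ` (Idl (set ys))"
      using Idl_zs Idl_quotient[OF K yc] by (simp add: zy)
    have ym: "set ys \<subseteq> m"
    proof
      fix y assume y: "y \<in> set ys"
      have "K +> y \<in> (+>) K ` m" unfolding im using genideal_self[OF yc] y by auto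
      then obtain j k where "j \<in> m" "k \<in> K" "y = k \<oplus> j"
        using coset_imageD[OF K _ _ m.a_subset, of y] yc y by auto
      then show "y \<in> m" using Km ideal_simps(2)[OF mi] by auto
    qed
    have gy: "m \<subseteq> Idl (set ys \<union> ideal_prod R m m)" by (rule genm[OF yc]) (simp add: im)
    have Idl_ys: "Idl (set ys) = m" by (rule nak[OF yH ym gy])
    have irr: "\<not> m \<subseteq> Idl ({ys ! j | j. j < length ys \<and> j \<noteq> i} \<union> ideal_prod R m m)" if i: "i < length ys" for i
    proof
      define Y where "Y = {ys ! j | j. j < length ys \<and> j \<noteq> i}"
      assume "m \<subseteq> Idl ({ys ! j | j. j < length ys \<and> j \<noteq> i} \<union> ideal_prod R m m)"
      then have "m \<subseteq> Idl (Y \<union> ideal_prod R m m)" by (simp add: Y_def)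
      moreover have "Y \<subseteq> set ys" by (auto simp: Y_def)
      ultimately have "Idl Y = m" using yH ym by (intro nak) auto
      then have "Idl\<^bsub>R Quot K\<^esub> ((+>) K ` Y) = (+>) K ` m"
        using Idl_quotient[OF K, of Y] \<open>Y \<subseteq> set ys\<close> yc by auto
      moreover have "(+>) K ` Y = {zs ! j | j. j < length zs \<and> j \<noteq> i}" 
      proof -
        have "Y = (!) ys ` ({..<length ys} - {i})" by (auto simp: Y_def)
        then have "(+>) K ` Y = (\<lambda>j. K +> ys ! j) ` ({..<length ys} - {i})" by (simp add: image_image)
        also have "\<dots> = (!) zs ` ({..<length zs} - {i})" using zy by (intro image_cong) auto
        also have "\<dots> = {zs ! j | j. j < length zs \<and> j \<noteq> i}" by auto
        finally show ?thesis .
      qed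
      ultimately show False using zs(1) i len by (auto simp: minimal_generators_def)
    qed
    have dist: "distinct ys"
      unfolding distinct_conv_nth
    proof (intro allI impI notI)
      fix i j assume ij: "i < length ys" "j < length ys" "i \<noteq> j" "ys ! i = ys ! j"
      have "set ys \<subseteq> {ys ! l | l. l < length ys \<and> l \<noteq> i}"
      proof
        fix y assume "y \<in> set ys"
        then obtain l where "l < length ys" "y = ys ! l" by (auto simp: in_set_conv_nth)
        then show "y \<in> {ys ! l | l. l < length ys \<and> l \<noteq> i}" using ij by (cases "l = i") auto
      qed
      then have "set ys = {ys ! l | l. l < length ys \<and> l \<noteq> i}" by auto
      then show False using irr[OF ij(1)] gy by simp
    qed
    have "card (set ys) \<le> card (set xs)"
    proof (rule generators_exchange[OF m finite_set finite_set xm ym _ gy])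
      have sub: "set xs \<union> ideal_prod R m m \<subseteq> carrier R" using xc ideal_simps(7)[OF mm] by auto
      show "m \<subseteq> Idl (set xs \<union> ideal_prod R m m)" using Idl_mono[OF _ sub, of "set xs"] xs(2) by auto
      fix y assume "y \<in> set ys"
      then obtain i where i: "i < length ys" "y = ys ! i" by (auto simp: in_set_conv_nth)
      have "set ys - {y} = {ys ! j | j. j < length ys \<and> j \<noteq> i}"
        using i dist by (auto simp: in_set_conv_nth nth_eq_iff_index_eq)
      then show "\<not> m \<subseteq> Idl (set ys - {y} \<union> ideal_prod R m m)" using irr[OF i(1)] by simp
    qed
    then have le: "length ys \<le> length xs" using dist card_length[of xs] by (simp add: distinct_card)
    interpret kq: koszul_quotient R K ys
      using K yc noetherian_cring_axioms by (intro koszul_quotient.intro koszul_quotient_axioms.intro)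
    have "golod_wrt (R Quot K) ((+>) K ` m) (map ((+>) K) ys)"
    proof (rule kq.golod_wrt_quotient[OF mi ideal_power_ideal[OF I(1)]])
      show "acyclic_mod R ((!) ys) {..<length ys} 0 K (ideal_power R I (k - r))"
        unfolding K_def by (rule r[OF yc Idl_ys le])
      have "ideal_power R I (k - r) \<subseteq> ideal_power R I (Suc 0)"
        by (rule ideal_power_antimono[OF I(1)]) (use k in auto)
      also have "\<dots> \<subseteq> I" using ideal_prod_inter[OF oneideal I(1)] by auto
      finally show "ideal_power R I (k - r) \<subseteq> m" using I(2) by auto
      fix x y assume "x \<in> ideal_power R I (k - r)" "y \<in> ideal_power R I (k - r)"
      then have "x \<otimes> y \<in> ideal_power R I ((k - r) + (k - r))" by (rule ideal_power_mult[OF I(1)])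
      moreover have "k \<le> (k - r) + (k - r)" using k by auto
      ultimately show "x \<otimes> y \<in> K" using ideal_power_antimono[OF I(1)] unfolding K_def by blast
    qed
    then show ?thesis by (simp add: zy K_def)
  qed
  then show ?thesis by (intro exI[of _ "2 * r + 2"]) auto
qed

lemma (in noetherian_cring) local_nakayama:
  assumes m: "primeideal m R" and units: "carrier R - m \<subseteq> Units R" and Y: "Y \<subseteq> m"
    and gen: "m \<subseteq> Idl (Y \<union> ideal_prod R m m)"
  shows "Idl Y = m"
proof
  interpret m: primeideal m R by fact
  have Yc: "Y \<subseteq> carrier R" using Y m.a_subset by auto
  note I = genideal_ideal[OF Yc]
  show "Idl Y \<subseteq> m" by (rule genideal_minimal[OF m.is_ideal Y])
  obtain G where G: "G \<subseteq> carrier R" "finite G" "m = Idl G" using finetely_gen[OF m.is_ideal] by blast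
  define W where "W = Idl (Idl Y \<union> {i \<otimes> g | i g. i \<in> m \<and> g \<in> G})"
  have Wsub: "Idl Y \<union> {i \<otimes> g | i g. i \<in> m \<and> g \<in> G} \<subseteq> carrier R"
    using ideal_simps(7)[OF I] G(1) m.a_subset by auto
  have W: "ideal W R" unfolding W_def by (rule genideal_ideal[OF Wsub])
  have Wsup: "Idl Y \<union> {i \<otimes> g | i g. i \<in> m \<and> g \<in> G} \<subseteq> W" unfolding W_def by (rule genideal_self[OF Wsub])
  have WG: "i \<otimes> g \<in> W" if "i \<in> m" "g \<in> G" for i g using Wsup that by blast
  have "ideal_prod R m m \<subseteq> W"
  proof (rule ideal_prod_minimal[OF W])
    fix i j assume ij: "i \<in> m" "j \<in> m"
    have "Idl G \<subseteq> {w \<in> carrier R. i \<otimes> w \<in> W}"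
      using WG ij(1) G(1) by (intro genideal_minimal ideal_colon[OF W]) auto
    then show "i \<otimes> j \<in> W" using ij(2) G(3) by auto
  qed
  then have "Idl (Y \<union> ideal_prod R m m) \<subseteq> W"
    using Wsup genideal_self[OF Yc] by (intro genideal_minimal[OF W]) auto
  then have "G \<subseteq> saturation R m W"
    using gen genideal_self[OF G(1)] G(3) saturation_superset[OF m W] by auto
  then obtain u where u: "u \<in> carrier R - m" "\<forall>g\<in>G. u \<otimes> g \<in> Idl Y"
    using nakayama[OF m I G(2,1)] unfolding W_def by blast
  then have uu: "u \<in> Units R" using units by auto
  have "G \<subseteq> Idl Y"
  proof
    fix g assume "g \<in> G"
    then have g: "inv u \<otimes> (u \<otimes> g) \<in> Idl Y" "g \<in> carrier R"
      using u uu ideal_simps(5)[OF I] G(1) by auto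
    have "inv u \<otimes> (u \<otimes> g) = (inv u \<otimes> u) \<otimes> g" using uu g(2) by (intro m_assoc[symmetric]) auto
    then show "g \<in> Idl Y" using g uu by simp
  qed
  then show "m \<subseteq> Idl Y" unfolding G(3) by (intro genideal_minimal I)
qed

lemma (in noetherian_cring) max_ideal_quotient:
  assumes loc: "local_ring R" and K: "ideal K R" "K \<subseteq> max_ideal R"
  shows "max_ideal (R Quot K) = (+>) K ` max_ideal R"
proof -
  define m where "m = max_ideal R"
  have max: "maximalideal m R" unfolding m_def by (rule local_ring_max_ideal(1)[OF loc])
  have uniq: "M = m" if "maximalideal M R" for M unfolding m_def by (rule local_ring_max_ideal(2)[OF loc that])
  interpret m: maximalideal m R by fact
  interpret K: ideal K R by fact
  interpret pi: ring_hom_cring R "R Quot K" "(+>) K" by (rule K.rcos_ring_hom_cring[OF cring_axioms])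
  have surj: "carrier (R Quot K) = (+>) K ` carrier R" unfolding FactRing_def A_RCOSETS_def' by auto
  have im: "ideal ((+>) K ` m) (R Quot K)" by (rule ring_ideal_imp_quot_ideal[OF K(1) m.is_ideal])
  have sub: "J \<subseteq> (+>) K ` m" if J: "ideal J (R Quot K)" "J \<noteq> carrier (R Quot K)" for J
  proof -
    interpret J: ideal J "R Quot K" by fact
    define J' where "J' = {r \<in> carrier R. K +> r \<in> J}"
    have J': "ideal J' R" unfolding J'_def by (rule ring_hom_ring.ideal_vimage[OF K.rcos_ring_hom_ring J(1)])
    have JJ': "J = (+>) K ` J'" using J.a_subset surj by (auto simp: J'_def)
    have "J' \<noteq> carrier R" using JJ' J(2) surj by auto
    then obtain M where "maximalideal M R" "J' \<subseteq> M" using exists_maximalideal_superset[OF J'] by auto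
    then show ?thesis using uniq JJ' by auto
  qed
  have ne: "(+>) K ` m \<noteq> carrier (R Quot K)"
  proof
    assume eq: "(+>) K ` m = carrier (R Quot K)"
    then have "K +> \<one> \<in> (+>) K ` m" using pi.hom_closed[OF one_closed] by simp
    then obtain j k where "j \<in> m" "k \<in> K" "\<one> = k \<oplus> j"
      using coset_imageD[OF K(1) one_closed _ m.a_subset] by auto
    then have "\<one> \<in> m" using K(2) ideal_simps(2)[OF m.is_ideal] by (auto simp: m_def)
    then show False using m.one_imp_carrier m.I_notcarr by auto
  qed
  have "maximalideal ((+>) K ` m) (R Quot K)"
  proof (rule maximalidealI[OF im])
    show "carrier (R Quot K) \<noteq> (+>) K ` m" using ne by auto
    fix J assume "ideal J (R Quot K)" "(+>) K ` m \<subseteq> J" "J \<subseteq> carrier (R Quot K)"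
    then show "J = (+>) K ` m \<or> J = carrier (R Quot K)" using sub by blast
  qed
  moreover have "M = (+>) K ` m" if M: "maximalideal M (R Quot K)" for M
  proof -
    interpret M: maximalideal M "R Quot K" by fact
    have "M \<subseteq> (+>) K ` m" using sub[OF M.is_ideal] M.I_notcarr by auto
    then show ?thesis using M.I_maximal[OF im] ideal_simps(7) ne pi.S.ideal_simps(7)[OF im] by auto
  qed
  ultimately show ?thesis unfolding max_ideal_def[of "R Quot K"] m_def[symmetric] by (rule the_equality)
qed

lemma golod_local_powers:
  fixes R :: "('a, 'b) ring_scheme" (structure)
  assumes R: "regular_local_ring R" and I: "ideal I R" "I \<subseteq> max_ideal R"
  shows "\<exists>k0. \<forall>k\<ge>k0. golod_local (R Quot ideal_power R I k)"
proof -
  have loc: "local_ring R" using R by (simp add: regular_local_ring_def)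
  interpret noetherian_cring R
    using R loc by (intro noetherian_cring.intro) (auto simp: regular_local_ring_def local_ring_def)
  define m where "m = max_ideal R"
  have max: "maximalideal m R" unfolding m_def by (rule local_ring_max_ideal(1)[OF loc])
  have prime: "primeideal m R" by (rule maximalideal_prime[OF max])
  obtain xs where xs: "regular_sequence R xs" "Idl (set xs) = m"
    using regular_local_regular_sequence[OF R] by (auto simp: m_def)
  obtain k0 where k0: "k0 \<ge> 1" "\<And>k zs. k \<ge> k0 \<Longrightarrow>
      minimal_generators (R Quot ideal_power R I k) ((+>) (ideal_power R I k) ` m) zs \<Longrightarrow>
      set zs \<subseteq> (+>) (ideal_power R I k) ` carrier R \<Longrightarrow>
      golod_wrt (R Quot ideal_power R I k) ((+>) (ideal_power R I k) ` m) zs"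
    using golod_quotient_powers[OF max xs I(1) _ order_refl] 
      local_nakayama[OF prime local_ring_units[OF loc, folded m_def]] I(2)
    unfolding m_def[symmetric] by blast
  have "golod_local (R Quot ideal_power R I k)" if k: "k \<ge> k0" for k
  proof -
    have K: "ideal (ideal_power R I k) R" by (rule ideal_power_ideal[OF I(1)])
    have "ideal_power R I k \<subseteq> ideal_power R I (Suc 0)"
      by (rule ideal_power_antimono[OF I(1)]) (use k k0(1) in auto)
    also have "\<dots> \<subseteq> I" using ideal_prod_inter[OF oneideal I(1)] by auto
    finally have Km: "ideal_power R I k \<subseteq> max_ideal R" using I(2) by auto
    have surj: "carrier (R Quot ideal_power R I k) = (+>) (ideal_power R I k) ` carrier R"
      unfolding FactRing_def A_RCOSETS_def' by auto
    show ?thesis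
      unfolding golod_local_def max_ideal_quotient[OF loc K Km] m_def[symmetric]
      using k0(2)[OF k] surj by (auto simp: minimal_generators_def)
  qed
  then show ?thesis by blast
qed

lemma golod_graded_powers:
  fixes J :: "((nat \<Rightarrow>\<^sub>0 nat) \<Rightarrow>\<^sub>0 'k::field) set"
  assumes J: "ideal J (polynomial_ring n)" "J \<subseteq> graded_max_ideal (polynomial_ring n) (polynomial_grading n)"
  shows "\<exists>k0. \<forall>k\<ge>k0. golod_graded (polynomial_ring n Quot ideal_power (polynomial_ring n) J k)
     (quotient_grading (polynomial_ring n) (polynomial_grading n) (ideal_power (polynomial_ring n) J k))"
proof -
  define P where "P = (polynomial_ring n :: ((nat \<Rightarrow>\<^sub>0 nat) \<Rightarrow>\<^sub>0 'k) ring)"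
  interpret polynomials n P by unfold_locales (simp add: P_def)
  define G where "G = (polynomial_grading n :: nat \<Rightarrow> ((nat \<Rightarrow>\<^sub>0 nat) \<Rightarrow>\<^sub>0 'k) set)"
  define H where "H = homogeneous_elements G"
  have Gc: "G i \<subseteq> carrier P" for i by (auto simp: G_def grading_def')
  have Hc: "H \<subseteq> carrier P" using Gc by (auto simp: H_def homogeneous_elements_def)
  have M: "graded_max_ideal P G = M0" by (simp add: G_def graded_max_ideal_P)
  have JP: "ideal J P" "J \<subseteq> M0" using J unfolding P_def[symmetric] G_def[symmetric] M by auto
  have vars: "Idl\<^bsub>P\<^esub> (set (map poly_var [0..<n])) = M0"
    unfolding M0_vars by (simp add: lessThan_atLeast0)
  have nak: "Idl\<^bsub>P\<^esub> Y = M0" if "Y \<subseteq> H" "Y \<subseteq> M0" "M0 \<subseteq> Idl\<^bsub>P\<^esub> (Y \<union> ideal_prod P M0 M0)" for Y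
    using that by (intro graded_nakayama) (auto simp: H_def G_def)
  obtain k0 where k0: "\<And>k zs. k \<ge> k0 \<Longrightarrow>
      minimal_generators (P Quot ideal_power P J k) (a_r_coset P (ideal_power P J k) ` M0) zs \<Longrightarrow>
      set zs \<subseteq> a_r_coset P (ideal_power P J k) ` H \<Longrightarrow>
      golod_wrt (P Quot ideal_power P J k) (a_r_coset P (ideal_power P J k) ` M0) zs"
    using golod_quotient_powers[OF M0_maximal vars_regular vars JP Hc nak] by blast
  have "golod_graded (P Quot ideal_power P J k) (quotient_grading P G (ideal_power P J k))" if k: "k \<ge> k0" for k
  proof -
    define K where "K = ideal_power P J k"
    have K: "ideal K P" unfolding K_def by (rule ideal_power_ideal[OF JP(1)])
    have "(\<Union>i\<in>{1..}. quotient_grading P G K i) = a_r_coset P K ` (\<Union>i\<in>{1..}. G i)"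
      by (auto simp: quotient_grading_def)
    moreover have "(\<Union>i\<in>{1..}. G i) \<subseteq> carrier P" using Gc by auto
    ultimately have gm: "graded_max_ideal (P Quot K) (quotient_grading P G K) = a_r_coset P K ` M0"
      unfolding M[symmetric] graded_max_ideal_def using Idl_quotient[OF K] by simp
    have "homogeneous_elements (quotient_grading P G K) = a_r_coset P K ` H"
      by (auto simp: homogeneous_elements_def quotient_grading_def H_def)
    then show ?thesis
      unfolding golod_graded_def K_def[symmetric] gm using k0[OF k] by (auto simp: K_def)
  qed
  then show ?thesis unfolding P_def G_def by blast
qed

theorem theorem4p1:
  fixes R :: "('a, 'b) ring_scheme" and I :: "'a set"
    and n :: nat and J :: "((nat \<Rightarrow>\<^sub>0 nat) \<Rightarrow>\<^sub>0 'k::field) set"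
  shows "(regular_local_ring R \<and> ideal I R \<and> I \<subseteq> max_ideal R \<longrightarrow>
            (\<exists>k0. \<forall>k\<ge>k0. golod_local (R Quot ideal_power R I k))) \<and>
         (graded_ideal (polynomial_ring n) (polynomial_grading n) J \<and>
            J \<subseteq> graded_max_ideal (polynomial_ring n) (polynomial_grading n) \<longrightarrow>
            (\<exists>k0. \<forall>k\<ge>k0. golod_graded (polynomial_ring n Quot ideal_power (polynomial_ring n) J k)
               (quotient_grading (polynomial_ring n) (polynomial_grading n)
                  (ideal_power (polynomial_ring n) J k))))"
  using golod_local_powers[of R I] golod_graded_powers[of J n] unfolding graded_ideal_def by blast

end
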